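(* Let $V$ be a nonempty open subset of $\ell^2$. Then $V$ is a pseudo-convex domain of $\ell^2$ if and only if there exists an exhaustion function $\eta\in C^\infty_{F^\infty}(V)$ on $V$ such that $\eta$ is plurisubharmonic on $V$.
   Context: $\ell^2$ is the complex Hilbert space of square-summable complex sequences $\mathbf z=(z_j)_{j\ge1}$, $z_j=x_j+\sqrt{-1}\,y_j$ with $x_j,y_j\in\mathbb R$, with its canonical norm $\|\cdot\|$. Plurisubharmonic: a real-valued continuous function $f$ on an open subset $O$ of a complex Banach space $X$ is plurisubharmonic on $O$ if $f(a)\le\frac1{2\pi}\int_0^{2\pi}f(a+e^{\sqrt{-1}\theta}b)\,d\theta$ for all $a\in O$, $b\in X$ with $\{a+\lambda b:\lambda\in\mathbb C,|\lambda|\le1\}\subset O$. Pseudo-convex: an open subset $O$ of a finite-dimensional complex normed space is pseudo-convex if there is a plurisubharmonic function $\eta$ on $O$ such that $\{x\in O:\eta(x)<t\}$ is relatively compact in $O$ for all $t\in\mathbb R$ (the empty set is regarded as pseudo-convex). A nonempty open subset $V$ of $\ell^2$ is a pseudo-convex domain if $V\cap M$ is pseudo-convex in $M$ for each finite-dimensional complex linear subspace $M$ of $\ell^2$. (Connectedness is not required.) Uniform inclusion: for a nonempty bounded $S\subset V$ put $d(S,\partial V)=\inf\{\|\mathbf z_1-\mathbf z_2\|:\mathbf z_1\in S,\mathbf z_2\in\partial V\}$ if $V\ne\ell^2$ and $d(S,\partial V)=+\infty$ if $V=\ell^2$. $S$ is uniformly included in $V$, written $S\stackrel{\circ}{\subset}V$,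 if $S$ is bounded and $d(S,\partial V)>0$; the empty set is also counted as uniformly included. Exhaustion function on $V$: a real-valued function $\eta$ on $V$ such that $\{\mathbf z\in V:\eta(\mathbf z)\le t\}\stackrel{\circ}{\subset}V$ for every $t\in\mathbb R$. Function spaces: partial derivatives $\partial/\partial x_j$ and $\partial/\partial y_j$ are the usual limits of difference quotients in the $j$-th coordinate along real increments $\tau$ and imaginary increments $\sqrt{-1}\,\tau$ ($\tau\in\mathbb R$). $C^k(V)$ is the set of $f:V\to\mathbb C$ such that $f$ and all its partial derivatives (in the variables $x_j,y_j$, $j\ge1$) of order up to $k$ exist and are continuous on $V$; $C^\infty(V)=\bigcap_kC^k(V)$. Put $\partial_j=\frac12(\frac{\partial}{\partial x_j}-\sqrt{-1}\frac{\partial}{\partial y_j})$, $\overline\partial_j=\frac12(\frac{\partial}{\partial x_j}+\sqrt{-1}\frac{\partial}{\partial y_j})$ and, for finitely supported sequences $\alpha,\beta$ of nonnegative integers, $\partial_\alpha=\prod_j\partial_j^{\alpha_j}$, $\overline\partial_\beta=\prod_j\overline\partial_j^{\beta_j}$. $C^1_F(V)$ is the set of $f\in C^1(V)$ with $\sup_S\{|f|+\sum_{j\ge1}(|\partial_jf|^2+|\overline\partial_jf|^2)\}<\infty$ for every $S\stackrel{\circ}{\subset}V$. $C^\infty_{F^\infty}(V)$ is the set of $f\in C^\infty(V)$ such that $\partial_\alpha\overline\partial_\beta f\in C^1_F(V)$ for all finitely supported multi-indices $\alpha,\beta$. *)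

theory Defs
  imports "HOL-Analysis.Analysis"
begin

section \<open>The Hilbert space of square-summable complex sequences\<close>

text \<open>Coordinates are indexed from 0, so \<open>coord z j\<close> is the coordinate \<open>z\<^sub>j\<^sub>+\<^sub>1\<close> of the usual
  numbering.\<close>

typedef ell2 = "{z :: nat \<Rightarrow> complex. summable (\<lambda>j. (cmod (z j))\<^sup>2)}"
  morphisms coord Abs_ell2
  by (rule exI[of _ "\<lambda>_. 0"]) simp

setup_lifting type_definition_ell2

lemma summable_coord: "summable (\<lambda>j. (cmod (coord z j))\<^sup>2)"
  using coord[of z] by simp

lemma ell2_eqI: "(\<And>j. coord z j = coord w j) \<Longrightarrow> z = w"
  by (simp add: coord_inject[symmetric] fun_eq_iff)

lemma square_summable_add:
  fixes z w :: "nat \<Rightarrow> complex"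
  assumes "summable (\<lambda>j. (cmod (z j))\<^sup>2)" "summable (\<lambda>j. (cmod (w j))\<^sup>2)"
  shows "summable (\<lambda>j. (cmod (z j + w j))\<^sup>2)"
proof (rule summable_comparison_test')
  show "summable (\<lambda>j. 2 * (cmod (z j))\<^sup>2 + 2 * (cmod (w j))\<^sup>2)"
    by (intro summable_add summable_mult assms)
  fix j :: nat
  have "(cmod (z j + w j))\<^sup>2 \<le> (cmod (z j) + cmod (w j))\<^sup>2"
    by (intro power_mono norm_triangle_ineq norm_ge_zero)
  also have "\<dots> \<le> 2 * (cmod (z j))\<^sup>2 + 2 * (cmod (w j))\<^sup>2"
    using zero_le_power2[of "cmod (z j) - cmod (w j)"]
    by (simp add: power2_eq_square algebra_simps)
  finally show "norm ((cmod (z j + w j))\<^sup>2) \<le> 2 * (cmod (z j))\<^sup>2 + 2 * (cmod (w j))\<^sup>2"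
    by simp
qed

lemma summable_inner_coord: "summable (\<lambda>j. inner (coord z j) (coord w j))"
proof (rule summable_comparison_test')
  show "summable (\<lambda>j. (cmod (coord z j))\<^sup>2 + (cmod (coord w j))\<^sup>2)"
    by (intro summable_add summable_coord)
  fix j :: nat
  have "\<bar>inner (coord z j) (coord w j)\<bar> \<le> cmod (coord z j) * cmod (coord w j)"
    by (rule Cauchy_Schwarz_ineq2)
  also have "\<dots> \<le> 2 * (cmod (coord z j) * cmod (coord w j))"
    by simp
  also have "\<dots> \<le> (cmod (coord z j))\<^sup>2 + (cmod (coord w j))\<^sup>2"
    using sum_squares_bound[of "cmod (coord z j)" "cmod (coord w j)"] by simp
  finally show "norm (inner (coord z j) (coord w j))
      \<le> (cmod (coord z j))\<^sup>2 + (cmod (coord w j))\<^sup>2"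
    by simp
qed

instantiation ell2 :: real_inner
begin

lift_definition zero_ell2 :: ell2 is "\<lambda>_. 0" by simp

lift_definition plus_ell2 :: "ell2 \<Rightarrow> ell2 \<Rightarrow> ell2" is "\<lambda>z w j. z j + w j"
  by (rule square_summable_add)

lift_definition uminus_ell2 :: "ell2 \<Rightarrow> ell2" is "\<lambda>z j. - z j" by simp

lift_definition minus_ell2 :: "ell2 \<Rightarrow> ell2 \<Rightarrow> ell2" is "\<lambda>z w j. z j - w j"
  subgoal for z w using square_summable_add[of z "\<lambda>j. - w j"] by simp
  done

lift_definition scaleR_ell2 :: "real \<Rightarrow> ell2 \<Rightarrow> ell2" is "\<lambda>r z j. r *\<^sub>R z j"
  by (simp add: power_mult_distrib summable_mult)

text \<open>The real part of the Hermitian inner product.\<close>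
definition inner_ell2 :: "ell2 \<Rightarrow> ell2 \<Rightarrow> real" where
  "inner_ell2 z w = (\<Sum>j. inner (coord z j) (coord w j))"

definition norm_ell2 :: "ell2 \<Rightarrow> real" where
  "norm_ell2 z = sqrt (\<Sum>j. (cmod (coord z j))\<^sup>2)"

definition dist_ell2 :: "ell2 \<Rightarrow> ell2 \<Rightarrow> real" where
  "dist_ell2 z w = norm (z - w)"

definition sgn_ell2 :: "ell2 \<Rightarrow> ell2" where
  "sgn_ell2 z = inverse (norm z) *\<^sub>R z"

definition uniformity_ell2 :: "(ell2 \<times> ell2) filter" where
  "uniformity_ell2 = (INF e\<in>{0 <..}. principal {(x, y). dist x y < e})"

definition open_ell2 :: "ell2 set \<Rightarrow> bool" where
  "open_ell2 U = (\<forall>x\<in>U. \<forall>\<^sub>F (x', y) in uniformity. x' = x \<longrightarrow> y \<in> U)"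

instance
proof
  fix x y z :: ell2 and r s :: real and U :: "ell2 set"
  show "x + y + z = x + (y + z)" "x + y = y + x" "0 + x = x" "- x + x = 0" "x - y = x + - y"
    by (transfer; simp add: fun_eq_iff)+
  show "r *\<^sub>R (x + y) = r *\<^sub>R x + r *\<^sub>R y" "(r + s) *\<^sub>R x = r *\<^sub>R x + s *\<^sub>R x"
    "r *\<^sub>R s *\<^sub>R x = (r * s) *\<^sub>R x" "1 *\<^sub>R x = x"
    by (transfer; simp add: fun_eq_iff algebra_simps)+
  show "dist x y = norm (x - y)" by (rule dist_ell2_def)
  show "sgn x = inverse (norm x) *\<^sub>R x" by (rule sgn_ell2_def)
  show "uniformity = (INF e\<in>{0 <..}. principal {(x :: ell2, y). dist x y < e})"
    by (rule uniformity_ell2_def)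
  show "open U \<longleftrightarrow> (\<forall>x\<in>U. \<forall>\<^sub>F (x', y) in uniformity. x' = x \<longrightarrow> y \<in> U)"
    by (rule open_ell2_def)
  show "inner x y = inner y x"
    by (simp add: inner_ell2_def inner_commute)
  show "inner (x + y) z = inner x z + inner y z"
    by (simp add: inner_ell2_def plus_ell2.rep_eq inner_add_left
        suminf_add[OF summable_inner_coord summable_inner_coord])
  show "inner (r *\<^sub>R x) y = r * inner x y"
    by (simp add: inner_ell2_def scaleR_ell2.rep_eq suminf_mult[OF summable_inner_coord])
  show "0 \<le> inner x x"
    unfolding inner_ell2_def by (intro suminf_nonneg summable_inner_coord) simp
  show "inner x x = 0 \<longleftrightarrow> x = 0"
    unfolding inner_ell2_def
    by (subst suminf_eq_zero_iff[OF summable_inner_coord])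
      (auto simp: zero_ell2.rep_eq intro: ell2_eqI)
  show "norm x = sqrt (inner x x)"
    by (simp add: norm_ell2_def inner_ell2_def power2_norm_eq_inner)
qed

end

lift_definition scaleC :: "complex \<Rightarrow> ell2 \<Rightarrow> ell2" (infixr "*\<^sub>C" 75) is "\<lambda>c z j. c * z j"
  by (simp add: norm_mult power_mult_distrib summable_mult)

interpretation cvec: vector_space scaleC
  by unfold_locales (transfer; simp add: fun_eq_iff algebra_simps)+

lift_definition unit_vec :: "nat \<Rightarrow> ell2" is "\<lambda>j k. if k = j then 1 else 0"
  subgoal for j by (rule summable_finite[of "{j}"]) auto
  done

section \<open>Plurisubharmonic functions and pseudo-convexity\<close>

text \<open>\<open>X\<close> is the ambient complex Banach space: the whole of \<open>ell2\<close> (\<open>X = UNIV\<close>) or a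
  finite-dimensional complex subspace. Openness of \<open>U\<close> is relative to \<open>X\<close>.\<close>

definition plurisubharmonic_on :: "ell2 set \<Rightarrow> ell2 set \<Rightarrow> (ell2 \<Rightarrow> real) \<Rightarrow> bool" where
  "plurisubharmonic_on X U f \<longleftrightarrow>
     openin (top_of_set X) U \<and> continuous_on U f \<and>
     (\<forall>a\<in>U. \<forall>b\<in>X. (\<forall>c. cmod c \<le> 1 \<longrightarrow> a + c *\<^sub>C b \<in> U) \<longrightarrow>
        f a \<le> 1 / (2 * pi) * integral {0..2 * pi} (\<lambda>\<theta>. f (a + cis \<theta> *\<^sub>C b)))"

definition relatively_compact_in :: "ell2 set \<Rightarrow> ell2 set \<Rightarrow> bool" where
  "relatively_compact_in U S \<longleftrightarrow> compact (closure S) \<and> closure S \<subseteq> U"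

definition pseudoconvex_in :: "ell2 set \<Rightarrow> ell2 set \<Rightarrow> bool" where
  "pseudoconvex_in M U \<longleftrightarrow>
     openin (top_of_set M) U \<and>
     (U = {} \<or> (\<exists>\<eta>. plurisubharmonic_on M U \<eta> \<and>
        (\<forall>t. relatively_compact_in U {x \<in> U. \<eta> x < t})))"

definition finite_dim_csubspace :: "ell2 set \<Rightarrow> bool" where
  "finite_dim_csubspace M \<longleftrightarrow> cvec.subspace M \<and> (\<exists>B. finite B \<and> M = cvec.span B)"

definition pseudoconvex_domain :: "ell2 set \<Rightarrow> bool" where
  "pseudoconvex_domain V \<longleftrightarrow>
     open V \<and> V \<noteq> {} \<and> (\<forall>M. finite_dim_csubspace M \<longrightarrow> pseudoconvex_in M (V \<inter> M))"

section \<open>Uniform inclusion and exhaustion functions\<close>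

definition boundary_dist :: "ell2 set \<Rightarrow> ell2 set \<Rightarrow> ereal" where
  "boundary_dist S V =
     (if V = UNIV then \<infinity> else INF (z, w) \<in> S \<times> frontier V. ereal (norm (z - w)))"

definition uniformly_included :: "ell2 set \<Rightarrow> ell2 set \<Rightarrow> bool" where
  "uniformly_included S V \<longleftrightarrow> S = {} \<or> S \<subseteq> V \<and> bounded S \<and> boundary_dist S V > 0"

definition exhaustion_function :: "ell2 set \<Rightarrow> (ell2 \<Rightarrow> real) \<Rightarrow> bool" where
  "exhaustion_function V \<eta> \<longleftrightarrow> (\<forall>t. uniformly_included {z \<in> V. \<eta> z \<le> t} V)"

section \<open>Function spaces\<close>

text \<open>Functions on the open set \<open>V\<close> are represented by total functions on \<open>ell2\<close>. The values off \<open>V\<close>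
  affect neither the derivatives at points of \<open>V\<close> nor the notions below.\<close>

definition ddir :: "ell2 \<Rightarrow> (ell2 \<Rightarrow> complex) \<Rightarrow> ell2 \<Rightarrow> complex" where
  "ddir v f z = vector_derivative (\<lambda>\<tau>::real. f (z + \<tau> *\<^sub>R v)) (at 0)"

definition has_ddir :: "ell2 \<Rightarrow> (ell2 \<Rightarrow> complex) \<Rightarrow> ell2 \<Rightarrow> bool" where
  "has_ddir v f z \<longleftrightarrow> (\<exists>D. ((\<lambda>\<tau>::real. f (z + \<tau> *\<^sub>R v)) has_vector_derivative D) (at 0))"

abbreviation x_dir :: "nat \<Rightarrow> ell2" where "x_dir j \<equiv> unit_vec j"
abbreviation y_dir :: "nat \<Rightarrow> ell2" where "y_dir j \<equiv> \<i> *\<^sub>C unit_vec j"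

primrec Ck :: "nat \<Rightarrow> ell2 set \<Rightarrow> (ell2 \<Rightarrow> complex) set" where
  "Ck 0 V = {f. continuous_on V f}"
| "Ck (Suc k) V = {f. continuous_on V f \<and>
     (\<forall>v \<in> range x_dir \<union> range y_dir. (\<forall>z\<in>V. has_ddir v f z) \<and> ddir v f \<in> Ck k V)}"

definition C_inf :: "ell2 set \<Rightarrow> (ell2 \<Rightarrow> complex) set" where
  "C_inf V = (\<Inter>k. Ck k V)"

definition d_hol :: "nat \<Rightarrow> (ell2 \<Rightarrow> complex) \<Rightarrow> ell2 \<Rightarrow> complex" where
  "d_hol j f z = 1 / 2 * (ddir (x_dir j) f z - \<i> * ddir (y_dir j) f z)"

definition d_anti :: "nat \<Rightarrow> (ell2 \<Rightarrow> complex) \<Rightarrow> ell2 \<Rightarrow> complex" where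
  "d_anti j f z = 1 / 2 * (ddir (x_dir j) f z + \<i> * ddir (y_dir j) f z)"

text \<open>\<open>d_multi D \<alpha>\<close> is the product of the operators \<open>D j ^^ \<alpha> j\<close> over the (finite) support of
  \<open>\<alpha>\<close>, composed in increasing order of \<open>j\<close>. On smooth functions the order is immaterial.\<close>

definition d_multi ::
  "(nat \<Rightarrow> (ell2 \<Rightarrow> complex) \<Rightarrow> ell2 \<Rightarrow> complex) \<Rightarrow> (nat \<Rightarrow> nat) \<Rightarrow> (ell2 \<Rightarrow> complex) \<Rightarrow> ell2 \<Rightarrow> complex"
where
  "d_multi D \<alpha> = foldr (\<lambda>j. D j ^^ \<alpha> j) (sorted_list_of_set {j. \<alpha> j \<noteq> 0})"

text \<open>The supremum and the series are taken in \<open>[0, \<infinity>]\<close>, so the bound includes convergence of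
  the series at every point of \<open>S\<close>.\<close>

definition C1_F :: "ell2 set \<Rightarrow> (ell2 \<Rightarrow> complex) set" where
  "C1_F V = {f \<in> Ck 1 V. \<forall>S. uniformly_included S V \<longrightarrow>
     (SUP z\<in>S. ennreal (cmod (f z)) +
        (\<Sum>j. ennreal ((cmod (d_hol j f z))\<^sup>2 + (cmod (d_anti j f z))\<^sup>2))) < \<infinity>}"

definition C_inf_F_inf :: "ell2 set \<Rightarrow> (ell2 \<Rightarrow> complex) set" where
  "C_inf_F_inf V = {f \<in> C_inf V. \<forall>\<alpha> \<beta>. finite {j. \<alpha> j \<noteq> 0} \<longrightarrow> finite {j. \<beta> j \<noteq> 0} \<longrightarrow>
     d_multi d_hol \<alpha> (d_multi d_anti \<beta> f) \<in> C1_F V}"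

end

theory Submission
  imports Defs "HOL-Complex_Analysis.Cauchy_Integral_Formula"
begin

text \<open>Let \<open>m\<close> be the distance to the complement of \<open>V\<close>, truncated at 1. A Hartogs argument with the discs
  \<open>c \<mapsto> a + c b + t exp (- P c) v\<close> in the slice spanned by \<open>a, b, v\<close> shows that \<open>- ln m\<close> is
  plurisubharmonic, so \<open>f z = \<parallel>z\<parallel> - ln (m z)\<close> is a plurisubharmonic exhaustion that is Lipschitz on
  its sublevel sets. It is smoothed by composing averages over segments of summable lengths in which
  every coordinate direction recurs infinitely often: differentiating in a coordinate direction turns
  one of the averages into a difference quotient, so all coordinate derivatives exist and remain
  Lipschitz, and a Lipschitz bound controls the square sum of the partial derivatives. The smoothings
  are defined on the whole space and plurisubharmonic on large sublevel sets of \<open>f\<close>; a smooth convex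
  ramp glues a sequence of them.\<close>

section \<open>Box averages and smoothness along directions\<close>

text \<open>Closed balls of \<open>ell2\<close> are not compact, so a continuous function may be
  unbounded on them, and there is no Lebesgue measure to convolve with. Lipschitz bounds on balls
  take the place of compactness; the law of a convergent sum of independent random points on short
  segments takes the place of a mollifier.

  Each derivative divides by the length of the average that it consumes, so the constants depend on
  the direction; but \<open>C_inf_F_inf\<close> asks for bounds for each fixed pair of multi-indices
  separately. The sum over all coordinates in \<open>C1_F\<close> is controlled by a Lipschitz
  constant of the function being differentiated, not by estimates of the single terms.

  Averaging shrinks the set on which a mean value inequality is known by the total length of the
  segments. On a sublevel set of \<open>f\<close> this is affordable, as \<open>m\<close> is bounded
  below there; on all of \<open>V\<close> it is not, hence the gluing.

  The exhaustions that the hypothesis provides on different slices are unrelated, so they are not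
  assembled into a global function. They only confine discs; the boundary distance is what the
  slices have in common.\<close>

definition box_avg :: "'a::real_normed_vector \<Rightarrow> ('a \<Rightarrow> real) \<Rightarrow> 'a \<Rightarrow> real" where
  "box_avg v h x = integral {0..1} (\<lambda>s. h (x + s *\<^sub>R v))"

lemma box_integrable:
  fixes h :: "'a::real_normed_vector \<Rightarrow> real"
  assumes "continuous_on UNIV h"
  shows "(\<lambda>s. h (x + s *\<^sub>R v)) integrable_on {a..b}"
  by (intro integrable_continuous_interval continuous_on_compose2[OF assms] continuous_intros) auto

lemma integral_unit_mono_const:
  fixes f :: "real \<Rightarrow> real"
  assumes "f integrable_on {0..1}"
  shows "(\<And>s. s \<in> {0..1} \<Longrightarrow> c \<le> f s) \<Longrightarrow> c \<le> integral {0..1} f"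
    and "(\<And>s. s \<in> {0..1} \<Longrightarrow> f s \<le> c) \<Longrightarrow> integral {0..1} f \<le> c"
  using integral_le[of "\<lambda>_. c" "{0..1}" f] integral_le[of f "{0..1}" "\<lambda>_. c"] assms by auto

lemma box_avg_diff_le:
  fixes h k :: "'a::real_normed_vector \<Rightarrow> real"
  assumes "continuous_on UNIV h" "continuous_on UNIV k"
    and "\<And>s. s \<in> {0..1} \<Longrightarrow> \<bar>h (x + s *\<^sub>R v) - k (y + s *\<^sub>R v)\<bar> \<le> c"
  shows "\<bar>box_avg v h x - box_avg v k y\<bar> \<le> c"
proof -
  have "box_avg v h x - box_avg v k y
      = integral {0..1} (\<lambda>s. h (x + s *\<^sub>R v) - k (y + s *\<^sub>R v))"
    unfolding box_avg_def by (intro Henstock_Kurzweil_Integration.integral_diff[symmetric] box_integrable assms)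
  moreover have "\<dots> \<le> c" "- c \<le> \<dots>"
    using assms(3) by (force intro!: integral_unit_mono_const integrable_diff box_integrable assms)+
  ultimately show ?thesis by linarith
qed

lemma box_avg_near:
  fixes h :: "'a::real_normed_vector \<Rightarrow> real" and x v :: 'a
  assumes "continuous_on UNIV h" "\<And>s. s \<in> {0..1} \<Longrightarrow> \<bar>h (x + s *\<^sub>R v) - y\<bar> \<le> c"
  shows "\<bar>box_avg v h x - y\<bar> \<le> c"
proof -
  have "box_avg v (\<lambda>_. y) x = y" by (simp add: box_avg_def)
  then show ?thesis
    using box_avg_diff_le[OF assms(1) continuous_on_const, where x = x and v = v and y = x and c = c]
      assms(2) by (metis (no_types, lifting))
qed

section \<open>Functions that are Lipschitz on every ball\<close>

text \<open>Stronger than Lipschitz near every point, since balls need not be compact. Unlike a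
  global Lipschitz bound it survives products, as the product and chain rules require, and it still
  bounds the function on bounded sets.\<close>

definition loc_lipschitz :: "('a::real_normed_vector \<Rightarrow> real) \<Rightarrow> bool" where
  "loc_lipschitz f \<longleftrightarrow> (\<forall>R. \<exists>L. L-lipschitz_on (cball 0 R) f)"

lemma loc_lipschitz_continuous:
  fixes f :: "'a::real_normed_vector \<Rightarrow> real"
  assumes "loc_lipschitz f"
  shows "continuous_on UNIV f"
proof (subst continuous_on_eq_continuous_at, simp, intro ballI)
  fix x :: 'a
  obtain L where "L-lipschitz_on (cball 0 (norm x + 1)) f"
    using assms unfolding loc_lipschitz_def by blast
  then have "continuous_on (ball 0 (norm x + 1)) f"
    by (intro lipschitz_on_continuous_on) (auto intro: lipschitz_on_subset)
  then show "isCont f x"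
    by (simp add: continuous_on_eq_continuous_at)
qed

lemma loc_lipschitz_bounded:
  assumes "loc_lipschitz f"
  obtains B where "0 \<le> B" "\<And>x. x \<in> cball 0 R \<Longrightarrow> \<bar>f x\<bar> \<le> B"
proof (cases "0 \<le> R")
  case True
  obtain L where L: "L-lipschitz_on (cball 0 R) f"
    using assms unfolding loc_lipschitz_def by blast
  show ?thesis
  proof
    show "0 \<le> \<bar>f 0\<bar> + L * R" using L True by (simp add: lipschitz_on_nonneg)
    show "\<bar>f x\<bar> \<le> \<bar>f 0\<bar> + L * R" if "x \<in> cball 0 R" for x
    proof -
      have "\<bar>f x - f 0\<bar> \<le> L * norm x"
        using lipschitz_on_normD[OF L, of x 0] that True by simp
      also have "\<dots> \<le> L * R" using that L by (simp add: lipschitz_on_nonneg mult_left_mono)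
      finally show ?thesis by linarith
    qed
  qed
next
  case False
  then show ?thesis using that[of 0] by auto
qed

lemma loc_lipschitzI:
  assumes "\<And>R. 0 \<le> R \<Longrightarrow> \<exists>L\<ge>0. \<forall>x\<in>cball 0 R. \<forall>y\<in>cball 0 R. \<bar>f x - f y\<bar> \<le> L * norm (x - y)"
  shows "loc_lipschitz f"
  unfolding loc_lipschitz_def
proof
  fix R :: real
  show "\<exists>L. L-lipschitz_on (cball 0 R) f"
  proof (cases "0 \<le> R")
    case True
    from assms[OF this] show ?thesis
      by (auto simp: lipschitz_on_def dist_norm simp del: mem_cball)
  next
    case False
    then have "cball (0::'a) R = {}" by simp
    then show ?thesis by (metis lipschitz_on_def empty_iff order_refl)
  qed
qed

lemma loc_lipschitzE:
  assumes "loc_lipschitz f"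
  obtains L where "0 \<le> L" "\<And>x y. x \<in> cball 0 R \<Longrightarrow> y \<in> cball 0 R \<Longrightarrow> \<bar>f x - f y\<bar> \<le> L * norm (x - y)"
proof -
  obtain L where "L-lipschitz_on (cball 0 R) f"
    using assms unfolding loc_lipschitz_def by blast
  then show thesis
    by (intro that[of L]) (auto simp: lipschitz_on_def dist_norm)
qed

lemma lipschitz_imp_loc: "L-lipschitz_on UNIV f \<Longrightarrow> loc_lipschitz f"
  unfolding loc_lipschitz_def using lipschitz_on_subset subset_UNIV by blast

lemma loc_lipschitz_const: "loc_lipschitz (\<lambda>_. c)"
  by (rule loc_lipschitzI) auto

lemma loc_lipschitz_add:
  assumes "loc_lipschitz f" "loc_lipschitz g"
  shows "loc_lipschitz (\<lambda>x. f x + g x)"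
  unfolding loc_lipschitz_def
proof
  fix R :: real
  obtain L M where "L-lipschitz_on (cball 0 R) f" "M-lipschitz_on (cball 0 R) g"
    using assms unfolding loc_lipschitz_def by blast
  then show "\<exists>L. L-lipschitz_on (cball 0 R) (\<lambda>x. f x + g x)"
    by (blast intro: lipschitz_on_add)
qed

lemma loc_lipschitz_mult:
  assumes "loc_lipschitz f" "loc_lipschitz g"
  shows "loc_lipschitz (\<lambda>x. f x * g x)"
proof (rule loc_lipschitzI)
  fix R :: real
  obtain L where L: "0 \<le> L"
    "\<And>x y. x \<in> cball 0 R \<Longrightarrow> y \<in> cball 0 R \<Longrightarrow> \<bar>f x - f y\<bar> \<le> L * norm (x - y)"
    using loc_lipschitzE[OF assms(1)] by metis
  obtain L' where L': "0 \<le> L'"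
    "\<And>x y. x \<in> cball 0 R \<Longrightarrow> y \<in> cball 0 R \<Longrightarrow> \<bar>g x - g y\<bar> \<le> L' * norm (x - y)"
    using loc_lipschitzE[OF assms(2)] by metis
  obtain B where B: "0 \<le> B" "\<And>x. x \<in> cball 0 R \<Longrightarrow> \<bar>f x\<bar> \<le> B"
    using loc_lipschitz_bounded[OF assms(1)] by metis
  obtain B' where B': "0 \<le> B'" "\<And>x. x \<in> cball 0 R \<Longrightarrow> \<bar>g x\<bar> \<le> B'"
    using loc_lipschitz_bounded[OF assms(2)] by metis
  have "\<bar>f x * g x - f y * g y\<bar> \<le> (B * L' + L * B') * norm (x - y)"
    if "x \<in> cball 0 R" "y \<in> cball 0 R" for x y
  proof -
    have "\<bar>f x * g x - f y * g y\<bar> = \<bar>f x * (g x - g y) + (f x - f y) * g y\<bar>"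
      by (simp add: algebra_simps)
    also have "\<dots> \<le> \<bar>f x\<bar> * \<bar>g x - g y\<bar> + \<bar>f x - f y\<bar> * \<bar>g y\<bar>"
      by (metis abs_mult abs_triangle_ineq)
    also have "\<dots> \<le> B * (L' * norm (x - y)) + (L * norm (x - y)) * B'"
      by (intro add_mono mult_mono L L' B B' that) (use L L' B B' in auto)
    finally show ?thesis by (simp add: algebra_simps)
  qed
  then show "\<exists>L\<ge>0. \<forall>x\<in>cball 0 R. \<forall>y\<in>cball 0 R. \<bar>f x * g x - f y * g y\<bar> \<le> L * norm (x - y)"
    using L L' B B' by (intro exI[of _ "B * L' + L * B'"]) auto
qed

lemma loc_lipschitz_compose:
  fixes \<phi> :: "real \<Rightarrow> real"
  assumes "loc_lipschitz \<phi>" "loc_lipschitz f"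
  shows "loc_lipschitz (\<lambda>x. \<phi> (f x))"
proof (rule loc_lipschitzI)
  fix R :: real
  obtain L where L: "0 \<le> L"
    "\<And>x y. x \<in> cball 0 R \<Longrightarrow> y \<in> cball 0 R \<Longrightarrow> \<bar>f x - f y\<bar> \<le> L * norm (x - y)"
    using loc_lipschitzE[OF assms(2)] by metis
  obtain B where B: "0 \<le> B" "\<And>x. x \<in> cball 0 R \<Longrightarrow> \<bar>f x\<bar> \<le> B"
    using loc_lipschitz_bounded[OF assms(2)] by metis
  obtain L' where L': "0 \<le> L'"
    "\<And>x y. x \<in> cball 0 B \<Longrightarrow> y \<in> cball 0 B \<Longrightarrow> \<bar>\<phi> x - \<phi> y\<bar> \<le> L' * norm (x - y)"
    using loc_lipschitzE[OF assms(1)] by metis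
  have "\<bar>\<phi> (f x) - \<phi> (f y)\<bar> \<le> (L' * L) * norm (x - y)"
    if "x \<in> cball 0 R" "y \<in> cball 0 R" for x y
  proof -
    have "\<bar>\<phi> (f x) - \<phi> (f y)\<bar> \<le> L' * \<bar>f x - f y\<bar>"
      using L'(2)[of "f x" "f y"] B that by simp
    also have "\<dots> \<le> L' * (L * norm (x - y))"
      by (intro mult_left_mono L L' that)
    finally show ?thesis by (simp add: algebra_simps)
  qed
  then show "\<exists>L\<ge>0. \<forall>x\<in>cball 0 R. \<forall>y\<in>cball 0 R. \<bar>\<phi> (f x) - \<phi> (f y)\<bar> \<le> L * norm (x - y)"
    using L L' by (intro exI[of _ "L' * L"]) auto
qed

lemma loc_lipschitz_shift:
  assumes "loc_lipschitz f"
  shows "loc_lipschitz (\<lambda>x. f (x + v))"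
proof (rule loc_lipschitzI)
  fix R :: real
  obtain L where L: "0 \<le> L" "\<And>x y. x \<in> cball 0 (R + norm v) \<Longrightarrow> y \<in> cball 0 (R + norm v)
      \<Longrightarrow> \<bar>f x - f y\<bar> \<le> L * norm (x - y)"
    using loc_lipschitzE[OF assms] by metis
  have "x + v \<in> cball 0 (R + norm v)" if "x \<in> cball 0 R" for x
    using that norm_triangle_ineq[of x v] by simp
  then show "\<exists>L\<ge>0. \<forall>x\<in>cball 0 R. \<forall>y\<in>cball 0 R. \<bar>f (x + v) - f (y + v)\<bar> \<le> L * norm (x - y)"
    using L by (intro exI[of _ L]) (metis add_diff_cancel_right)
qed

lemma loc_lipschitz_box_avg:
  assumes "loc_lipschitz f"
  shows "loc_lipschitz (box_avg v f)"
proof (rule loc_lipschitzI)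
  fix R :: real
  obtain L where L: "0 \<le> L" "\<And>x y. x \<in> cball 0 (R + norm v) \<Longrightarrow> y \<in> cball 0 (R + norm v)
      \<Longrightarrow> \<bar>f x - f y\<bar> \<le> L * norm (x - y)"
    using loc_lipschitzE[OF assms] by metis
  have *: "x + s *\<^sub>R v \<in> cball 0 (R + norm v)" if "x \<in> cball 0 R" "s \<in> {0..1}" for x s
  proof -
    have "norm (x + s *\<^sub>R v) \<le> norm x + \<bar>s\<bar> * norm v"
      by (metis norm_triangle_ineq norm_scaleR)
    also have "\<dots> \<le> R + 1 * norm v"
      using that by (intro add_mono mult_right_mono) auto
    finally show ?thesis by simp
  qed
  show "\<exists>L\<ge>0. \<forall>x\<in>cball 0 R. \<forall>y\<in>cball 0 R. \<bar>box_avg v f x - box_avg v f y\<bar> \<le> L * norm (x - y)"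
  proof (intro exI[of _ L] conjI ballI L box_avg_diff_le loc_lipschitz_continuous assms)
    fix x y :: 'a and s :: real
    assume "x \<in> cball 0 R" "y \<in> cball 0 R" "s \<in> {0..1}"
    then show "\<bar>f (x + s *\<^sub>R v) - f (y + s *\<^sub>R v)\<bar> \<le> L * norm (x - y)"
      using L(2)[OF * *, of x s y s] by simp
  qed
qed

lemma lipschitz_box_avg:
  assumes "L-lipschitz_on UNIV f"
  shows "L-lipschitz_on UNIV (box_avg v f)"
proof (rule lipschitz_onI)
  fix x y
  have "\<bar>box_avg v f x - box_avg v f y\<bar> \<le> L * norm (x - y)"
    using lipschitz_on_normD[OF assms]
    by (intro box_avg_diff_le lipschitz_on_continuous_on[OF assms])
      (metis UNIV_I add_diff_cancel_right real_norm_def)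
  then show "dist (box_avg v f x) (box_avg v f y) \<le> L * dist x y" by (simp add: dist_norm)
qed (use assms lipschitz_on_nonneg in auto)

section \<open>Derivatives along a direction\<close>

definition has_dderiv :: "'a::real_normed_vector \<Rightarrow> ('a \<Rightarrow> real) \<Rightarrow> ('a \<Rightarrow> real) \<Rightarrow> bool" where
  "has_dderiv v f f' \<longleftrightarrow> (\<forall>x. ((\<lambda>\<tau>. f (x + \<tau> *\<^sub>R v)) has_real_derivative f' x) (at 0))"

lemma has_dderivD:
  assumes "has_dderiv v f f'"
  shows "((\<lambda>\<tau>. f (x + \<tau> *\<^sub>R v)) has_real_derivative f' (x + t *\<^sub>R v)) (at t within S)"
proof -
  have "((\<lambda>\<tau>. f ((x + t *\<^sub>R v) + \<tau> *\<^sub>R v)) has_real_derivative f' (x + t *\<^sub>R v)) (at (t - t))"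
    using assms by (simp add: has_dderiv_def)
  then have "((\<lambda>\<tau>. f ((x + t *\<^sub>R v) + (\<tau> - t) *\<^sub>R v)) has_real_derivative f' (x + t *\<^sub>R v)) (at t)"
    using DERIV_shift[of "\<lambda>\<tau>. f ((x + t *\<^sub>R v) + \<tau> *\<^sub>R v)" _ t "- t"] by simp
  then show ?thesis by (simp add: algebra_simps has_field_derivative_at_within)
qed

text \<open>Along the line through \<open>x\<close>, substitution turns the average into
  \<open>1 / e\<close> times the integral of \<open>h\<close> over a window of length
  \<open>e\<close> starting at \<tau>; differentiating it leaves the values at the two ends.\<close>

lemma has_dderiv_box_avg_self:
  fixes h :: "'a::real_normed_vector \<Rightarrow> real"
  assumes h: "continuous_on UNIV h" and e: "0 < e"
  shows "has_dderiv v (box_avg (e *\<^sub>R v) h) (\<lambda>x. (h (x + e *\<^sub>R v) - h x) / e)"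
  unfolding has_dderiv_def
proof
  fix x
  let ?k = "\<lambda>s. h (x + s *\<^sub>R v)"
  \<comment> \<open>Any base point left of 0 serves: \<open>?H\<close> has two-sided derivatives at
    0 and at \<open>e\<close>.\<close>
  let ?H = "\<lambda>\<tau>. integral {-1..\<tau>} ?k"
  have k: "continuous_on S ?k" for S
    by (intro continuous_on_compose2[OF h] continuous_intros) auto
  have H: "(?H has_real_derivative ?k t) (at t)" if "-1 < t" for t
  proof -
    have "(?H has_real_derivative ?k t) (at t within {-1..t+1})"
      by (rule integral_has_real_derivative[OF k]) (use that in auto)
    then show ?thesis using at_within_Icc_at[of "-1" t "t+1"] that by simp
  qed
  have eq: "box_avg (e *\<^sub>R v) h (x + \<tau> *\<^sub>R v) = (?H (\<tau> + e) - ?H \<tau>) / e" if "-1 < \<tau>" for \<tau>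
  proof -
    have "(?k has_integral integral {\<tau>..\<tau>+e} ?k) (cbox \<tau> (\<tau>+e))"
      using integrable_integral[OF box_integrable[OF h]] by simp
    from has_integral_affinity'[OF this e, of \<tau>]
    have "((\<lambda>s. ?k (e *\<^sub>R s + \<tau>)) has_integral integral {\<tau>..\<tau>+e} ?k / e) {0..1}"
      using e by (simp add: divide_inverse mult.commute)
    then have "box_avg (e *\<^sub>R v) h (x + \<tau> *\<^sub>R v) = integral {\<tau>..\<tau>+e} ?k / e"
      unfolding box_avg_def
      by (intro integral_unique) (simp only: scaleR_scaleR scaleR_add_left add.assoc add.commute[of "\<tau> *\<^sub>R v"] real_scaleR_def mult.commute[of e])
    also have "integral {\<tau>..\<tau>+e} ?k = ?H (\<tau> + e) - ?H \<tau>"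
      using Henstock_Kurzweil_Integration.integral_combine[of "-1" \<tau> "\<tau>+e" ?k]
        box_integrable[OF h] that e by auto
    finally show ?thesis .
  qed
  have He: "((\<lambda>\<tau>. ?H (\<tau> + e)) has_real_derivative ?k e) (at 0)"
    using H[of e] e DERIV_shift[of ?H "?k e" 0 e] by simp
  have "((\<lambda>\<tau>. (?H (\<tau> + e) - ?H \<tau>) / e) has_real_derivative (h (x + e *\<^sub>R v) - h x) / e) (at 0)"
    using e DERIV_cdivide[OF DERIV_diff[OF He H[of 0]], of e] by simp
  moreover have "\<forall>\<^sub>F \<tau> in nhds 0. (?H (\<tau> + e) - ?H \<tau>) / e = box_avg (e *\<^sub>R v) h (x + \<tau> *\<^sub>R v)"
    using eventually_nhds_in_open[of "{-1<..}" "0::real"] eq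
    by (auto elim!: eventually_mono)
  ultimately show "((\<lambda>\<tau>. box_avg (e *\<^sub>R v) h (x + \<tau> *\<^sub>R v)) has_real_derivative
      (h (x + e *\<^sub>R v) - h x) / e) (at 0)"
    by (rule DERIV_cong_ev[OF refl _ refl, THEN iffD1, rotated])
qed

lemma has_dderiv_box_avg:
  fixes h :: "'a::real_normed_vector \<Rightarrow> real"
  assumes h: "continuous_on UNIV h" and h': "continuous_on UNIV h'" and d: "has_dderiv v h h'"
  shows "has_dderiv v (box_avg w h) (box_avg w h')"
  unfolding has_dderiv_def
proof
  fix x
  have "((\<lambda>\<tau>. integral (cbox 0 1) (\<lambda>s. h (x + s *\<^sub>R w + \<tau> *\<^sub>R v))) has_vector_derivative
      integral (cbox 0 1) (\<lambda>s. h' (x + s *\<^sub>R w + 0 *\<^sub>R v))) (at 0 within UNIV)"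
  proof (rule leibniz_rule_vector_derivative)
    show "((\<lambda>\<tau>. h (x + s *\<^sub>R w + \<tau> *\<^sub>R v)) has_vector_derivative h' (x + s *\<^sub>R w + t *\<^sub>R v))
        (at t within UNIV)" for t s
      using has_dderivD[OF d, of "x + s *\<^sub>R w" t UNIV]
      by (simp add: has_real_derivative_iff_has_vector_derivative)
    show "(\<lambda>s. h (x + s *\<^sub>R w + t *\<^sub>R v)) integrable_on cbox 0 1" for t
      unfolding cbox_interval
      by (intro integrable_continuous_interval continuous_on_compose2[OF h] continuous_intros) auto
    show "continuous_on (UNIV \<times> cbox 0 1) (\<lambda>(t, s). h' (x + s *\<^sub>R w + t *\<^sub>R v))"
      unfolding case_prod_beta
      by (intro continuous_on_compose2[OF h'] continuous_intros) auto
  qed auto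
  then show "((\<lambda>\<tau>. box_avg w h (x + \<tau> *\<^sub>R v)) has_real_derivative box_avg w h' x) (at 0)"
    by (simp add: box_avg_def has_real_derivative_iff_has_vector_derivative algebra_simps)
qed

section \<open>Iterated derivatives along a set of directions\<close>

text \<open>Lipschitz bounds are demanded at every level because the estimate of all coordinate
  derivatives at once rests on them. With \<open>{1}\<close> as the set of directions of the real
  line, this is the class of outer functions for the chain rule.\<close>

primrec smooth_along :: "'a::real_normed_vector set \<Rightarrow> nat \<Rightarrow> ('a \<Rightarrow> real) \<Rightarrow> bool" where
  "smooth_along D 0 f \<longleftrightarrow> loc_lipschitz f"
| "smooth_along D (Suc n) f \<longleftrightarrow> loc_lipschitz f \<and> (\<forall>v\<in>D. \<exists>f'. has_dderiv v f f' \<and> smooth_along D n f')"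

lemma smooth_along_lipschitz: "smooth_along D n f \<Longrightarrow> loc_lipschitz f"
  by (cases n) auto

lemma smooth_along_Suc: "smooth_along D (Suc n) f \<Longrightarrow> smooth_along D n f"
proof (induction n arbitrary: f)
  case (Suc n)
  then show ?case by (metis smooth_along.simps(2))
qed simp

lemma smooth_along_const: "smooth_along D n (\<lambda>_. c)"
proof (induction n arbitrary: c)
  case 0
  then show ?case by (simp add: loc_lipschitz_const)
next
  case (Suc n)
  then show ?case
    by (auto simp: loc_lipschitz_const has_dderiv_def intro!: exI[of _ "\<lambda>_. 0"])
qed

lemma smooth_along_add:
  "smooth_along D n f \<Longrightarrow> smooth_along D n g \<Longrightarrow> smooth_along D n (\<lambda>x. f x + g x)"
proof (induction n arbitrary: f g)
  case 0
  then show ?case by (simp add: loc_lipschitz_add)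
next
  case (Suc n)
  have "\<exists>k. has_dderiv v (\<lambda>x. f x + g x) k \<and> smooth_along D n k" if v: "v \<in> D" for v
  proof -
    obtain f' g' where *: "has_dderiv v f f'" "smooth_along D n f'"
      "has_dderiv v g g'" "smooth_along D n g'"
      using Suc.prems v by (auto dest!: bspec)
    then have "has_dderiv v (\<lambda>x. f x + g x) (\<lambda>x. f' x + g' x)"
      unfolding has_dderiv_def by (auto intro: DERIV_add)
    then show ?thesis using Suc.IH * by blast
  qed
  then show ?case using Suc.prems by (simp add: loc_lipschitz_add)
qed

lemma smooth_along_mult:
  "smooth_along D n f \<Longrightarrow> smooth_along D n g \<Longrightarrow> smooth_along D n (\<lambda>x. f x * g x)"
proof (induction n arbitrary: f g)
  case 0
  then show ?case by (simp add: loc_lipschitz_mult)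
next
  case (Suc n)
  have "\<exists>k. has_dderiv v (\<lambda>x. f x * g x) k \<and> smooth_along D n k" if v: "v \<in> D" for v
  proof -
    obtain f' g' where *: "has_dderiv v f f'" "smooth_along D n f'"
      "has_dderiv v g g'" "smooth_along D n g'"
      using Suc.prems v by (auto dest!: bspec)
    then have "has_dderiv v (\<lambda>x. f x * g x) (\<lambda>x. f' x * g x + g' x * f x)"
      unfolding has_dderiv_def by (auto intro!: DERIV_mult[THEN DERIV_cong])
    moreover have "smooth_along D n (\<lambda>x. f' x * g x + g' x * f x)"
      using * Suc.prems[THEN smooth_along_Suc] by (intro smooth_along_add Suc.IH)
    ultimately show ?thesis by blast
  qed
  then show ?case using Suc.prems by (simp add: loc_lipschitz_mult)
qed

lemma smooth_along_cmult: "smooth_along D n f \<Longrightarrow> smooth_along D n (\<lambda>x. c * f x)"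
  by (intro smooth_along_mult smooth_along_const)

lemma smooth_along_diff:
  "smooth_along D n f \<Longrightarrow> smooth_along D n g \<Longrightarrow> smooth_along D n (\<lambda>x. f x - g x)"
  using smooth_along_add[of D n f "\<lambda>x. -1 * g x"] smooth_along_cmult[of D n g "-1"] by simp

lemma smooth_along_compose:
  "smooth_along {1} n \<phi> \<Longrightarrow> smooth_along D n f \<Longrightarrow> smooth_along D n (\<lambda>x. \<phi> (f x))"
proof (induction n arbitrary: \<phi> f)
  case 0
  then show ?case by (simp add: loc_lipschitz_compose)
next
  case (Suc n)
  have "\<exists>k. has_dderiv v (\<lambda>x. \<phi> (f x)) k \<and> smooth_along D n k" if v: "v \<in> D" for v
  proof -
    obtain f' \<phi>' where *: "has_dderiv v f f'" "smooth_along D n f'"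
      "has_dderiv 1 \<phi> \<phi>'" "smooth_along {1} n \<phi>'"
      using Suc.prems v by (auto dest!: bspec)
    have "has_dderiv v (\<lambda>x. \<phi> (f x)) (\<lambda>x. \<phi>' (f x) * f' x)"
      unfolding has_dderiv_def
    proof
      fix x
      have "(\<phi> has_real_derivative \<phi>' (f (x + 0 *\<^sub>R v))) (at (f (x + 0 *\<^sub>R v)))"
        using has_dderivD[OF *(3), of 0 "f x" UNIV] by simp
      from DERIV_chain2[where g = "\<lambda>\<tau>. f (x + \<tau> *\<^sub>R v)", OF this] *(1)
      show "((\<lambda>\<tau>. \<phi> (f (x + \<tau> *\<^sub>R v))) has_real_derivative \<phi>' (f x) * f' x) (at 0)"
        by (simp add: has_dderiv_def)
    qed
    moreover have "smooth_along D n (\<lambda>x. \<phi>' (f x) * f' x)"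
      by (rule smooth_along_mult[OF Suc.IH[OF *(4) smooth_along_Suc[OF Suc.prems(2)]] *(2)])
    ultimately show ?thesis by blast
  qed
  then show ?case using Suc.prems by (simp add: loc_lipschitz_compose)
qed

lemma smooth_along_shift: "smooth_along D n f \<Longrightarrow> smooth_along D n (\<lambda>x. f (x + w))"
proof (induction n arbitrary: f)
  case 0
  then show ?case by (simp add: loc_lipschitz_shift)
next
  case (Suc n)
  have "\<exists>k. has_dderiv v (\<lambda>x. f (x + w)) k \<and> smooth_along D n k" if v: "v \<in> D" for v
  proof -
    obtain f' where *: "has_dderiv v f f'" "smooth_along D n f'"
      using Suc.prems v by (auto dest!: bspec)
    have "has_dderiv v (\<lambda>x. f (x + w)) (\<lambda>x. f' (x + w))"
      unfolding has_dderiv_def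
    proof
      fix x
      have "x + \<tau> *\<^sub>R v + w = x + w + \<tau> *\<^sub>R v" for \<tau> by simp
      then show "((\<lambda>\<tau>. f (x + \<tau> *\<^sub>R v + w)) has_real_derivative f' (x + w)) (at 0)"
        using *(1) by (simp only: has_dderiv_def)
    qed
    then show ?thesis using Suc.IH * by blast
  qed
  then show ?case using Suc.prems by (simp add: loc_lipschitz_shift)
qed

lemma smooth_along_box_avg: "smooth_along D n f \<Longrightarrow> smooth_along D n (box_avg w f)"
proof (induction n arbitrary: f)
  case 0
  then show ?case by (simp add: loc_lipschitz_box_avg)
next
  case (Suc n)
  have "\<exists>k. has_dderiv v (box_avg w f) k \<and> smooth_along D n k" if v: "v \<in> D" for v
  proof -
    obtain f' where *: "has_dderiv v f f'" "smooth_along D n f'"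
      using Suc.prems v by (auto dest!: bspec)
    then have "has_dderiv v (box_avg w f) (box_avg w f')"
      by (intro has_dderiv_box_avg loc_lipschitz_continuous smooth_along_lipschitz[OF Suc.prems]
          smooth_along_lipschitz[OF *(2)])
    then show ?thesis using Suc.IH * by blast
  qed
  then show ?case using Suc.prems by (simp add: loc_lipschitz_box_avg)
qed

section \<open>Smoothing by infinitely many box averages\<close>

text \<open>The passage from \<open>n\<close> to \<open>n + 1\<close> inserts the average along
  \<open>w n\<close> innermost, while \<open>w 0\<close> stays outermost. So convergence is seen
  from the inside and differentiation from the outside.\<close>

primrec box_chain :: "nat \<Rightarrow> (nat \<Rightarrow> 'a) \<Rightarrow> ('a::real_normed_vector \<Rightarrow> real) \<Rightarrow> 'a \<Rightarrow> real" where
  "box_chain 0 = (\<lambda>w F. F)"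
| "box_chain (Suc n) = (\<lambda>w F. box_avg (w 0) (box_chain n (\<lambda>i. w (Suc i)) F))"

definition smoothing :: "(nat \<Rightarrow> 'a) \<Rightarrow> ('a::real_normed_vector \<Rightarrow> real) \<Rightarrow> 'a \<Rightarrow> real" where
  "smoothing w F x = lim (\<lambda>n. box_chain n w F x)"

lemma lipschitz_box_chain:
  "L-lipschitz_on UNIV F \<Longrightarrow> L-lipschitz_on UNIV (box_chain n w F)"
  by (induction n arbitrary: w) (auto intro: lipschitz_box_avg)

lemma continuous_box_chain:
  "L-lipschitz_on UNIV F \<Longrightarrow> continuous_on S (box_chain n w F)"
  using lipschitz_on_continuous_on[OF lipschitz_box_chain] continuous_on_subset by blast

text \<open>Averaging does not increase the distance of two functions, so only the innermost average
  counts, and it moves an \<open>L\<close>-Lipschitz function by at most \<open>L\<close> times its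
  length.\<close>

lemma box_chain_step:
  assumes F: "L-lipschitz_on UNIV F"
  shows "\<bar>box_chain (Suc n) w F x - box_chain n w F x\<bar> \<le> L * norm (w n)"
proof (induction n arbitrary: w x)
  case 0
  have "\<bar>F (x + s *\<^sub>R w 0) - F x\<bar> \<le> L * norm (w 0)" if "s \<in> {0..1}" for s
  proof -
    have "\<bar>F (x + s *\<^sub>R w 0) - F x\<bar> \<le> L * (\<bar>s\<bar> * norm (w 0))"
      using lipschitz_on_normD[OF F, of "x + s *\<^sub>R w 0" x] by simp
    also have "\<dots> \<le> L * (1 * norm (w 0))"
      using that lipschitz_on_nonneg[OF F] by (intro mult_left_mono mult_right_mono) auto
    finally show ?thesis by simp
  qed
  then show ?case
    using box_avg_near[OF lipschitz_on_continuous_on[OF F]] by simp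
next
  case (Suc n)
  then show ?case
    by (subst (1 2) box_chain.simps(2)) (intro box_avg_diff_le continuous_box_chain[OF F])
qed

text \<open>The differences of consecutive chains are dominated by a convergent series. The bound
  does not depend on \<open>x\<close>, so later the limit can be taken under averages and circular
  means.\<close>

lemma smoothing_approx:
  assumes F: "L-lipschitz_on UNIV F" and w: "summable (\<lambda>i. norm (w i))"
  shows "\<bar>smoothing w F x - box_chain n w F x\<bar> \<le> L * (\<Sum>i. norm (w (i + n)))"
    and "(\<lambda>n. box_chain n w F x) \<longlonglongrightarrow> smoothing w F x"
proof -
  define a where "a i = box_chain (Suc i) w F x - box_chain i w F x" for i
  have a: "\<bar>a i\<bar> \<le> L * norm (w i)" for i
    unfolding a_def by (rule box_chain_step[OF F])
  have Lw: "summable (\<lambda>i. L * norm (w i))" by (rule summable_mult[OF w])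
  have abs_a: "summable (\<lambda>i. \<bar>a i\<bar>)"
    by (rule summable_comparison_test'[OF Lw]) (use a in simp)
  have sum_a: "(\<Sum>i<n. a i) = box_chain n w F x - F x" for n
    unfolding a_def using sum_lessThan_telescope[of "\<lambda>i. box_chain i w F x" n] by (simp del: box_chain.simps(2))
  have "(\<lambda>n. \<Sum>i<n. a i) \<longlonglongrightarrow> suminf a"
    using summable_LIMSEQ[OF summable_rabs_cancel[OF abs_a]] .
  then have "(\<lambda>n. box_chain n w F x - F x + F x) \<longlonglongrightarrow> suminf a + F x"
    unfolding sum_a by (intro tendsto_intros)
  then have lim: "(\<lambda>n. box_chain n w F x) \<longlonglongrightarrow> suminf a + F x" by simp
  then have eq: "smoothing w F x = suminf a + F x"
    unfolding smoothing_def by (rule limI)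
  show "(\<lambda>n. box_chain n w F x) \<longlonglongrightarrow> smoothing w F x" using lim eq by simp
  have "smoothing w F x - box_chain n w F x = (\<Sum>i. a (i + n))"
    using suminf_split_initial_segment[OF summable_rabs_cancel[OF abs_a], of n] sum_a eq by simp
  also have "\<bar>\<dots>\<bar> \<le> (\<Sum>i. \<bar>a (i + n)\<bar>)"
    by (intro summable_rabs summable_ignore_initial_segment[OF abs_a])
  also have "\<dots> \<le> (\<Sum>i. L * norm (w (i + n)))"
    by (intro suminf_le a summable_ignore_initial_segment[OF abs_a] summable_ignore_initial_segment[OF Lw])
  also have "\<dots> = L * (\<Sum>i. norm (w (i + n)))"
    by (intro suminf_mult summable_ignore_initial_segment[OF w])
  finally show "\<bar>smoothing w F x - box_chain n w F x\<bar> \<le> L * (\<Sum>i. norm (w (i + n)))" .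
qed

lemma lipschitz_smoothing:
  assumes F: "L-lipschitz_on UNIV F" and w: "summable (\<lambda>i. norm (w i))"
  shows "L-lipschitz_on UNIV (smoothing w F)"
proof (rule lipschitz_onI)
  fix x y
  have "(\<lambda>n. dist (box_chain n w F x) (box_chain n w F y)) \<longlonglongrightarrow> dist (smoothing w F x) (smoothing w F y)"
    by (intro tendsto_dist smoothing_approx(2)[OF F w])
  then show "dist (smoothing w F x) (smoothing w F y) \<le> L * dist x y"
    by (rule LIMSEQ_le_const2) (use lipschitz_onD[OF lipschitz_box_chain[OF F]] in blast)
qed (use F lipschitz_on_nonneg in auto)

lemma tail_norm_null:
  assumes w: "summable (\<lambda>i. norm (w i))"
  shows "(\<lambda>n. L * (\<Sum>i. norm (w (i + n)))) \<longlonglongrightarrow> 0"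
proof -
  have "(\<lambda>n. (\<Sum>i. norm (w i)) - (\<Sum>i<n. norm (w i))) \<longlonglongrightarrow> (\<Sum>i. norm (w i)) - (\<Sum>i. norm (w i))"
    by (intro tendsto_intros summable_LIMSEQ w)
  then have "(\<lambda>n. L * ((\<Sum>i. norm (w i)) - (\<Sum>i<n. norm (w i)))) \<longlonglongrightarrow> L * 0"
    by (intro tendsto_intros) simp
  then show ?thesis
    by (simp only: suminf_minus_initial_segment[OF w] mult_zero_right)
qed

lemma smoothing_Suc:
  fixes w :: "nat \<Rightarrow> 'a::real_normed_vector"
  assumes F: "L-lipschitz_on UNIV F" and w: "summable (\<lambda>i. norm (w i))"
  shows "smoothing w F = box_avg (w 0) (smoothing (\<lambda>i. w (Suc i)) F)"
proof
  fix x
  let ?w = "\<lambda>i. w (Suc i)"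
  have w': "summable (\<lambda>i. norm (?w i))" using summable_ignore_initial_segment[OF w, of 1] by simp
  let ?t = "\<lambda>n. L * (\<Sum>i. norm (?w (i + n)))"
  have t: "?t \<longlonglongrightarrow> 0" by (rule tail_norm_null[OF w'])
  have "\<bar>box_chain (Suc n) w F x - box_avg (w 0) (smoothing ?w F) x\<bar> \<le> ?t n" for n
    unfolding box_chain.simps(2)
    using smoothing_approx(1)[OF F w']
    by (intro box_avg_diff_le continuous_box_chain[OF F]
        lipschitz_on_continuous_on[OF lipschitz_smoothing[OF F w']]) (simp only: abs_minus_commute)
  then have "(\<lambda>n. box_chain (Suc n) w F x - box_avg (w 0) (smoothing ?w F) x) \<longlonglongrightarrow> 0"
    by (intro Lim_null_comparison[OF _ t]) (auto simp del: box_chain.simps)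
  then have "(\<lambda>n. box_chain (Suc n) w F x) \<longlonglongrightarrow> box_avg (w 0) (smoothing ?w F) x"
    by (simp only: LIM_zero_iff)
  moreover have "(\<lambda>n. box_chain (Suc n) w F x) \<longlonglongrightarrow> smoothing w F x"
    using LIMSEQ_Suc[OF smoothing_approx(2)[OF F w]] .
  ultimately show "smoothing w F x = box_avg (w 0) (smoothing ?w F) x"
    using LIMSEQ_unique by blast
qed

text \<open>Occurrences arbitrarily far out survive the removal of initial terms. The factor is
  positive because it becomes the step of a difference quotient.\<close>

definition recurs :: "'a::real_vector \<Rightarrow> (nat \<Rightarrow> 'a) \<Rightarrow> bool" where
  "recurs v w \<longleftrightarrow> (\<forall>N. \<exists>i\<ge>N. \<exists>e>0. w i = e *\<^sub>R v)"

lemma recurs_Suc: "recurs v w \<Longrightarrow> recurs v (\<lambda>i. w (Suc i))"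
  unfolding recurs_def by (metis Suc_le_D Suc_le_mono)

text \<open>Differentiating along \<open>v\<close> consumes one average in the direction \<open>v\<close>, which it turns into a
  difference quotient; infinitely many remain.\<close>

lemma smooth_along_smoothing:
  assumes F: "L-lipschitz_on UNIV F"
    and "summable (\<lambda>i. norm (w i))" "\<And>v. v \<in> D \<Longrightarrow> recurs v w"
  shows "smooth_along D n (smoothing w F)"
  using assms(2,3)
proof (induction n arbitrary: w)
  case 0
  then show ?case using lipschitz_imp_loc[OF lipschitz_smoothing[OF F]] by simp
next
  case (Suc n)
  have "\<exists>f'. has_dderiv v (smoothing w F) f' \<and> smooth_along D n f'"
    if v: "v \<in> D" and "w i = e *\<^sub>R v" "0 < e" and w: "summable (\<lambda>i. norm (w i))"
      and rec: "\<And>v. v \<in> D \<Longrightarrow> recurs v w" for v i e w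
    using that(2) w rec
  \<comment> \<open>Averages in front of the chosen occurrence of \<open>v\<close> commute with the
    derivative, so they are peeled off until that occurrence is outermost.\<close>
  proof (induction i arbitrary: w)
    case 0
    let ?w = "\<lambda>i. w (Suc i)"
    have w': "summable (\<lambda>i. norm (?w i))" using summable_ignore_initial_segment[OF 0(2), of 1] by simp
    let ?h = "smoothing ?w F"
    have h: "smooth_along D n ?h"
      by (rule Suc.IH[OF w' recurs_Suc[OF 0(3)]])
    have "has_dderiv v (smoothing w F) (\<lambda>x. (?h (x + e *\<^sub>R v) - ?h x) / e)"
      unfolding smoothing_Suc[OF F 0(2)] 0(1)
      by (intro has_dderiv_box_avg_self that(3) loc_lipschitz_continuous[OF smooth_along_lipschitz[OF h]])
    moreover have "smooth_along D n (\<lambda>x. (1 / e) * (?h (x + e *\<^sub>R v) - ?h x))"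
      by (intro smooth_along_cmult smooth_along_diff smooth_along_shift h)
    ultimately show ?case by auto
  next
    case (Suc i)
    let ?w = "\<lambda>i. w (Suc i)"
    have w': "summable (\<lambda>i. norm (?w i))" using summable_ignore_initial_segment[OF Suc.prems(2), of 1] by simp
    obtain f' where f': "has_dderiv v (smoothing ?w F) f'" "smooth_along D n f'"
      using Suc.IH[OF _ w' recurs_Suc[OF Suc.prems(3)]] Suc.prems(1) by auto
    have "has_dderiv v (smoothing w F) (box_avg (w 0) f')"
      unfolding smoothing_Suc[OF F Suc.prems(2)]
      by (intro has_dderiv_box_avg f' lipschitz_on_continuous_on[OF lipschitz_smoothing[OF F w']]
          loc_lipschitz_continuous[OF smooth_along_lipschitz[OF f'(2)]])
    then show ?case using smooth_along_box_avg[OF f'(2)] by blast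
  qed
  note step = this
  have "\<exists>f'. has_dderiv v (smoothing w F) f' \<and> smooth_along D n f'" if v: "v \<in> D" for v
  proof -
    obtain i e where "0 < e" "w i = e *\<^sub>R v"
      using Suc.prems(2)[OF v] unfolding recurs_def by meson
    then show ?thesis using step[OF v _ _ Suc.prems] by metis
  qed
  then show ?case
    using lipschitz_imp_loc[OF lipschitz_smoothing[OF F Suc.prems(1)]] by simp
qed

section \<open>A smooth convex ramp\<close>

text \<open>The bend lies between \<open>- c\<close> and 0, with slope 1 after it. The value at 0 is
  left open since averaging may raise it. Averages along \<open>v\<close> \<ge> 0 look only to the
  right, so they move the left end of the bend and keep the right end at 0.\<close>

definition ramp_like :: "real \<Rightarrow> (real \<Rightarrow> real) \<Rightarrow> bool" where
  "ramp_like c f \<longleftrightarrow> convex_on UNIV f \<and> (\<forall>t. 0 \<le> f t) \<and> (\<forall>t\<le>-c. f t = 0) \<and> (\<forall>t\<ge>0. f t = f 0 + t)"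

lemma ramp_likeD:
  assumes "ramp_like c f"
  shows "convex_on UNIV f" "0 \<le> f t" "t \<le> -c \<Longrightarrow> f t = 0" "0 \<le> t \<Longrightarrow> f t = f 0 + t"
  using assms unfolding ramp_like_def by blast+

lemma ramp_like_mono: "ramp_like c f \<Longrightarrow> c \<le> d \<Longrightarrow> ramp_like d f"
  unfolding ramp_like_def by (meson neg_le_iff_le order_trans)

lemma ramp_like_box_avg:
  assumes f: "ramp_like c f" "continuous_on UNIV f" and v: "0 \<le> v"
  shows "ramp_like (c + v) (box_avg v f)"
  unfolding ramp_like_def
proof (intro conjI allI impI)
  note int = box_integrable[OF f(2), where a = 0 and b = 1]
  show "convex_on UNIV (box_avg v f)"
  proof (rule convex_onI)
    fix t x y :: real assume t: "0 < t" "t < 1"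
    have "box_avg v f ((1 - t) *\<^sub>R x + t *\<^sub>R y)
        \<le> integral {0..1} (\<lambda>s. (1 - t) * f (x + s *\<^sub>R v) + t * f (y + s *\<^sub>R v))"
      unfolding box_avg_def
    proof (intro integral_le int integrable_add integrable_on_mult_right)
      fix s
      have "f ((1 - t) *\<^sub>R (x + s *\<^sub>R v) + t *\<^sub>R (y + s *\<^sub>R v)) \<le> (1 - t) * f (x + s *\<^sub>R v) + t * f (y + s *\<^sub>R v)"
        using ramp_likeD(1)[OF f(1)] t by (intro convex_onD) auto
      then show "f ((1 - t) *\<^sub>R x + t *\<^sub>R y + s *\<^sub>R v) \<le> (1 - t) * f (x + s *\<^sub>R v) + t * f (y + s *\<^sub>R v)"
        by (simp add: algebra_simps)
    qed
    also have "\<dots> = (1 - t) * box_avg v f x + t * box_avg v f y"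
      unfolding box_avg_def
      by (subst Henstock_Kurzweil_Integration.integral_add) (auto intro!: integrable_on_mult_right int simp del: real_scaleR_def)
    finally show "box_avg v f ((1 - t) *\<^sub>R x + t *\<^sub>R y) \<le> (1 - t) * box_avg v f x + t * box_avg v f y" .
  qed simp
  show "0 \<le> box_avg v f t" for t
    using ramp_likeD(2)[OF f(1)] unfolding box_avg_def
    by (intro Henstock_Kurzweil_Integration.integral_nonneg int)
  show "box_avg v f t = 0" if "t \<le> - (c + v)" for t
  proof -
    have "box_avg v f t = integral {0..1} (\<lambda>s::real. 0)"
      unfolding box_avg_def
    proof (rule Henstock_Kurzweil_Integration.integral_cong)
      fix s :: real assume "s \<in> {0..1}"
      then have "s * v \<le> 1 * v" using v by (intro mult_right_mono) auto
      then show "f (t + s *\<^sub>R v) = 0" using that by (intro ramp_likeD(3)[OF f(1)]) simp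
    qed
    then show ?thesis by simp
  qed
  show "box_avg v f t = box_avg v f 0 + t" if "0 \<le> t" for t
  proof -
    have "box_avg v f t = integral {0..1} (\<lambda>s. f (0 + s *\<^sub>R v) + t)"
      unfolding box_avg_def
    proof (rule Henstock_Kurzweil_Integration.integral_cong)
      fix s :: real assume "s \<in> {0..1}"
      then have "0 \<le> s * v" using v by simp
      then show "f (t + s *\<^sub>R v) = f (0 + s *\<^sub>R v) + t"
        using ramp_likeD(4)[OF f(1), of "t + s * v"] ramp_likeD(4)[OF f(1), of "s * v"] that by simp
    qed
    also have "\<dots> = box_avg v f 0 + t"
      unfolding box_avg_def
      by (subst Henstock_Kurzweil_Integration.integral_add[OF int]) auto
    finally show ?thesis .
  qed
qed

lemma ramp_like_box_chain:
  assumes F: "L-lipschitz_on UNIV F" "ramp_like 0 F" and w: "\<And>i. 0 \<le> w i"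
  shows "ramp_like (\<Sum>i<n. w i) (box_chain n w F)"
  using w
proof (induction n arbitrary: w)
  case 0
  then show ?case using F by simp
next
  case (Suc n)
  have "ramp_like ((\<Sum>i<n. w (Suc i)) + w 0) (box_chain (Suc n) w F)"
    unfolding box_chain.simps
    by (intro ramp_like_box_avg Suc continuous_box_chain[OF F(1)])
  then show ?case by (simp only: sum.lessThan_Suc_shift add.commute)
qed

lemma ramp_like_limit:
  assumes lim: "\<And>t. (\<lambda>n. f n t) \<longlonglongrightarrow> g t" and f: "\<And>n. ramp_like c (f n)"
  shows "ramp_like c g"
  unfolding ramp_like_def
proof (intro conjI allI impI)
  show "convex_on UNIV g"
  proof (rule convex_onI)
    fix t x y :: real assume t: "0 < t" "t < 1"
    show "g ((1 - t) *\<^sub>R x + t *\<^sub>R y) \<le> (1 - t) * g x + t * g y"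
    proof (rule LIMSEQ_le[OF lim])
      show "(\<lambda>n. (1 - t) * f n x + t * f n y) \<longlonglongrightarrow> (1 - t) * g x + t * g y"
        by (intro tendsto_intros lim)
      show "\<exists>N. \<forall>n\<ge>N. f n ((1 - t) *\<^sub>R x + t *\<^sub>R y) \<le> (1 - t) * f n x + t * f n y"
        using ramp_likeD(1)[OF f] t by (intro exI allI impI convex_onD) auto
    qed
  qed simp
  show "0 \<le> g t" for t
    using ramp_likeD(2)[OF f] by (intro LIMSEQ_le_const[OF lim]) auto
  show "g t = 0" if "t \<le> - c" for t
    using ramp_likeD(3)[OF f that] LIMSEQ_unique[OF lim[of t], of 0] by simp
  show "g t = g 0 + t" if "0 \<le> t" for t
  proof -
    have "(\<lambda>n. f n 0 + t) \<longlonglongrightarrow> g 0 + t" by (intro tendsto_intros lim)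
    then have "(\<lambda>n. f n t) \<longlonglongrightarrow> g 0 + t" using ramp_likeD(4)[OF f that] by (simp only:)
    then show ?thesis using LIMSEQ_unique[OF lim[of t]] by blast
  qed
qed

text \<open>The positive part is averaged over lengths 1/2, 1/4, and so on; their total 1 is the
  width of the bend. The last property packs convexity, monotonicity and slope at most 1 into the
  supporting line that the gluing needs.\<close>

lemma smooth_ramp:
  obtains \<rho> :: "real \<Rightarrow> real" where
    "\<And>n. smooth_along {1} n \<rho>" "\<And>t. 0 \<le> \<rho> t" "\<And>t. t \<le> -1 \<Longrightarrow> \<rho> t = 0"
    "\<And>t. 0 \<le> t \<Longrightarrow> \<rho> t = \<rho> 0 + t"
    "\<And>s. \<exists>\<beta>. 0 \<le> \<beta> \<and> \<beta> \<le> 1 \<and> (\<forall>t. \<rho> s + \<beta> * (t - s) \<le> \<rho> t)"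
proof -
  define F :: "real \<Rightarrow> real" where "F = max 0"
  define w :: "nat \<Rightarrow> real" where "w i = (1/2) ^ Suc i" for i
  define \<rho> where "\<rho> = smoothing w F"
  have F: "1-lipschitz_on UNIV F"
    by (rule lipschitz_onI) (auto simp: F_def dist_real_def)
  have w: "0 \<le> w i" for i by (simp add: w_def)
  have w_sums: "w sums 1" unfolding w_def by (rule power_half_series)
  then have sw: "summable (\<lambda>i. norm (w i))" using w by (simp add: sums_iff)
  have rF: "ramp_like 0 F"
    unfolding ramp_like_def F_def
    by (auto intro!: convex_onI max.boundedI add_mono mult_left_mono add_nonneg_nonneg)
  have r: "ramp_like 1 \<rho>"
    unfolding \<rho>_def
  proof (rule ramp_like_limit)
    show "(\<lambda>n. box_chain n w F t) \<longlonglongrightarrow> smoothing w F t" for t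
      by (rule smoothing_approx(2)[OF F sw])
    have "(\<Sum>i<n. w i) \<le> 1" for n
      using sum_le_suminf[of w "{..<n}"] w w_sums by (simp add: sums_iff)
    then show "ramp_like 1 (box_chain n w F)" for n
      by (rule ramp_like_mono[OF ramp_like_box_chain[OF F rF w]])
  qed
  have smooth: "smooth_along {1} n \<rho>" for n
    unfolding \<rho>_def
  proof (rule smooth_along_smoothing[OF F sw])
    fix v :: real assume "v \<in> {1}"
    then show "recurs v w"
      unfolding recurs_def w_def
      by (intro allI) (rule exI, rule conjI[OF order_refl], rule exI[of _ "(1/2) ^ Suc _"], simp)
  qed
  show thesis
  proof
    show "\<exists>\<beta>. 0 \<le> \<beta> \<and> \<beta> \<le> 1 \<and> (\<forall>t. \<rho> s + \<beta> * (t - s) \<le> \<rho> t)" for s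
    proof -
      obtain \<rho>' where d: "has_dderiv 1 \<rho> \<rho>'" using smooth[of 1] by auto
      define \<beta> where "\<beta> = \<rho>' s"
      have "(\<rho> has_real_derivative \<beta>) (at s)"
        using has_dderivD[OF d, of 0 s UNIV] by (simp add: \<beta>_def)
      then have tan: "\<rho> s + \<beta> * (t - s) \<le> \<rho> t" for t
        using convex_on_imp_above_tangent[of UNIV \<rho> s t \<beta>] ramp_likeD(1)[OF r] by auto
      have "0 \<le> \<beta>"
      proof (rule ccontr)
        assume "\<not> 0 \<le> \<beta>"
        \<comment> \<open>Here \<rho> vanishes, while a tangent of negative slope, being nonnegative
          at \<open>s\<close>, is positive to the left of \<open>s\<close>.\<close>
        define t where "t = min (-1) (s - 1)"
        have "0 < \<beta> * (t - s)" using \<open>\<not> 0 \<le> \<beta>\<close> by (intro mult_neg_neg) (auto simp: t_def)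
        moreover have "\<rho> t = 0" "0 \<le> \<rho> s" by (auto intro: ramp_likeD[OF r] simp: t_def)
        ultimately show False using tan[of t] by simp
      qed
      moreover have "\<beta> \<le> 1"
      proof (rule ccontr)
        assume b: "\<not> \<beta> \<le> 1"
        \<comment> \<open>Far enough to the right that a tangent of slope above 1 has overtaken
          \<open>\<rho> 0 + t\<close>.\<close>
        define t where "t = (\<bar>\<rho> 0\<bar> + \<bar>\<beta> * s\<bar> + 1) / (\<beta> - 1)"
        have "0 \<le> t" "(\<beta> - 1) * t = \<bar>\<rho> 0\<bar> + \<bar>\<beta> * s\<bar> + 1" using b by (auto simp: t_def)
        moreover have "\<rho> t = \<rho> 0 + t" "0 \<le> \<rho> s" using \<open>0 \<le> t\<close> by (auto intro: ramp_likeD[OF r])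
        ultimately show False using tan[of t] by (simp add: algebra_simps)
      qed
      ultimately show ?thesis using tan by blast
    qed
  qed (use smooth ramp_likeD[OF r] in blast)+
qed

section \<open>Circular means\<close>

text \<open>Other centres and radii are reached by the substitution
  \<open>z + of_real r * c\<close>, so that all integrals are over the unit circle.\<close>

definition circ_mean :: "(complex \<Rightarrow> real) \<Rightarrow> real" where
  "circ_mean u = 1 / (2 * pi) * integral {0..2 * pi} (\<lambda>\<theta>. u (cis \<theta>))"

lemma circ_integrable:
  fixes u :: "complex \<Rightarrow> real"
  assumes "continuous_on (sphere 0 1) u"
  shows "(\<lambda>\<theta>. u (cis \<theta>)) integrable_on {a..b}"
proof (rule integrable_continuous_real)
  have "continuous_on {a..b} cis" unfolding cis_conv_exp by (intro continuous_intros)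
  then show "continuous_on {a..b} (\<lambda>\<theta>. u (cis \<theta>))"
    by (rule continuous_on_compose2[OF assms]) auto
qed

lemma circ_mean_const [simp]: "circ_mean (\<lambda>_. c) = c"
  by (simp add: circ_mean_def)

lemma circ_mean_add:
  assumes "continuous_on (sphere 0 1) u" "continuous_on (sphere 0 1) v"
  shows "circ_mean (\<lambda>c. u c + v c) = circ_mean u + circ_mean v"
  unfolding circ_mean_def
  by (subst Henstock_Kurzweil_Integration.integral_add) (auto intro: circ_integrable assms simp: algebra_simps)

lemma circ_mean_cmult: "circ_mean (\<lambda>c. k * u c) = k * circ_mean u"
  unfolding circ_mean_def by simp

lemma circ_mean_diff:
  assumes "continuous_on (sphere 0 1) u" "continuous_on (sphere 0 1) v"
  shows "circ_mean (\<lambda>c. u c - v c) = circ_mean u - circ_mean v"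
  unfolding circ_mean_def
  by (subst Henstock_Kurzweil_Integration.integral_diff) (auto intro: circ_integrable assms simp: algebra_simps)

lemma circ_mean_mono:
  assumes "continuous_on (sphere 0 1) u" "continuous_on (sphere 0 1) v"
    and "\<And>c. c \<in> sphere 0 1 \<Longrightarrow> u c \<le> v c"
  shows "circ_mean u \<le> circ_mean v"
  unfolding circ_mean_def
  by (intro mult_left_mono integral_le circ_integrable assms) auto

lemma circ_mean_cong:
  assumes "\<And>c. c \<in> sphere 0 1 \<Longrightarrow> u c = v c"
  shows "circ_mean u = circ_mean v"
  unfolding circ_mean_def using assms by (metis norm_cis mem_sphere_0)

text \<open>Cauchy's integral formula on the unit circle. The factor \<open>k\<close> is carried
  along because \<open>Re (k * w)\<close> is the general real-linear function of \<open>w\<close>,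
  the form in which gradients enter later.\<close>

lemma circ_mean_holomorphic:
  assumes f: "f holomorphic_on UNIV"
  shows "circ_mean (\<lambda>c. Re (k * f (z + of_real r * c))) = Re (k * f z)"
proof -
  let ?g = "\<lambda>c. k * f (z + of_real r * c)"
  have g: "?g holomorphic_on UNIV"
    by (intro holomorphic_intros holomorphic_on_compose_gen[OF _ f, of "\<lambda>c. z + of_real r * c", unfolded o_def]) auto
  have "((\<lambda>u. ?g u / (u - 0)) has_contour_integral 2 * of_real pi * \<i> * ?g 0) (circlepath 0 1)"
    by (rule Cauchy_integral_circlepath_simple) (auto intro: holomorphic_on_subset[OF g])
  then have "((\<lambda>t. ?g (cis t) / cis t * \<i> * cis t) has_integral 2 * of_real pi * \<i> * (k * f z)) {0..2*pi}"
    unfolding circlepath_def by (subst (asm) has_contour_integral_part_circlepath_iff) auto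
  then have "((\<lambda>t. \<i> * ?g (cis t)) has_integral 2 * of_real pi * \<i> * (k * f z)) {0..2*pi}"
    by (simp add: mult.commute)
  then have "((\<lambda>t. -\<i> * (\<i> * ?g (cis t))) has_integral -\<i> * (2 * of_real pi * \<i> * (k * f z))) {0..2*pi}"
    by (rule has_integral_mult_right)
  then have "((\<lambda>t. ?g (cis t)) has_integral of_real (2 * pi) * (k * f z)) {0..2*pi}"
    by (simp add: algebra_simps)
  then have "((\<lambda>t. Re (?g (cis t))) has_integral Re (of_real (2 * pi) * (k * f z))) {0..2*pi}"
    by (rule has_integral_Re)
  then have "integral {0..2*pi} (\<lambda>t. Re (?g (cis t))) = 2 * pi * Re (k * f z)"
    by (intro integral_unique) (simp only: Re_complex_of_real Im_complex_of_real times_complex.sel mult_zero_left diff_zero)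
  then show ?thesis by (simp add: circ_mean_def)
qed

lemma circ_mean_Re_linear: "circ_mean (\<lambda>c. Re (k * c)) = 0"
  using circ_mean_holomorphic[of "\<lambda>c. c" k 0 1] by (simp add: holomorphic_on_ident)

text \<open>On the circle the mixed term is the real part of a linear function and has mean zero.
  The surplus \<open>r\<^sup>2\<close> is what makes a mean value inequality strict.\<close>

lemma circ_mean_norm_sq:
  "circ_mean (\<lambda>c. (cmod (z + of_real r * c))\<^sup>2) = (cmod z)\<^sup>2 + r\<^sup>2"
proof -
  have "circ_mean (\<lambda>c. (cmod (z + of_real r * c))\<^sup>2)
      = circ_mean (\<lambda>c. ((cmod z)\<^sup>2 + r\<^sup>2) + Re (2 * of_real r * cnj z * c))"
  proof (rule circ_mean_cong)
    fix c :: complex assume "c \<in> sphere 0 1"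
    then have "(cmod c)\<^sup>2 = 1" by simp
    moreover have "(cmod (z + of_real r * c))\<^sup>2
        = (cmod z)\<^sup>2 + r\<^sup>2 * (cmod c)\<^sup>2 + Re (2 * of_real r * cnj z * c)"
      unfolding cmod_power2 by (simp add: power2_eq_square algebra_simps)
    ultimately show "(cmod (z + of_real r * c))\<^sup>2 = ((cmod z)\<^sup>2 + r\<^sup>2) + Re (2 * of_real r * cnj z * c)"
      by simp
  qed
  also have "\<dots> = (cmod z)\<^sup>2 + r\<^sup>2"
    by (subst circ_mean_add) (auto simp: circ_mean_Re_linear simp del: times_complex.sel intro!: continuous_intros)
  finally show ?thesis .
qed

text \<open>The hypothesis is an infinitesimal mean value inequality: adding a small multiple of
  \<open>(cmod z)\<^sup>2\<close> makes it strict, so that no maximum is interior.\<close>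

lemma max_principle:
  fixes u :: "complex \<Rightarrow> real"
  assumes u: "continuous_on (cball 0 1) u"
    and sub: "\<And>z e. z \<in> ball 0 1 \<Longrightarrow> 0 < e \<Longrightarrow> \<exists>r>0. cball z r \<subseteq> cball 0 1 \<and>
      u z - e * r\<^sup>2 \<le> circ_mean (\<lambda>c. u (z + of_real r * c))"
    and bd: "\<And>z. z \<in> sphere 0 1 \<Longrightarrow> u z \<le> B"
    and z: "z \<in> cball 0 1"
  shows "u z \<le> B"
proof (rule ccontr)
  assume neg: "\<not> u z \<le> B"
  \<comment> \<open>Half of the excess: the added term is \<open>e\<close> on the circle, too little
    to lift boundary values to the value at \<open>z\<close>.\<close>
  define e where "e = (u z - B) / 2"
  have e: "0 < e" using neg by (simp add: e_def)
  define v where "v w = u w + e * (cmod w)\<^sup>2" for w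
  have v: "continuous_on (cball 0 1) v"
    unfolding v_def by (intro continuous_intros u)
  obtain p where p: "p \<in> cball 0 1" "\<And>w. w \<in> cball 0 1 \<Longrightarrow> v w \<le> v p"
    using continuous_attains_sup[OF compact_cball _ v] z by auto
  have "u z \<le> v z" using e by (simp add: v_def)
  also have "\<dots> \<le> v p" by (rule p(2)[OF z])
  finally have "B + 2 * e \<le> v p" by (simp add: e_def field_simps)
  have "p \<in> ball 0 1"
  proof (rule ccontr)
    assume "p \<notin> ball 0 1"
    with p(1) have "p \<in> sphere 0 1" by simp
    then have "v p \<le> B + e" using bd[of p] by (simp add: v_def)
    with \<open>B + 2 * e \<le> v p\<close> e show False by simp
  qed
  \<comment> \<open>The permitted error is half of the gain \<open>e * r\<^sup>2\<close> that the
    quadratic term brings to the mean.\<close>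
  from sub[OF this, of "e / 2"] e obtain r where r: "0 < r" "cball p r \<subseteq> cball 0 1"
    "u p - e / 2 * r\<^sup>2 \<le> circ_mean (\<lambda>c. u (p + of_real r * c))" by auto
  have in_r: "p + of_real r * c \<in> cball 0 1" if "c \<in> sphere 0 1" for c
    using r that by (intro subsetD[OF r(2)]) (simp add: dist_norm norm_mult)
  have cu: "continuous_on (sphere 0 1) (\<lambda>c. u (p + of_real r * c))"
    by (intro continuous_on_compose2[OF u] continuous_intros) (use in_r in auto)
  have cn: "continuous_on (sphere 0 1) (\<lambda>c. e * (cmod (p + of_real r * c))\<^sup>2)"
    by (intro continuous_intros)
  have "circ_mean (\<lambda>c. v (p + of_real r * c)) \<le> circ_mean (\<lambda>_. v p)"
    unfolding v_def
    by (intro circ_mean_mono continuous_on_add cu cn continuous_on_const)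
      (use p(2)[OF in_r] in \<open>simp add: v_def\<close>)
  moreover have "circ_mean (\<lambda>c. v (p + of_real r * c))
      = circ_mean (\<lambda>c. u (p + of_real r * c)) + e * ((cmod p)\<^sup>2 + r\<^sup>2)"
    unfolding v_def by (subst circ_mean_add[OF cu cn]) (simp add: circ_mean_cmult circ_mean_norm_sq)
  ultimately have "u p - e / 2 * r\<^sup>2 + e * ((cmod p)\<^sup>2 + r\<^sup>2) \<le> v p" using r(3) by simp
  then have "e * r\<^sup>2 \<le> e / 2 * r\<^sup>2" by (simp add: v_def algebra_simps)
  then show False using e r(1) by simp
qed

section \<open>Approximation on the circle by real parts of entire functions\<close>

text \<open>Nonnegative exponents suffice: on the circle a negative power is the conjugate of a
  positive one, and conjugation does not change real parts.\<close>

inductive trig_poly :: "(complex \<Rightarrow> real) \<Rightarrow> bool" where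
  monom: "trig_poly (\<lambda>z. Re (a * z ^ n))"
| add: "trig_poly f \<Longrightarrow> trig_poly g \<Longrightarrow> trig_poly (\<lambda>z. f z + g z)"

lemma trig_poly_holomorphic:
  assumes "trig_poly f"
  obtains P where "P holomorphic_on UNIV" "\<And>z. f z = Re (P z)"
  using assms
proof (induction arbitrary: thesis)
  case (monom a n)
  show ?case by (rule monom[of "\<lambda>z. a * z ^ n"]) (auto intro!: holomorphic_intros)
next
  case (add f g)
  obtain P where P: "P holomorphic_on UNIV" "\<And>z. f z = Re (P z)" using add.IH(1) by blast
  obtain Q where Q: "Q holomorphic_on UNIV" "\<And>z. g z = Re (Q z)" using add.IH(2) by blast
  show ?case
    by (rule add.prems[of "\<lambda>z. P z + Q z"]) (auto intro!: holomorphic_intros simp: P Q)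
qed

text \<open>\<open>Re A * Re B\<close> is the mean of the real parts of \<open>A * B\<close> and
  \<open>cnj A * B\<close>. On the circle \<open>cnj z\<close> inverts \<open>z\<close>, so the
  second product is again a monomial when \<open>m\<close> \<le> \<open>n\<close>; the other case is
  symmetric.\<close>

lemma trig_poly_monom_mult:
  "\<exists>h. trig_poly h \<and> (\<forall>z\<in>sphere 0 1. Re (a * z ^ m) * Re (b * z ^ n) = h z)"
proof (induction m n arbitrary: a b rule: linorder_wlog)
  case (le m n)
  let ?h = "\<lambda>z. Re ((a * b / 2) * z ^ (m + n)) + Re ((cnj a * b / 2) * z ^ (n - m))"
  have "Re (a * z ^ m) * Re (b * z ^ n) = ?h z" if "z \<in> sphere 0 1" for z
  proof -
    have "cnj z * z = 1" using that complex_norm_square[of z] by (simp add: mult.commute)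
    then have zz: "cnj z ^ m * z ^ m = 1" by (simp add: power_mult_distrib[symmetric])
    have "cnj (a * z ^ m) * (b * z ^ n) = cnj a * b * (cnj z ^ m * z ^ m * z ^ (n - m))"
      using le power_add[of z m "n - m"] by simp
    then have *: "cnj (a * z ^ m) * (b * z ^ n) = cnj a * b * z ^ (n - m)" by (simp add: zz)
    have "Re (A) * Re (B) = Re (A * B / 2) + Re (cnj A * B / 2)" for A B :: complex
      by (simp add: field_simps)
    from this[of "a * z ^ m" "b * z ^ n"] show ?thesis unfolding *
      by (simp add: power_add ac_simps del: times_complex.sel Re_divide_numeral)
  qed
  moreover have "trig_poly ?h" by (intro trig_poly.intros)
  ultimately show ?case by blast
next
  case (sym m n)
  obtain h where "trig_poly h" "\<forall>z\<in>sphere 0 1. Re (b * z ^ n) * Re (a * z ^ m) = h z"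
    using sym by blast
  then show ?case by (auto simp: mult.commute)
qed

lemma trig_poly_mult:
  assumes "trig_poly f" "trig_poly g"
  shows "\<exists>h. trig_poly h \<and> (\<forall>z\<in>sphere 0 1. f z * g z = h z)"
  using assms
proof (induction arbitrary: g)
  case (monom a n)
  then show ?case
  proof (induction)
    case (monom b m)
    then show ?case by (rule trig_poly_monom_mult)
  next
    case (add f1 f2)
    let ?p = "\<lambda>z. Re (a * z ^ n)"
    obtain h1 h2 where "trig_poly h1" "\<forall>z\<in>sphere 0 1. ?p z * f1 z = h1 z"
      "trig_poly h2" "\<forall>z\<in>sphere 0 1. ?p z * f2 z = h2 z"
      using add.IH by blast
    then show ?case
      by (intro exI[of _ "\<lambda>z. h1 z + h2 z"]) (simp add: trig_poly.add distrib_left del: times_complex.sel)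
  qed
next
  case (add f1 f2)
  obtain h1 h2 where "trig_poly h1" "\<forall>z\<in>sphere 0 1. f1 z * g z = h1 z"
    "trig_poly h2" "\<forall>z\<in>sphere 0 1. f2 z * g z = h2 z"
    using add.IH[OF add.prems] by blast
  then show ?case
    by (intro exI[of _ "\<lambda>z. h1 z + h2 z"]) (simp add: trig_poly.add distrib_right)
qed

lemma trig_poly_real_polynomial:
  fixes p :: "complex \<Rightarrow> real"
  assumes "real_polynomial_function p"
  shows "\<exists>h. trig_poly h \<and> (\<forall>z\<in>sphere 0 1. p z = h z)"
  using assms
proof induction
  case (linear f)
  then interpret bounded_linear f .
  have "f z = Re (Complex (f 1) (- f \<i>) * z ^ 1)" for z
  proof -
    have "f z = f (Re z *\<^sub>R 1 + Im z *\<^sub>R \<i>)" by (rule arg_cong[of _ _ f]) (simp add: complex_eq_iff)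
    also have "\<dots> = Re z * f 1 + Im z * f \<i>" by (simp only: add scaleR real_scaleR_def)
    finally show ?thesis by simp
  qed
  then show ?case using trig_poly.monom[of "Complex (f 1) (- f \<i>)" 1] by metis
next
  case (const c)
  show ?case using trig_poly.monom[of "of_real c" 0] by (intro exI[of _ "\<lambda>z. Re (of_real c * z ^ 0)"]) simp
next
  case (add f g)
  then obtain h k where "trig_poly h" "\<forall>z\<in>sphere 0 1. f z = h z"
    "trig_poly k" "\<forall>z\<in>sphere 0 1. g z = k z" by blast
  then show ?case by (intro exI[of _ "\<lambda>z. h z + k z"]) (simp add: trig_poly.add)
next
  case (mult f g)
  then obtain h k where "trig_poly h" "\<forall>z\<in>sphere 0 1. f z = h z"
    "trig_poly k" "\<forall>z\<in>sphere 0 1. g z = k z" by blast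
  moreover from this obtain l where "trig_poly l" "\<forall>z\<in>sphere 0 1. h z * k z = l z"
    using trig_poly_mult by blast
  ultimately show ?case by (intro exI[of _ l]) simp
qed

text \<open>An approximate Dirichlet problem: \<open>Re P\<close> is harmonic on the plane and
  nearly \<open>u\<close> on the circle. Stone-Weierstrass stands in for the Poisson
  integral.\<close>

lemma circle_approx_holomorphic:
  fixes u :: "complex \<Rightarrow> real"
  assumes "continuous_on (sphere 0 1) u" "0 < e"
  obtains P where "P holomorphic_on UNIV" "\<And>z. z \<in> sphere 0 1 \<Longrightarrow> \<bar>u z - Re (P z)\<bar> < e"
proof -
  obtain p where p: "real_polynomial_function p" "\<And>z. z \<in> sphere 0 1 \<Longrightarrow> \<bar>u z - p z\<bar> < e"
    using Stone_Weierstrass_real_polynomial_function[OF _ assms] by (auto simp: compact_sphere)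
  obtain h where h: "trig_poly h" "\<And>z. z \<in> sphere 0 1 \<Longrightarrow> p z = h z"
    using trig_poly_real_polynomial[OF p(1)] by blast
  obtain P where "P holomorphic_on UNIV" "\<And>z. h z = Re (P z)"
    using trig_poly_holomorphic[OF h(1)] by blast
  then show thesis using that p(2) h(2) by auto
qed

text \<open>Subtracting a harmonic \<open>Re P\<close> that is close to \<open>u\<close> on the
  circle preserves the local inequality, so the maximum principle makes the difference small at 0.
  There \<open>Re P\<close> equals its own mean, which is close to that of \<open>u\<close>. This is
  what makes plurisubharmonicity a local property.\<close>

lemma submean_local_to_global:
  fixes u :: "complex \<Rightarrow> real"
  assumes u: "continuous_on (cball 0 1) u"
    and sub: "\<And>z. z \<in> ball 0 1 \<Longrightarrow> \<exists>r>0. cball z r \<subseteq> cball 0 1 \<and>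
      u z \<le> circ_mean (\<lambda>c. u (z + of_real r * c))"
  shows "u 0 \<le> circ_mean u"
proof (rule field_le_epsilon)
  fix e :: real assume e: "0 < e"
  have us: "continuous_on (sphere 0 1) u" by (rule continuous_on_subset[OF u]) auto
  obtain P where P: "P holomorphic_on UNIV" "\<And>z. z \<in> sphere 0 1 \<Longrightarrow> \<bar>u z - Re (P z)\<bar> < e / 2"
    using circle_approx_holomorphic[OF us, of "e / 2"] e by auto
  have cP: "continuous_on S (\<lambda>z. Re (P z))" for S
    using holomorphic_on_imp_continuous_on[OF P(1)] continuous_on_subset
    by (intro continuous_on_Re) blast
  have "u 0 - Re (P 0) \<le> e / 2"
  proof (rule max_principle[where u = "\<lambda>z. u z - Re (P z)"])
    show "continuous_on (cball 0 1) (\<lambda>z. u z - Re (P z))"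
      by (intro continuous_on_diff u cP)
    show "\<exists>r>0. cball z r \<subseteq> cball 0 1 \<and> u z - Re (P z) - d * r\<^sup>2
        \<le> circ_mean (\<lambda>c. u (z + of_real r * c) - Re (P (z + of_real r * c)))"
      if z: "z \<in> ball 0 1" and d: "0 < d" for z d
    proof -
      obtain r where r: "0 < r" "cball z r \<subseteq> cball 0 1" "u z \<le> circ_mean (\<lambda>c. u (z + of_real r * c))"
        using sub[OF z] by blast
      have in_r: "z + of_real r * c \<in> cball 0 1" if "c \<in> sphere 0 1" for c
        using r that by (intro subsetD[OF r(2)]) (simp add: dist_norm norm_mult)
      have "circ_mean (\<lambda>c. u (z + of_real r * c) - Re (P (z + of_real r * c)))
          = circ_mean (\<lambda>c. u (z + of_real r * c)) - circ_mean (\<lambda>c. Re (P (z + of_real r * c)))"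
        by (intro circ_mean_diff continuous_on_compose2[OF u] continuous_intros
            continuous_on_compose2[OF cP[of UNIV], where f = "\<lambda>c. z + of_real r * c"]) (use in_r in auto)
      also have "circ_mean (\<lambda>c. Re (P (z + of_real r * c))) = Re (P z)"
        using circ_mean_holomorphic[OF P(1), of 1] by simp
      finally show ?thesis using r mult_nonneg_nonneg[of d "r\<^sup>2"] d by (intro exI[of _ r]) (auto simp del: mult_nonneg_nonneg)
    qed
    show "u z - Re (P z) \<le> e / 2" if "z \<in> sphere 0 1" for z
      using P(2)[OF that] by linarith
  qed auto
  moreover have "circ_mean (\<lambda>c. Re (P c) - e / 2) \<le> circ_mean u"
  proof (intro circ_mean_mono us continuous_on_diff cP continuous_on_const)
    show "Re (P c) - e / 2 \<le> u c" if "c \<in> sphere 0 1" for c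
      using P(2)[OF that] by linarith
  qed
  moreover have "circ_mean (\<lambda>c. Re (P c) - e / 2) = Re (P 0) - e / 2"
    using circ_mean_holomorphic[OF P(1), of 1 0 1] by (subst circ_mean_diff) (auto intro: cP)
  ultimately show "u 0 \<le> circ_mean u + e" by linarith
qed

section \<open>Plurisubharmonic functions along holomorphic discs\<close>

text \<open>Fubini: mean value inequalities for all translates along the segment integrate to one
  for the average.\<close>

lemma box_avg_submean:
  fixes h :: "'a::real_normed_vector \<Rightarrow> real"
  assumes h: "continuous_on UNIV h" and \<gamma>: "continuous_on (sphere 0 1) \<gamma>"
    and sub: "\<And>s. s \<in> {0..1} \<Longrightarrow> h (a + s *\<^sub>R v) \<le> circ_mean (\<lambda>c. h (\<gamma> c + s *\<^sub>R v))"
  shows "box_avg v h a \<le> circ_mean (\<lambda>c. box_avg v h (\<gamma> c))"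
proof -
  let ?F = "\<lambda>\<theta> s. h (\<gamma> (cis \<theta>) + s *\<^sub>R v)"
  have cis: "continuous_on S cis" for S
    unfolding cis_conv_exp by (intro continuous_intros)
  have \<gamma>c: "continuous_on (S \<times> T) (\<lambda>x. \<gamma> (cis (fst x)))" for S and T :: "real set"
    by (rule continuous_on_compose2[OF \<gamma>], rule continuous_on_compose2[OF cis])
      (auto intro!: continuous_intros)
  have F: "continuous_on (S \<times> T) (\<lambda>(\<theta>, s). ?F \<theta> s)" for S T
    unfolding case_prod_beta
    by (rule continuous_on_compose2[OF h]) (auto intro!: continuous_intros \<gamma>c)
  have F': "continuous_on (S \<times> T) (\<lambda>(s, \<theta>). ?F \<theta> s)" for S T
    using continuous_on_compose2[OF F[of T S] continuous_on_swap, of "S \<times> T"]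
    by (force simp: case_prod_beta prod.swap_def)
  have "box_avg v h a \<le> integral {0..1} (\<lambda>s. 1 / (2 * pi) * integral {0..2 * pi} (\<lambda>\<theta>. ?F \<theta> s))"
    unfolding box_avg_def
  proof (intro integral_le box_integrable h integrable_continuous_real continuous_intros)
    show "continuous_on {0..1} (\<lambda>s. integral {0..2 * pi} (\<lambda>\<theta>. ?F \<theta> s))"
      using integral_continuous_on_param[OF F'[of "{0..1}" "cbox 0 (2 * pi)"]] by simp
    show "h (a + s *\<^sub>R v) \<le> 1 / (2 * pi) * integral {0..2 * pi} (\<lambda>\<theta>. ?F \<theta> s)" if "s \<in> {0..1}" for s
      using sub[OF that] by (simp add: circ_mean_def)
  qed
  also have "\<dots> = 1 / (2 * pi) * integral {0..1} (\<lambda>s. integral {0..2 * pi} (\<lambda>\<theta>. ?F \<theta> s))"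
    by simp
  also have "integral {0..1} (\<lambda>s. integral {0..2 * pi} (\<lambda>\<theta>. ?F \<theta> s))
      = integral {0..2 * pi} (\<lambda>\<theta>. integral {0..1} (\<lambda>s. ?F \<theta> s))"
    using integral_swap_continuous[of 0 0 "2*pi" 1 ?F] continuous_on_subset[OF F[of UNIV UNIV]] by simp
  finally show ?thesis by (simp add: circ_mean_def box_avg_def)
qed

lemma has_dderiv_linear_approx:
  assumes d: "has_dderiv v U \<alpha>" and b: "\<And>s. \<bar>s\<bar> \<le> \<bar>t\<bar> \<Longrightarrow> \<bar>\<alpha> (x + s *\<^sub>R v) - a\<bar> \<le> e"
  shows "\<bar>U (x + t *\<^sub>R v) - U x - t * a\<bar> \<le> e * \<bar>t\<bar>"
proof -
  let ?f = "\<lambda>s. U (x + s *\<^sub>R v) - s * a"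
  have "norm (?f t - ?f 0) \<le> e * norm (t - 0)"
  proof (rule field_differentiable_bound[where S = "{-\<bar>t\<bar>..\<bar>t\<bar>}"])
    show "(?f has_field_derivative \<alpha> (x + s *\<^sub>R v) - a) (at s within {-\<bar>t\<bar>..\<bar>t\<bar>})" for s
      by (rule derivative_eq_intros has_dderivD[OF d] refl | simp)+
    show "norm (\<alpha> (x + s *\<^sub>R v) - a) \<le> e" if "s \<in> {-\<bar>t\<bar>..\<bar>t\<bar>}" for s
      using b[of s] that by auto
  qed auto
  then show ?thesis by (simp add: algebra_simps)
qed

lemma entire_second_order_bound:
  assumes g: "g holomorphic_on UNIV"
  obtains C where "0 < C" "\<And>h. cmod h \<le> 1 \<Longrightarrow> cmod (g (z + h) - g z - deriv g z * h) \<le> C * (cmod h)\<^sup>2"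
proof -
  let ?f = "\<lambda>i. (deriv ^^ i) g"
  have hol: "?f i holomorphic_on UNIV" for i
    using g by (intro holomorphic_higher_deriv) auto
  have "compact (?f 2 ` cball z 1)"
    using holomorphic_on_imp_continuous_on[OF hol] continuous_on_subset
    by (intro compact_continuous_image compact_cball) blast
  then obtain B where B: "\<And>x. x \<in> cball z 1 \<Longrightarrow> cmod (?f 2 x) \<le> B"
    using bounded_iff compact_imp_bounded by (metis imageI)
  show thesis
  proof
    show "0 < \<bar>B\<bar> + 1" by simp
    fix h assume h: "cmod h \<le> 1"
    have "cmod (?f 0 (z + h) - (\<Sum>i\<le>1. ?f i z * (z + h - z) ^ i / fact i)) \<le> B * cmod (z + h - z) ^ Suc 1 / fact 1"
    proof (rule field_Taylor[where S = "cball z 1"])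
      show "(?f i has_field_derivative ?f (Suc i) x) (at x within cball z 1)" for i x
        using holomorphic_derivI[OF hol[of i] open_UNIV, of x] by (auto intro: has_field_derivative_at_within)
      show "cmod (?f (Suc 1) x) \<le> B" if "x \<in> cball z 1" for x
        using B[OF that] by (simp add: numeral_2_eq_2)
    qed (use h in \<open>auto simp: dist_norm\<close>)
    then have "cmod (g (z + h) - (g z + deriv g z * h)) \<le> B * (cmod h)\<^sup>2"
      by (simp add: numeral_2_eq_2)
    also have "\<dots> \<le> (\<bar>B\<bar> + 1) * (cmod h)\<^sup>2" by (intro mult_right_mono) auto
    finally show "cmod (g (z + h) - g z - deriv g z * h) \<le> (\<bar>B\<bar> + 1) * (cmod h)\<^sup>2"
      by (simp add: algebra_simps)
  qed
qed

text \<open>Box averages in the second variable make the function continuously differentiable there. The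
  disc deviates from its tangent by a holomorphic remainder of second order: the first-order effect of
  the remainder has circular mean zero, and the rest is negligible in \<open>max_principle\<close>.\<close>

lemma max_principle_graph:
  fixes u :: "complex \<times> complex \<Rightarrow> real"
  assumes U: "open U" and u: "continuous_on U u"
    and sub: "\<And>z w p q. (\<And>c. cmod c \<le> 1 \<Longrightarrow> (z + c * p, w + c * q) \<in> U) \<Longrightarrow>
      u (z, w) \<le> circ_mean (\<lambda>c. u (z + c * p, w + c * q))"
    and g: "g holomorphic_on UNIV" and gU: "\<And>z. z \<in> cball 0 1 \<Longrightarrow> (z, g z) \<in> U"
    and bd: "\<And>z. z \<in> sphere 0 1 \<Longrightarrow> u (z, g z) \<le> B"
    and z: "z \<in> cball 0 1"
  shows "u (z, g z) \<le> B"
proof (rule field_le_epsilon)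
  fix e :: real assume e: "0 < e"
  have cg: "continuous_on S g" for S
    using holomorphic_on_imp_continuous_on[OF g] continuous_on_subset by blast
  have "compact ((\<lambda>z. (z, g z)) ` cball 0 1)"
    by (intro compact_continuous_image compact_cball continuous_intros cg)
  then obtain d0 where d0: "0 < d0" "(\<Union>x\<in>(\<lambda>z. (z, g z)) ` cball 0 1. ball x d0) \<subseteq> U"
    using compact_subset_open_imp_ball_epsilon_subset[OF _ U] gU by (metis image_subsetI)
  \<comment> \<open>Radius, in the second variable, of a compact tube \<open>K\<close> around the
    graph inside \<open>U\<close>.\<close>
  define d1 where "d1 = d0 / 2"
  have d1: "0 < d1" using d0 by (simp add: d1_def)
  define K where "K = (\<lambda>x. (fst x, g (fst x) + snd x)) ` (cball 0 1 \<times> cball 0 d1)"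
  have K: "compact K" unfolding K_def
    by (intro compact_continuous_image compact_Times compact_cball continuous_intros continuous_on_compose2[OF cg]) auto
  have KI: "(x, y) \<in> K" if "cmod x \<le> 1" "cmod (y - g x) \<le> d1" for x y
    unfolding K_def by (rule image_eqI[of _ _ "(x, y - g x)"]) (use that in auto)
  have KU: "K \<subseteq> U"
  proof
    fix a assume "a \<in> K"
    then obtain x y where a: "a = (x, g x + y)" "x \<in> cball 0 1" "cmod y \<le> d1" by (auto simp: K_def)
    then have "a \<in> ball (x, g x) d0" using d1 by (simp add: d1_def dist_Pair_Pair dist_norm)
    then show "a \<in> U" using a d0 by blast
  qed
  obtain b where b: "\<And>x. x \<in> K \<Longrightarrow> norm (u x) \<le> b"
    using compact_imp_bounded[OF compact_continuous_image[OF continuous_on_subset[OF u KU] K]]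
    by (auto simp: bounded_iff)
  \<comment> \<open>Box averages are formed of functions on the whole space. The extension agrees
    with \<open>u\<close> on the tube, where all values that matter are taken.\<close>
  obtain t where t: "continuous_on UNIV t" "\<And>x. x \<in> K \<Longrightarrow> t x = u x"
    using Tietze[of K u UNIV "\<bar>b\<bar>"] continuous_on_subset[OF u KU] compact_imp_closed[OF K] b
    by (metis abs_ge_self abs_ge_zero closed_closedin order_trans subtopology_UNIV)
  have "uniformly_continuous_on K t"
    using compact_uniformly_continuous[OF continuous_on_subset[OF t(1)] K] by simp
  then obtain d2 where d2: "0 < d2"
    "\<And>x y. x \<in> K \<Longrightarrow> y \<in> K \<Longrightarrow> dist x y < d2 \<Longrightarrow> \<bar>t x - t y\<bar> < e / 2"
    using e unfolding uniformly_continuous_on_def dist_real_def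
    by (metis half_gt_zero abs_minus_commute)
  \<comment> \<open>Two averages of length \<open>d\<close> move a point by at most
    \<open>2 * d\<close>. Half of the tube radius is kept for the remainder \<open>Q\<close>, and
    \<open>u\<close> varies by less than \<open>e / 2\<close> over such a shift.\<close>
  define d where "d = min (d1 / 4) (d2 / 4)"
  have d: "0 < d" "2 * d \<le> d1 / 2" "2 * d < d2" using d1 d2(1) by (auto simp: d_def)
  let ?vx = "(0, 1) :: complex \<times> complex" and ?vy = "(0, \<i>) :: complex \<times> complex"
  define t1 where "t1 = box_avg (d *\<^sub>R ?vy) t"
  define T where "T = box_avg (d *\<^sub>R ?vx) t1"
  have dy: "has_dderiv ?vy t1 (\<lambda>x. (t (x + d *\<^sub>R ?vy) - t x) / d)"
    unfolding t1_def by (rule has_dderiv_box_avg_self[OF t(1) d(1)])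
  have cdy: "continuous_on UNIV (\<lambda>x. (t (x + d *\<^sub>R ?vy) - t x) / d)"
    by (intro continuous_intros continuous_on_compose2[OF t(1)]) (use d in auto)
  have cavg: "continuous_on UNIV (box_avg w h)" if h: "continuous_on UNIV h"
    for w and h :: "complex \<times> complex \<Rightarrow> real"
  proof -
    have "continuous_on (UNIV \<times> cbox 0 1) (\<lambda>(x, s). h (x + s *\<^sub>R w))"
      unfolding case_prod_beta by (intro continuous_on_compose2[OF h] continuous_intros) auto
    from integral_continuous_on_param[OF this] show ?thesis
      by (simp add: box_avg_def[abs_def])
  qed
  have ct1: "continuous_on UNIV t1" unfolding t1_def by (rule cavg[OF t(1)])
  have cT: "continuous_on S T" for S unfolding T_def
    by (rule continuous_on_subset[OF cavg[OF ct1]]) simp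
  \<comment> \<open>\<alpha> and \<beta> are the derivatives of \<open>T\<close> along the real and
    the imaginary direction of the second variable.\<close>
  define \<alpha> where "\<alpha> x = (t1 (x + d *\<^sub>R ?vx) - t1 x) / d" for x
  define \<beta> where "\<beta> = box_avg (d *\<^sub>R ?vx) (\<lambda>x. (t (x + d *\<^sub>R ?vy) - t x) / d)"
  have \<alpha>: "has_dderiv ?vx T \<alpha>"
    unfolding T_def \<alpha>_def by (rule has_dderiv_box_avg_self[OF ct1 d(1)])
  have \<beta>: "has_dderiv ?vy T \<beta>"
    unfolding T_def \<beta>_def by (rule has_dderiv_box_avg[OF ct1 cdy dy])
  have c\<alpha>: "continuous_on UNIV \<alpha>" unfolding \<alpha>_def
    by (intro continuous_intros continuous_on_compose2[OF ct1]) (use d in auto)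
  have c\<beta>: "continuous_on UNIV \<beta>" unfolding \<beta>_def by (rule cavg[OF cdy])
  have shift: "norm (s *\<^sub>R d *\<^sub>R ?vx + s' *\<^sub>R d *\<^sub>R ?vy) \<le> 2 * d" if "s \<in> {0..1}" "s' \<in> {0..1}" for s s'
  proof -
    have "norm (s *\<^sub>R d *\<^sub>R ?vx + s' *\<^sub>R d *\<^sub>R ?vy) \<le> s * d + s' * d"
      using norm_triangle_ineq[of "s *\<^sub>R d *\<^sub>R ?vx" "s' *\<^sub>R d *\<^sub>R ?vy"] that d(1) by (simp add: norm_Pair)
    also have "\<dots> \<le> 1 * d + 1 * d" using that d(1) by (intro add_mono mult_right_mono) auto
    finally show ?thesis by simp
  qed
  have Tu: "\<bar>T (x, g x) - u (x, g x)\<bar> \<le> e / 2" if x: "x \<in> cball 0 1" for x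
    unfolding T_def
  proof (rule box_avg_near[OF ct1])
    fix s :: real assume s: "s \<in> {0..1}"
    show "\<bar>t1 ((x, g x) + s *\<^sub>R d *\<^sub>R ?vx) - u (x, g x)\<bar> \<le> e / 2"
      unfolding t1_def
    proof (rule box_avg_near[OF t(1)])
      fix s' :: real assume s': "s' \<in> {0..1}"
      let ?v = "s *\<^sub>R d *\<^sub>R ?vx + s' *\<^sub>R d *\<^sub>R ?vy"
      have "norm ?v = cmod (snd ?v)" by (simp add: norm_Pair)
      then have "(x, g x) + ?v \<in> K" "(x, g x) \<in> K"
        using x shift[OF s s'] d d1 KI[of x "g x + snd ?v"] KI[of x "g x"] by auto
      moreover have "dist ((x, g x) + ?v) (x, g x) < d2"
        using shift[OF s s'] d by (simp add: dist_norm)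
      ultimately show "\<bar>t ((x, g x) + s *\<^sub>R d *\<^sub>R ?vx + s' *\<^sub>R d *\<^sub>R ?vy) - u (x, g x)\<bar> \<le> e / 2"
        using d2(2) t(2) by (metis add.assoc less_imp_le)
    qed
  qed
  have "T (z, g z) \<le> B + e / 2"
  proof (rule max_principle[where u = "\<lambda>z. T (z, g z)", OF _ _ _ z])
    show "continuous_on (cball 0 1) (\<lambda>z. T (z, g z))"
      by (intro continuous_on_compose2[OF cT[of UNIV]] continuous_intros cg) auto
    show "T (x, g x) \<le> B + e / 2" if "x \<in> sphere 0 1" for x
    proof -
      have "x \<in> cball 0 1" using that by simp
      then show ?thesis using Tu[of x] bd[OF that] by linarith
    qed
    show "\<exists>r>0. cball z r \<subseteq> cball 0 1 \<and> T (z, g z) - e' * r\<^sup>2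
        \<le> circ_mean (\<lambda>c. T (z + of_real r * c, g (z + of_real r * c)))"
      if z: "z \<in> ball 0 1" and e': "0 < e'" for z e'
    proof -
      let ?p = "(z, g z)"
      obtain C where C: "0 < C"
        "\<And>h. cmod h \<le> 1 \<Longrightarrow> cmod (g (z + h) - g z - deriv g z * h) \<le> C * (cmod h)\<^sup>2"
        using entire_second_order_bound[OF g] by metis
      define Q where "Q h = g (z + h) - g z - deriv g z * h" for h
      \<comment> \<open>Makes two first-order errors, each at most
        \<open>\<eta> * (C * r\<^sup>2)\<close>, add up to \<open>e' * r\<^sup>2\<close>.\<close>
      define \<eta> where "\<eta> = e' / (2 * C)"
      have \<eta>: "0 < \<eta>" using e' C by (simp add: \<eta>_def)
      obtain \<rho>1 where \<rho>1: "0 < \<rho>1" "\<And>x. dist x ?p < \<rho>1 \<Longrightarrow> \<bar>\<alpha> x - \<alpha> ?p\<bar> < \<eta>"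
        using c\<alpha> \<eta> unfolding continuous_on_iff dist_real_def by (metis UNIV_I)
      obtain \<rho>2 where \<rho>2: "0 < \<rho>2" "\<And>x. dist x ?p < \<rho>2 \<Longrightarrow> \<bar>\<beta> x - \<beta> ?p\<bar> < \<eta>"
        using c\<beta> \<eta> unfolding continuous_on_iff dist_real_def by (metis UNIV_I)
      define \<rho> where "\<rho> = min \<rho>1 \<rho>2"
      \<comment> \<open>Per unit of \<open>r\<close>, the distance from \<open>?p\<close> on the way
        from the tangent disc to the graph: 1 for the first coordinate, the slope of
        \<open>g\<close> for the second, and \<open>C\<close> for each component of
        \<open>Q\<close>.\<close>
      define M where "M = 1 + cmod (deriv g z) + 2 * C"
      have M: "1 \<le> M" using C by (simp add: M_def)
      \<comment> \<open>The four bounds keep the disc in the unit disc, validate the second-order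
        estimate, keep \<open>Q\<close> within half of the tube radius, and keep the path within
        \<rho> of \<open>?p\<close>.\<close>
      define r where "r = min (1 - cmod z) (min 1 (min (d1 / (2 * C)) (\<rho> / (2 * M))))"
      have \<rho>: "0 < \<rho>" using \<rho>1 \<rho>2 by (simp add: \<rho>_def)
      have r: "0 < r" "r \<le> 1 - cmod z" "r \<le> 1" "r * C \<le> d1 / 2" "r * M < \<rho>"
      proof -
        show "0 < r" using z C d1 \<rho> M by (simp add: r_def)
        show "r \<le> 1 - cmod z" "r \<le> 1" by (simp_all add: r_def)
        have "r * C \<le> d1 / (2 * C) * C" using C by (intro mult_right_mono) (auto simp: r_def)
        then show "r * C \<le> d1 / 2" using C by simp
        have "r * M \<le> \<rho> / (2 * M) * M" using M by (intro mult_right_mono) (auto simp: r_def)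
        then show "r * M < \<rho>" using M \<rho> by simp
      qed
      have r2: "r\<^sup>2 \<le> r" using r by (simp add: power2_eq_square mult_left_le)
      have Qb: "cmod (Q (of_real r * c)) \<le> C * r\<^sup>2" if "cmod c \<le> 1" for c
      proof -
        have rc: "cmod (of_real r * c) \<le> r" using that r(1) by (simp add: norm_mult mult_left_le)
        then have "cmod (Q (of_real r * c)) \<le> C * (cmod (of_real r * c))\<^sup>2"
          using C(2)[of "of_real r * c"] r(3) by (simp add: Q_def)
        also have "\<dots> \<le> C * r\<^sup>2" using rc C(1) by (intro mult_left_mono power_mono) auto
        finally show ?thesis .
      qed
      have Qr: "C * r\<^sup>2 \<le> d1 / 2"
        using mult_left_mono[OF r2 less_imp_le[OF C(1)]] r(4) by (simp add: mult.commute)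
      \<comment> \<open>The affine disc tangent to the graph at \<open>?p\<close>; being affine, it
        is covered by \<open>sub\<close>.\<close>
      define L where "L c = (z + of_real r * c, g z + deriv g z * (of_real r * c))" for c
      have cL: "continuous_on S L" for S unfolding L_def by (intro continuous_intros)
      have zc: "cmod (z + of_real r * c) \<le> 1" if "cmod c \<le> 1" for c
      proof -
        have "cmod (z + of_real r * c) \<le> cmod z + r * cmod c"
          using norm_triangle_ineq[of z "of_real r * c"] r(1) by (simp add: norm_mult)
        also have "\<dots> \<le> cmod z + r * 1" using that r(1) by (intro add_left_mono mult_left_mono) auto
        finally show ?thesis using r(2) by simp
      qed
      have LK: "L c + (s *\<^sub>R d *\<^sub>R ?vx + s' *\<^sub>R d *\<^sub>R ?vy) \<in> K"
        if c: "cmod c \<le> 1" and s: "s \<in> {0..1}" "s' \<in> {0..1}" for c s s'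
      proof -
        let ?v = "s *\<^sub>R d *\<^sub>R ?vx + s' *\<^sub>R d *\<^sub>R ?vy"
        have "norm ?v = cmod (snd ?v)" by (simp add: norm_Pair)
        have "cmod (snd (L c + ?v) - g (z + of_real r * c)) = cmod (snd ?v - Q (of_real r * c))"
          by (simp add: L_def Q_def algebra_simps)
        also have "\<dots> \<le> cmod (snd ?v) + cmod (Q (of_real r * c))" by (rule norm_triangle_ineq4)
        also have "\<dots> \<le> 2 * d + C * r\<^sup>2"
          using shift[OF s] Qb[OF c] \<open>norm ?v = _\<close> by (intro add_mono) simp_all
        also have "\<dots> \<le> d1" using d(2) Qr by simp
        finally show ?thesis using KI[OF zc[OF c], of "snd (L c + ?v)"] by (simp add: L_def)
      qed
      have "T ?p \<le> circ_mean (\<lambda>c. T (L c))"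
        unfolding T_def
      proof (rule box_avg_submean[OF ct1 cL])
        fix s :: real assume s: "s \<in> {0..1}"
        show "t1 (?p + s *\<^sub>R d *\<^sub>R ?vx) \<le> circ_mean (\<lambda>c. t1 (L c + s *\<^sub>R d *\<^sub>R ?vx))"
          unfolding t1_def
        proof (rule box_avg_submean[OF t(1)])
          show "continuous_on (sphere 0 1) (\<lambda>c. L c + s *\<^sub>R d *\<^sub>R ?vx)" by (intro continuous_intros cL)
          fix s' :: real assume s': "s' \<in> {0..1}"
          let ?v = "s *\<^sub>R d *\<^sub>R ?vx + s' *\<^sub>R d *\<^sub>R ?vy"
          have inK: "(fst ?p + c * of_real r, snd (?p + ?v) + c * (deriv g z * of_real r)) \<in> K" if "cmod c \<le> 1" for c
            using LK[OF that s s'] by (simp add: L_def algebra_simps)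
          have "u (fst ?p, snd (?p + ?v)) \<le> circ_mean (\<lambda>c. u (fst ?p + c * of_real r, snd (?p + ?v) + c * (deriv g z * of_real r)))"
            by (rule sub) (use inK KU in blast)
          moreover have "circ_mean (\<lambda>c. u (fst ?p + c * of_real r, snd (?p + ?v) + c * (deriv g z * of_real r)))
              = circ_mean (\<lambda>c. t (L c + s *\<^sub>R d *\<^sub>R ?vx + s' *\<^sub>R d *\<^sub>R ?vy))"
          proof (rule circ_mean_cong)
            fix c :: complex assume "c \<in> sphere 0 1"
            then show "u (fst ?p + c * of_real r, snd (?p + ?v) + c * (deriv g z * of_real r))
              = t (L c + s *\<^sub>R d *\<^sub>R ?vx + s' *\<^sub>R d *\<^sub>R ?vy)"
              using t(2)[OF inK[of c]] by (simp add: L_def algebra_simps)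
          qed
          moreover have "u (fst ?p, snd (?p + ?v)) = t (?p + s *\<^sub>R d *\<^sub>R ?vx + s' *\<^sub>R d *\<^sub>R ?vy)"
            using t(2)[OF inK[of 0]] by (simp add: algebra_simps)
          ultimately show "t (?p + s *\<^sub>R d *\<^sub>R ?vx + s' *\<^sub>R d *\<^sub>R ?vy)
              \<le> circ_mean (\<lambda>c. t (L c + s *\<^sub>R d *\<^sub>R ?vx + s' *\<^sub>R d *\<^sub>R ?vy))" by simp
        qed
      qed
      \<comment> \<open>The first-order effect of \<open>Q\<close> is the real part of a holomorphic
        function of \<open>c\<close> that vanishes at 0, so it drops out of the mean.\<close>
      moreover have "circ_mean (\<lambda>c. T (L c) + Re (Complex (\<alpha> ?p) (- \<beta> ?p) * Q (of_real r * c)) - e' * r\<^sup>2)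
          \<le> circ_mean (\<lambda>c. T (z + of_real r * c, g (z + of_real r * c)))"
      proof (intro circ_mean_mono)
        show "continuous_on (sphere 0 1) (\<lambda>c. T (L c) + Re (Complex (\<alpha> ?p) (- \<beta> ?p) * Q (of_real r * c)) - e' * r\<^sup>2)"
          unfolding Q_def
          by (intro continuous_intros continuous_on_compose2[OF cT[of UNIV] cL] continuous_on_compose2[OF cg[of UNIV]]) auto
        show "continuous_on (sphere 0 1) (\<lambda>c. T (z + of_real r * c, g (z + of_real r * c)))"
          by (intro continuous_intros continuous_on_compose2[OF cT[of UNIV]] continuous_on_compose2[OF cg[of UNIV]]) auto
        fix c :: complex assume "c \<in> sphere 0 1"
        then have c: "cmod c \<le> 1" by simp
        let ?q = "Q (of_real r * c)"
        have near: "dist (L c + a *\<^sub>R ?vx + b *\<^sub>R ?vy) ?p < \<rho>" if "\<bar>a\<bar> \<le> cmod ?q" "\<bar>b\<bar> \<le> cmod ?q" for a b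
        proof -
          have "L c + a *\<^sub>R ?vx + b *\<^sub>R ?vy - ?p
              = (of_real r * c, deriv g z * (of_real r * c) + of_real a + of_real b * \<i>)"
            by (simp add: L_def scaleR_conv_of_real)
          also have "norm \<dots> \<le> cmod (of_real r * c) + cmod (deriv g z * (of_real r * c) + of_real a + of_real b * \<i>)"
            by (rule norm_Pair_le)
          also have "cmod (deriv g z * (of_real r * c) + of_real a + of_real b * \<i>)
              \<le> cmod (deriv g z * (of_real r * c)) + cmod (of_real a) + cmod (of_real b * \<i>)"
            by (intro norm_triangle_le add_right_mono norm_triangle_ineq)
          also have "cmod (of_real r * c) + (cmod (deriv g z * (of_real r * c)) + cmod (of_real a) + cmod (of_real b * \<i>))
              = cmod (of_real r * c) + (cmod (deriv g z) * cmod (of_real r * c) + \<bar>a\<bar> + \<bar>b\<bar>)"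
            by (simp add: norm_mult)
          also have "\<dots> \<le> r + (cmod (deriv g z) * r + C * r + C * r)"
          proof (intro add_mono mult_left_mono)
            show "cmod (of_real r * c) \<le> r" "cmod (of_real r * c) \<le> r"
              using c r(1) by (simp_all add: norm_mult mult_left_le)
            have "C * r\<^sup>2 \<le> C * r" using r2 C(1) by simp
            then show "\<bar>a\<bar> \<le> C * r" "\<bar>b\<bar> \<le> C * r" using that Qb[OF c] by linarith+
          qed simp
          also have "\<dots> = r * M" by (simp add: M_def algebra_simps)
          also have "\<dots> < \<rho>" by (rule r(5))
          finally show ?thesis by (simp add: dist_norm)
        qed
        have 1: "\<bar>T (L c + Re ?q *\<^sub>R ?vx) - T (L c) - Re ?q * \<alpha> ?p\<bar> \<le> \<eta> * \<bar>Re ?q\<bar>"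
        proof (rule has_dderiv_linear_approx[OF \<alpha>])
          fix s :: real assume "\<bar>s\<bar> \<le> \<bar>Re ?q\<bar>"
          then have "dist (L c + s *\<^sub>R ?vx + 0 *\<^sub>R ?vy) ?p < \<rho>"
            by (intro near) (use abs_Re_le_cmod[of ?q] in linarith, simp)
          then have "dist (L c + s *\<^sub>R ?vx) ?p < \<rho>" by (simp only: scaleR_zero_left add_0_right)
          then show "\<bar>\<alpha> (L c + s *\<^sub>R ?vx) - \<alpha> ?p\<bar> \<le> \<eta>"
            using \<rho>1(2)[of "L c + s *\<^sub>R ?vx"] by (simp add: \<rho>_def)
        qed
        have 2: "\<bar>T (L c + Re ?q *\<^sub>R ?vx + Im ?q *\<^sub>R ?vy) - T (L c + Re ?q *\<^sub>R ?vx) - Im ?q * \<beta> ?p\<bar> \<le> \<eta> * \<bar>Im ?q\<bar>"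
        proof (rule has_dderiv_linear_approx[OF \<beta>])
          fix s :: real assume "\<bar>s\<bar> \<le> \<bar>Im ?q\<bar>"
          then have "dist (L c + Re ?q *\<^sub>R ?vx + s *\<^sub>R ?vy) ?p < \<rho>"
            by (intro near) (use abs_Re_le_cmod[of ?q] abs_Im_le_cmod[of ?q] in linarith)+
          then show "\<bar>\<beta> (L c + Re ?q *\<^sub>R ?vx + s *\<^sub>R ?vy) - \<beta> ?p\<bar> \<le> \<eta>"
            using \<rho>2(2)[of "L c + Re ?q *\<^sub>R ?vx + s *\<^sub>R ?vy"] by (simp add: \<rho>_def)
        qed
        have tip: "L c + Re ?q *\<^sub>R ?vx + Im ?q *\<^sub>R ?vy = (z + of_real r * c, g (z + of_real r * c))"
          by (simp add: L_def) (simp add: complex_eq_iff Q_def)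
        have small: "\<eta> * \<bar>Re ?q\<bar> + \<eta> * \<bar>Im ?q\<bar> \<le> e' * r\<^sup>2"
        proof -
          have "\<eta> * \<bar>Re ?q\<bar> + \<eta> * \<bar>Im ?q\<bar> \<le> \<eta> * (C * r\<^sup>2) + \<eta> * (C * r\<^sup>2)"
            using \<eta> order_trans[OF abs_Re_le_cmod Qb[OF c]] order_trans[OF abs_Im_le_cmod Qb[OF c]]
            by (intro add_mono mult_left_mono) auto
          also have "\<dots> = e' * r\<^sup>2" using C(1) by (simp add: \<eta>_def)
          finally show ?thesis .
        qed
        have re: "Re (Complex (\<alpha> ?p) (- \<beta> ?p) * ?q) = Re ?q * \<alpha> ?p + Im ?q * \<beta> ?p"
          by (simp add: mult.commute)
        show "T (L c) + Re (Complex (\<alpha> ?p) (- \<beta> ?p) * ?q) - e' * r\<^sup>2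
            \<le> T (z + of_real r * c, g (z + of_real r * c))"
          using 1 2 small unfolding re tip[symmetric] abs_le_iff by linarith
      qed
      moreover have "circ_mean (\<lambda>c. T (L c) + Re (Complex (\<alpha> ?p) (- \<beta> ?p) * Q (of_real r * c)) - e' * r\<^sup>2)
          = circ_mean (\<lambda>c. T (L c)) - e' * r\<^sup>2"
      proof -
        have hQ: "Q holomorphic_on UNIV" unfolding Q_def
          by (intro holomorphic_intros holomorphic_on_compose_gen[OF _ g, of "\<lambda>h. z + h", unfolded o_def]) auto
        have cQ: "continuous_on (sphere 0 1) (\<lambda>c. Re (Complex (\<alpha> ?p) (- \<beta> ?p) * Q (of_real r * c)))"
          by (intro continuous_intros continuous_on_compose2[OF holomorphic_on_imp_continuous_on[OF hQ]]) auto
        have "circ_mean (\<lambda>c. Re (Complex (\<alpha> ?p) (- \<beta> ?p) * Q (0 + of_real r * c))) = Re (Complex (\<alpha> ?p) (- \<beta> ?p) * Q 0)"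
          by (rule circ_mean_holomorphic[OF hQ])
        then have 0: "circ_mean (\<lambda>c. Re (Complex (\<alpha> ?p) (- \<beta> ?p) * Q (of_real r * c))) = 0"
          by (simp add: Q_def del: times_complex.sel)
        have cTL: "continuous_on (sphere 0 1) (\<lambda>c. T (L c))"
          by (rule continuous_on_compose2[OF cT[of UNIV] cL]) auto
        show ?thesis
          by (subst circ_mean_diff[OF continuous_on_add[OF cTL cQ] continuous_on_const],
              subst circ_mean_add[OF cTL cQ], subst 0) simp
      qed
      moreover have "cball z r \<subseteq> cball 0 1"
      proof
        fix x assume "x \<in> cball z r"
        then show "x \<in> cball 0 1"
          using r(2) norm_triangle_ineq[of z "x - z"] by (simp add: dist_norm norm_minus_commute)
      qed
      ultimately show ?thesis using r(1) by (intro exI[of _ r]) auto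
    qed
  qed
  then show "u (z, g z) \<le> B + e" using Tu[OF z] by linarith
qed

section \<open>Plurisubharmonicity of the boundary distance\<close>

lemma norm_scaleC: "norm (c *\<^sub>C z) = cmod c * norm z"
proof -
  have "(\<Sum>j. (cmod (coord (c *\<^sub>C z) j))\<^sup>2) = (\<Sum>j. (cmod c)\<^sup>2 * (cmod (coord z j))\<^sup>2)"
    by (simp add: scaleC.rep_eq norm_mult power_mult_distrib)
  also have "\<dots> = (cmod c)\<^sup>2 * (\<Sum>j. (cmod (coord z j))\<^sup>2)"
    by (rule suminf_mult[OF summable_coord])
  finally show ?thesis by (simp add: norm_ell2_def real_sqrt_mult)
qed

lemma scaleC_of_real: "of_real r *\<^sub>C z = r *\<^sub>R z"
  by (rule ell2_eqI) (simp add: scaleC.rep_eq scaleR_ell2.rep_eq scaleR_conv_of_real)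

interpretation scaleC: bounded_bilinear scaleC
proof
  show "(a + a') *\<^sub>C b = a *\<^sub>C b + a' *\<^sub>C b" for a a' :: complex and b :: ell2
    by (rule cvec.scale_left_distrib)
  show "a *\<^sub>C (b + b') = a *\<^sub>C b + a *\<^sub>C b'" for a :: complex and b b' :: ell2
    by (rule cvec.scale_right_distrib)
  show "(r *\<^sub>R a) *\<^sub>C b = r *\<^sub>R a *\<^sub>C b" for r and a :: complex and b :: ell2
    by (rule ell2_eqI) (simp add: scaleC.rep_eq scaleR_ell2.rep_eq)
  show "a *\<^sub>C (r *\<^sub>R b) = r *\<^sub>R a *\<^sub>C b" for r and a :: complex and b :: ell2
    by (rule ell2_eqI) (simp add: scaleC.rep_eq scaleR_ell2.rep_eq)
  show "\<exists>K. \<forall>a b. norm (a *\<^sub>C b) \<le> norm a * norm b * K"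
    by (rule exI[of _ 1]) (simp add: norm_scaleC)
qed

lemmas continuous_on_scaleC [continuous_intros] = scaleC.continuous_on

text \<open>Separated from continuity because the smoothed functions are continuous on the whole
  space but satisfy the inequality only on part of it.\<close>

definition submean_on :: "ell2 set \<Rightarrow> (ell2 \<Rightarrow> real) \<Rightarrow> bool" where
  "submean_on W f \<longleftrightarrow> (\<forall>a b. (\<forall>c. cmod c \<le> 1 \<longrightarrow> a + c *\<^sub>C b \<in> W) \<longrightarrow>
     f a \<le> circ_mean (\<lambda>c. f (a + c *\<^sub>C b)))"

lemma plurisubharmonic_on_UNIV_iff:
  "plurisubharmonic_on UNIV W f \<longleftrightarrow> open W \<and> continuous_on W f \<and> submean_on W f"
proof -
  have "a \<in> W" if "\<forall>c. cmod c \<le> 1 \<longrightarrow> a + c *\<^sub>C b \<in> W" for a b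
    using that[rule_format, of 0] by simp
  then show ?thesis
    unfolding plurisubharmonic_on_def submean_on_def circ_mean_def by auto
qed

lemma submean_onD:
  "submean_on W f \<Longrightarrow> (\<And>c. cmod c \<le> 1 \<Longrightarrow> a + c *\<^sub>C b \<in> W) \<Longrightarrow> f a \<le> circ_mean (\<lambda>c. f (a + c *\<^sub>C b))"
  unfolding submean_on_def by blast

lemma submean_on_subset: "submean_on W f \<Longrightarrow> W' \<subseteq> W \<Longrightarrow> submean_on W' f"
  unfolding submean_on_def by blast

lemma submean_on_cong:
  assumes "submean_on W f" "\<And>x. x \<in> W \<Longrightarrow> f x = g x"
  shows "submean_on W g"
  unfolding submean_on_def
proof (intro allI impI)
  fix a b assume d: "\<forall>c. cmod c \<le> 1 \<longrightarrow> a + c *\<^sub>C b \<in> W"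
  then have "f a \<le> circ_mean (\<lambda>c. f (a + c *\<^sub>C b))" using submean_onD[OF assms(1)] by blast
  also have "\<dots> = circ_mean (\<lambda>c. g (a + c *\<^sub>C b))"
    using d by (intro circ_mean_cong assms(2)) auto
  also have "f a = g a" using d[rule_format, of 0] assms(2) by simp
  finally show "g a \<le> circ_mean (\<lambda>c. g (a + c *\<^sub>C b))" .
qed

lemma continuous_on_disc:
  assumes "continuous_on W f" "\<And>c. c \<in> S \<Longrightarrow> a + c *\<^sub>C b \<in> W"
  shows "continuous_on S (\<lambda>c. f (a + c *\<^sub>C b))"
  by (rule continuous_on_compose2[OF assms(1)]) (auto intro!: continuous_intros assms(2))

text \<open>Small discs around a point of the given disc lie in one of the neighbourhoods; in one
  complex variable the local inequality implies the global one.\<close>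

lemma submean_on_local:
  assumes f: "continuous_on W f"
    and loc: "\<And>x. x \<in> W \<Longrightarrow> \<exists>N. open N \<and> x \<in> N \<and> submean_on N f"
  shows "submean_on W f"
  unfolding submean_on_def
proof (intro allI impI)
  fix a b assume d: "\<forall>c. cmod c \<le> 1 \<longrightarrow> a + c *\<^sub>C b \<in> W"
  have "f (a + 0 *\<^sub>C b) \<le> circ_mean (\<lambda>c. f (a + c *\<^sub>C b))"
  proof (rule submean_local_to_global)
    show "continuous_on (cball 0 1) (\<lambda>c. f (a + c *\<^sub>C b))"
      by (rule continuous_on_disc[OF f]) (use d in auto)
    fix z :: complex assume z: "z \<in> ball 0 1"
    then obtain N where N: "open N" "a + z *\<^sub>C b \<in> N" "submean_on N f"
      using loc[of "a + z *\<^sub>C b"] d by auto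
    obtain e where e: "0 < e" "ball (a + z *\<^sub>C b) e \<subseteq> N"
      using N(1,2) open_contains_ball by blast
    define r where "r = min (1 - cmod z) (e / (2 * (norm b + 1)))"
    have nb: "0 < norm b + 1" using norm_ge_zero[of b] by linarith
    have r: "0 < r" "r \<le> 1 - cmod z" using z e(1) nb by (auto simp: r_def)
    have "r * norm b \<le> e / (2 * (norm b + 1)) * (norm b + 1)"
      using r(1) e(1) nb by (intro mult_mono) (auto simp: r_def)
    also have "\<dots> = e / 2" using nb by (simp del: distrib_left_numeral)
    finally have re: "r * norm b < e" using e(1) by linarith
    have "f (a + z *\<^sub>C b) \<le> circ_mean (\<lambda>c. f (a + z *\<^sub>C b + c *\<^sub>C (of_real r *\<^sub>C b)))"
    proof (rule submean_onD[OF N(3)])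
      fix c :: complex assume c: "cmod c \<le> 1"
      have "norm (c *\<^sub>C (of_real r *\<^sub>C b)) \<le> 1 * (r * norm b)"
        using c r(1) unfolding norm_scaleC by (intro mult_mono) auto
      then show "a + z *\<^sub>C b + c *\<^sub>C (of_real r *\<^sub>C b) \<in> N"
        using re by (intro subsetD[OF e(2)]) (simp add: dist_norm)
    qed
    also have "(\<lambda>c. f (a + z *\<^sub>C b + c *\<^sub>C (of_real r *\<^sub>C b))) = (\<lambda>c. f (a + (z + of_real r * c) *\<^sub>C b))"
      by (simp add: scaleC.add_left mult.commute add.assoc)
    finally have "f (a + z *\<^sub>C b) \<le> circ_mean (\<lambda>c. f (a + (z + of_real r * c) *\<^sub>C b))" .
    moreover have "cball z r \<subseteq> cball 0 1"
    proof
      fix x assume "x \<in> cball z r"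
      then show "x \<in> cball 0 1"
        using r(2) norm_triangle_ineq[of z "x - z"] by (simp add: dist_norm norm_minus_commute)
    qed
    ultimately show "\<exists>r>0. cball z r \<subseteq> cball 0 1 \<and>
        f (a + z *\<^sub>C b) \<le> circ_mean (\<lambda>c. f (a + (z + of_real r * c) *\<^sub>C b))"
      using r(1) by auto
  qed
  then show "f a \<le> circ_mean (\<lambda>c. f (a + c *\<^sub>C b))" by simp
qed

text \<open>The functional given by \<open>sgn a\<close> supports the norm at \<open>a\<close>.
  Along a complex disc it is a constant plus the real part of a linear function, which has mean
  zero.\<close>

lemma submean_on_norm: "submean_on W norm"
  unfolding submean_on_def
proof (intro allI impI)
  fix a b :: ell2
  show "norm a \<le> circ_mean (\<lambda>c. norm (a + c *\<^sub>C b))"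
  proof (cases "a = 0")
    case True
    have "0 = circ_mean (\<lambda>c. 0)" by simp
    also have "\<dots> \<le> circ_mean (\<lambda>c. norm (a + c *\<^sub>C b))"
      by (rule circ_mean_mono) (auto intro!: continuous_intros)
    finally show ?thesis using True by simp
  next
    case False
    let ?k = "Complex (inner (sgn a) b) (- inner (sgn a) (\<i> *\<^sub>C b))"
    have lin: "inner (sgn a) (a + c *\<^sub>C b) = norm a + Re (?k * c)" for c
    proof -
      have "c = of_real (Re c) + of_real (Im c) * \<i>" by (simp add: complex_eq_iff)
      then have "c *\<^sub>C b = of_real (Re c) *\<^sub>C b + of_real (Im c) *\<^sub>C (\<i> *\<^sub>C b)"
        by (metis cvec.scale_left_distrib cvec.scale_scale)
      then have "c *\<^sub>C b = Re c *\<^sub>R b + Im c *\<^sub>R (\<i> *\<^sub>C b)" unfolding scaleC_of_real .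
      moreover have "inner (sgn a) a = norm a"
        using False by (simp add: sgn_div_norm dot_square_norm power2_eq_square)
      ultimately show ?thesis by (simp add: inner_add_right mult.commute)
    qed
    have "norm a = circ_mean (\<lambda>c. norm a + Re (?k * c))"
      by (subst circ_mean_add) (simp_all add: circ_mean_Re_linear continuous_intros del: times_complex.sel)
    also have "\<dots> \<le> circ_mean (\<lambda>c. norm (a + c *\<^sub>C b))"
    proof (rule circ_mean_mono)
      show "norm a + Re (?k * c) \<le> norm (a + c *\<^sub>C b)" for c
        using Cauchy_Schwarz_ineq2[of "sgn a" "a + c *\<^sub>C b"] False
        unfolding lin by (simp add: norm_sgn)
    qed (auto intro!: continuous_intros simp del: times_complex.sel)
    finally show ?thesis .
  qed
qed

text \<open>The continuity principle. As \<open>t\<close> grows from 0 to 1 the boundary circles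
  sweep out a compact set, and the maximum principle bounds the exhaustion of the slice on each disc
  that lies in \<open>V\<close> by its bound on that set. Such discs therefore stay in a compact
  subset of \<open>V\<close>, at a fixed distance from the complement, and \<open>t\<close> can be
  advanced in equal steps.\<close>

lemma disc_in_pseudoconvex_domain:
  assumes V: "pseudoconvex_domain V" and \<psi>: "\<psi> holomorphic_on UNIV"
    and disc: "\<And>c. cmod c \<le> 1 \<Longrightarrow> a + c *\<^sub>C b \<in> V"
    and bdry: "\<And>c t. cmod c = 1 \<Longrightarrow> t \<in> {0..1} \<Longrightarrow> a + c *\<^sub>C b + (of_real t * \<psi> c) *\<^sub>C v \<in> V"
    and c: "cmod c \<le> 1"
  shows "a + c *\<^sub>C b + \<psi> c *\<^sub>C v \<in> V"
proof -
  define M where "M = cvec.span {a, b, v}"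
  have M: "finite_dim_csubspace M"
    unfolding finite_dim_csubspace_def M_def
    by (intro conjI cvec.subspace_span exI[of _ "{a, b, v}"]) auto
  have inM: "a \<in> M" "b \<in> M" "v \<in> M" unfolding M_def by (auto intro: cvec.span_base)
  define \<Phi> where "\<Phi> x = a + fst x *\<^sub>C b + snd x *\<^sub>C v" for x :: "complex \<times> complex"
  have \<Phi>M: "\<Phi> x \<in> M" for x
    unfolding \<Phi>_def M_def by (intro cvec.span_add cvec.span_scale) (use inM in \<open>auto simp: M_def\<close>)
  have c\<Phi>: "continuous_on S \<Phi>" for S unfolding \<Phi>_def by (intro continuous_intros)
  have "open V" using V by (simp add: pseudoconvex_domain_def)
  have "a \<in> V \<inter> M" using disc[of 0] inM by simp
  moreover have "pseudoconvex_in M (V \<inter> M)" using V M by (simp add: pseudoconvex_domain_def)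
  ultimately obtain \<eta> where \<eta>: "plurisubharmonic_on M (V \<inter> M) \<eta>"
    "\<And>t. relatively_compact_in (V \<inter> M) {x \<in> V \<inter> M. \<eta> x < t}"
    unfolding pseudoconvex_in_def by blast
  have c\<eta>: "continuous_on (V \<inter> M) \<eta>" using \<eta>(1) by (simp add: plurisubharmonic_on_def)
  define U where "U = \<Phi> -` V"
  have U: "open U" unfolding U_def by (rule open_vimage[OF \<open>open V\<close> c\<Phi>])
  have cu: "continuous_on U (\<lambda>x. \<eta> (\<Phi> x))"
    by (rule continuous_on_compose2[OF c\<eta> c\<Phi>]) (use \<Phi>M in \<open>auto simp: U_def\<close>)
  have sub: "\<eta> (\<Phi> (z, w)) \<le> circ_mean (\<lambda>c. \<eta> (\<Phi> (z + c * p, w + c * q)))"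
    if affine: "\<And>c. cmod c \<le> 1 \<Longrightarrow> (z + c * p, w + c * q) \<in> U" for z w p q
  proof -
    let ?d = "p *\<^sub>C b + q *\<^sub>C v"
    have eq: "\<Phi> (z + c * p, w + c * q) = \<Phi> (z, w) + c *\<^sub>C ?d" for c
      by (simp add: \<Phi>_def scaleC.add_left scaleC.add_right algebra_simps)
    have d: "?d \<in> M" unfolding M_def
      by (intro cvec.span_add cvec.span_scale) (use inM in \<open>auto simp: M_def\<close>)
    have in_V: "\<Phi> (z, w) + c *\<^sub>C ?d \<in> V \<inter> M" if "cmod c \<le> 1" for c
      using affine[OF that] \<Phi>M[of "(z + c * p, w + c * q)"] by (simp add: U_def eq)
    have "\<Phi> (z, w) \<in> V \<inter> M" using in_V[of 0] by simp
    then show ?thesis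
      using \<eta>(1) d in_V unfolding plurisubharmonic_on_def circ_mean_def eq by blast
  qed
  define K where "K = (\<lambda>x. \<Phi> (fst x, of_real (snd x) * \<psi> (fst x))) ` (sphere 0 1 \<times> {0..1})"
  have c\<psi>: "continuous_on S \<psi>" for S
    using holomorphic_on_imp_continuous_on[OF \<psi>] continuous_on_subset by blast
  have K: "compact K" unfolding K_def
    by (intro compact_continuous_image compact_Times compact_sphere compact_Icc
        continuous_on_compose2[OF c\<Phi>[of UNIV]] continuous_intros continuous_on_compose2[OF c\<psi>[of UNIV]]) auto
  have KV: "K \<subseteq> V \<inter> M"
    using bdry \<Phi>M by (auto simp: K_def \<Phi>_def)
  obtain C where C: "\<And>x. x \<in> K \<Longrightarrow> \<bar>\<eta> x\<bar> \<le> C"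
    using compact_imp_bounded[OF compact_continuous_image[OF continuous_on_subset[OF c\<eta> KV] K]]
    by (auto simp: bounded_iff)
  \<comment> \<open>The exhaustion has relatively compact strict sublevel sets, so a level above
    \<open>C\<close> is taken.\<close>
  define S where "S = closure {x \<in> V \<inter> M. \<eta> x < C + 1}"
  have S: "compact S" "S \<subseteq> V" using \<eta>(2)[of "C + 1"] by (auto simp: relatively_compact_in_def S_def)
  obtain e where e: "0 < e" "(\<Union>x\<in>S. ball x e) \<subseteq> V"
    using compact_subset_open_imp_ball_epsilon_subset[OF S(1) \<open>open V\<close> S(2)] by blast
  have "continuous_on (cball 0 1) (\<lambda>c. \<psi> c *\<^sub>C v)" by (intro continuous_intros c\<psi>)
  from compact_imp_bounded[OF compact_continuous_image[OF this compact_cball]]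
  obtain B where B: "\<And>c. c \<in> cball 0 1 \<Longrightarrow> norm (\<psi> c *\<^sub>C v) \<le> B"
    unfolding bounded_iff by blast
  \<comment> \<open>With \<open>N\<close> steps every point of the disc moves by at most
    \<open>B / N\<close> < \<open>e\<close> in each step.\<close>
  obtain N :: nat where N: "B / e < N" using reals_Archimedean2 by blast
  have "0 \<le> B" using B[of 0] norm_ge_zero[of "\<psi> 0 *\<^sub>C v"] by (simp del: norm_ge_zero)
  then have "0 \<le> B / e" using e(1) by simp
  then have N0: "0 < N" using N by simp
  have BN: "B / N < e" using N N0 e(1) by (simp add: field_simps)
  have "k \<le> N \<Longrightarrow> c \<in> cball 0 1 \<Longrightarrow> \<Phi> (c, of_real (k / N) * \<psi> c) \<in> V" for k c
  proof (induction k arbitrary: c)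
    case 0
    then show ?case using disc[of c] by (simp add: \<Phi>_def)
  next
    case (Suc k)
    let ?g = "\<lambda>c. of_real (real k / real N) * \<psi> c"
    have "\<eta> (\<Phi> (c, ?g c)) \<le> C"
    proof (rule max_principle_graph[OF U cu sub, where g = ?g])
      show "?g holomorphic_on UNIV" by (intro holomorphic_intros \<psi>)
      show "(z, ?g z) \<in> U" if "z \<in> cball 0 1" for z
        using Suc.IH[OF _ that] Suc.prems by (simp add: U_def)
      show "\<eta> (\<Phi> (z, ?g z)) \<le> C" if "z \<in> sphere 0 1" for z
      proof -
        have "\<Phi> (z, ?g z) \<in> K"
          unfolding K_def by (rule image_eqI[of _ _ "(z, real k / real N)"]) (use that Suc.prems in auto)
        then show ?thesis using C by fastforce
      qed
    qed (use Suc.prems in auto)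
    then have "\<Phi> (c, ?g c) \<in> S"
      using Suc.IH[of c] Suc.prems \<Phi>M unfolding S_def
      by (intro subsetD[OF closure_subset]) auto
    moreover have "\<Phi> (c, of_real (Suc k / N) * \<psi> c) \<in> ball (\<Phi> (c, ?g c)) e"
    proof -
      have "of_real (Suc k / N) * \<psi> c = ?g c + of_real (1 / N) * \<psi> c"
        by (simp add: add_divide_distrib distrib_right)
      then have "\<Phi> (c, of_real (Suc k / N) * \<psi> c) = \<Phi> (c, ?g c) + (1 / N) *\<^sub>R \<psi> c *\<^sub>C v"
        unfolding \<Phi>_def fst_conv snd_conv by (metis add.assoc scaleC.add_left scaleC_of_real cvec.scale_scale)
      moreover have "norm ((1 / N) *\<^sub>R \<psi> c *\<^sub>C v) \<le> B / N"
        using B[OF Suc.prems(2)] N0 by (simp add: divide_right_mono)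
      ultimately show ?thesis using BN by (simp add: dist_norm)
    qed
    ultimately show ?case using e(2) by blast
  qed
  from this[of N c] show ?thesis using c N0 by (simp add: \<Phi>_def)
qed

text \<open>The boundary distance truncated at 1, so that it also makes sense for \<open>V = UNIV\<close> and its
  negative logarithm is nonnegative.\<close>

definition inner_radius :: "ell2 set \<Rightarrow> ell2 \<Rightarrow> real" where
  "inner_radius V z = (if V = UNIV then 1 else min 1 (infdist z (- V)))"

lemma inner_radius_le_1: "inner_radius V z \<le> 1"
  by (simp add: inner_radius_def)

lemma inner_radius_lipschitz: "\<bar>inner_radius V x - inner_radius V y\<bar> \<le> norm (x - y)"
  using infdist_triangle_abs[of x "- V" y] by (auto simp: inner_radius_def dist_norm min_def)

lemma inner_radius_continuous: "continuous_on S (inner_radius V)"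
  by (rule lipschitz_on_continuous_on[of 1])
    (rule lipschitz_onI, use inner_radius_lipschitz in \<open>auto simp: dist_norm\<close>)

lemma ball_inner_radius: "norm (y - x) < inner_radius V x \<Longrightarrow> y \<in> V"
  using infdist_le[of y "- V" x] by (fastforce simp: inner_radius_def dist_norm norm_minus_commute split: if_splits)

lemma inner_radius_pos:
  assumes "open V" "x \<in> V"
  shows "0 < inner_radius V x"
proof (cases "V = UNIV")
  case False
  then have "- V \<noteq> {}" by auto
  then show ?thesis
    using assms False infdist_pos_not_in_closed[of "- V" x] by (auto simp: inner_radius_def)
qed (simp add: inner_radius_def)

lemma inner_radius_geI:
  assumes "r \<le> 1" "\<And>y. norm (y - x) < r \<Longrightarrow> y \<in> V"
  shows "r \<le> inner_radius V x"
proof (cases "V = UNIV")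
  case False
  then have "- V \<noteq> {}" by auto
  moreover have "r \<le> dist x y" if "y \<in> - V" for y
    using assms(2)[of y] that by (force simp: dist_norm norm_minus_commute)
  ultimately have "r \<le> infdist x (- V)" unfolding infdist_notempty[OF \<open>- V \<noteq> {}\<close>]
    by (intro cINF_greatest) auto
  then show ?thesis using assms False by (simp add: inner_radius_def)
qed (use assms in \<open>simp add: inner_radius_def\<close>)

text \<open>Let \<open>Re P\<close> lie just above the negative logarithm of the radius on the
  circle. For \<open>norm v\<close> < 1 the vectors \<open>exp (- P c) *\<^sub>C v\<close> are then
  shorter than the radius at the boundary points, so the continuity principle puts the centre
  \<open>a + exp (- P 0) *\<^sub>C v\<close> into \<open>V\<close>. Hence the radius at
  \<open>a\<close> is at least \<open>exp (- Re (P 0))\<close>, and \<open>Re (P 0)\<close> is the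
  circular mean of \<open>Re P\<close>.\<close>

lemma submean_on_neg_log_inner_radius:
  assumes V: "pseudoconvex_domain V"
  shows "submean_on V (\<lambda>z. - ln (inner_radius V z))"
  unfolding submean_on_def
proof (intro allI impI)
  fix a b assume d: "\<forall>c. cmod c \<le> 1 \<longrightarrow> a + c *\<^sub>C b \<in> V"
  have oV: "open V" using V by (simp add: pseudoconvex_domain_def)
  let ?m = "\<lambda>c. inner_radius V (a + c *\<^sub>C b)"
  have m: "0 < ?m c" if "cmod c \<le> 1" for c using inner_radius_pos[OF oV] d that by blast
  have cm: "continuous_on (sphere 0 1) (\<lambda>c. - ln (?m c))"
    by (intro continuous_intros continuous_on_disc[OF inner_radius_continuous[of UNIV]]) (use m in \<open>auto simp: less_imp_neq[symmetric]\<close>)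
  show "- ln (inner_radius V a) \<le> circ_mean (\<lambda>c. - ln (?m c))"
  proof (rule field_le_epsilon)
    fix e :: real assume e: "0 < e"
    \<comment> \<open>Approximating a target raised by \<open>e / 2\<close> to within
      \<open>e / 2\<close> makes the approximation one-sided.\<close>
    obtain P where P: "P holomorphic_on UNIV" "\<And>c. c \<in> sphere 0 1 \<Longrightarrow> \<bar>(- ln (?m c) + e / 2) - Re (P c)\<bar> < e / 2"
      using circle_approx_holomorphic[OF continuous_on_add[OF cm continuous_on_const], of "e / 2" "e / 2"] e
      by (metis half_gt_zero)
    have P1: "- ln (?m c) < Re (P c)" "Re (P c) < - ln (?m c) + e" if "cmod c = 1" for c
    proof -
      have "\<bar>(- ln (?m c) + e / 2) - Re (P c)\<bar> < e / 2" by (rule P(2)) (use that in simp)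
      then show "- ln (?m c) < Re (P c)" "Re (P c) < - ln (?m c) + e" by linarith+
    qed
    have cP: "continuous_on S (\<lambda>c. Re (P c))" for S
      using holomorphic_on_imp_continuous_on[OF P(1)] continuous_on_subset
      by (intro continuous_on_Re) blast
    have P0: "circ_mean (\<lambda>c. Re (P c)) = Re (P 0)"
      using circ_mean_holomorphic[OF P(1), of 1 0 1] by simp
    \<comment> \<open>Since the radius is truncated at 1, the ball to be found in \<open>V\<close>
      must have radius at most 1, that is, \<open>Re (P 0)\<close> \<ge> 0.\<close>
    have "circ_mean (\<lambda>_. 0) \<le> circ_mean (\<lambda>c. Re (P c))"
    proof (intro circ_mean_mono cP continuous_on_const)
      fix c :: complex assume "c \<in> sphere 0 1"
      then have c: "cmod c = 1" by simp
      have "ln (?m c) \<le> 0" using m[of c] inner_radius_le_1 c by simp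
      then show "0 \<le> Re (P c)" using P1(1)[OF c] by linarith
    qed
    then have "exp (- Re (P 0)) \<le> 1" unfolding P0 by simp
    moreover have "y \<in> V" if y: "norm (y - a) < exp (- Re (P 0))" for y
    proof -
      define v where "v = exp (P 0) *\<^sub>C (y - a)"
      have "norm v = exp (Re (P 0)) * norm (y - a)" by (simp add: v_def norm_scaleC)
      also have "\<dots> < exp (Re (P 0)) * exp (- Re (P 0))" using y by simp
      finally have v: "norm v < 1" by (simp add: exp_minus)
      have "a + 0 *\<^sub>C b + exp (- P 0) *\<^sub>C v \<in> V"
      proof (rule disc_in_pseudoconvex_domain[OF V, where \<psi> = "\<lambda>c. exp (- P c)"])
        show "(\<lambda>c. exp (- P c)) holomorphic_on UNIV" by (intro holomorphic_intros P(1))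
        show "a + c *\<^sub>C b \<in> V" if "cmod c \<le> 1" for c using d that by blast
        show "a + c *\<^sub>C b + (of_real t * exp (- P c)) *\<^sub>C v \<in> V" if c: "cmod c = 1" and t: "t \<in> {0..1}" for c t
        proof (rule ball_inner_radius)
          have "norm ((of_real t * exp (- P c)) *\<^sub>C v) \<le> 1 * exp (- Re (P c)) * 1"
            unfolding norm_scaleC norm_mult using t v by (intro mult_mono) auto
          also have "exp (- Re (P c)) < exp (ln (?m c))" using P1(1)[OF c] by simp
          also have "\<dots> = ?m c" using m[of c] c by simp
          finally show "norm (a + c *\<^sub>C b + (of_real t * exp (- P c)) *\<^sub>C v - (a + c *\<^sub>C b)) < ?m c" by simp
        qed
      qed simp
      moreover have "exp (- P 0) *\<^sub>C v = y - a" by (simp add: v_def exp_minus)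
      ultimately show ?thesis by simp
    qed
    ultimately have "exp (- Re (P 0)) \<le> inner_radius V a" by (rule inner_radius_geI)
    then have "- ln (inner_radius V a) \<le> Re (P 0)"
      using m[of 0] ln_ge_iff[of "inner_radius V a" "- Re (P 0)"] by simp
    also have "\<dots> \<le> circ_mean (\<lambda>c. - ln (?m c) + e)"
      unfolding P0[symmetric] by (intro circ_mean_mono cP continuous_on_add cm continuous_on_const) (use P1(2) in \<open>auto intro: less_imp_le\<close>)
    also have "\<dots> = circ_mean (\<lambda>c. - ln (?m c)) + e"
      by (subst circ_mean_add[OF cm continuous_on_const]) simp
    finally show "- ln (inner_radius V a) \<le> circ_mean (\<lambda>c. - ln (?m c)) + e" .
  qed
qed

section \<open>Smoothing on the Hilbert space\<close>

definition coord_dirs :: "ell2 set" where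
  "coord_dirs = range x_dir \<union> range y_dir"

lemma norm_unit_vec [simp]: "norm (unit_vec j) = 1"
proof -
  have "(\<lambda>k. (cmod (coord (unit_vec j) k))\<^sup>2) = (\<lambda>k. if k = j then 1 else 0)"
    by (auto simp: unit_vec.rep_eq)
  moreover have "(\<lambda>k. if k = j then 1 else 0 :: real) sums 1" by (rule sums_single)
  ultimately show ?thesis by (simp add: norm_ell2_def sums_iff)
qed

definition dir_seq :: "nat \<Rightarrow> ell2" where
  "dir_seq n = (if even n then x_dir (n div 2) else y_dir (n div 2))"

lemma norm_dir_seq: "norm (dir_seq n) = 1"
  by (simp add: dir_seq_def norm_scaleC)

lemma coord_dirs_dir_seq: "v \<in> coord_dirs \<Longrightarrow> \<exists>n. v = dir_seq n"
proof -
  have "x_dir j = dir_seq (2 * j)" "y_dir j = dir_seq (Suc (2 * j))" for j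
    by (simp_all add: dir_seq_def)
  then show "v \<in> coord_dirs \<Longrightarrow> \<exists>n. v = dir_seq n" by (auto simp: coord_dirs_def)
qed

text \<open>Erosion of \<open>W\<close> by a closed ball: averages of total length \<open>r\<close>
  read only translates by vectors of norm at most \<open>r\<close>.\<close>

definition shrink :: "real \<Rightarrow> ell2 set \<Rightarrow> ell2 set" where
  "shrink r W = {x. \<forall>y. norm y \<le> r \<longrightarrow> x + y \<in> W}"

lemma shrink_add: "shrink (r + s) W \<subseteq> shrink r (shrink s W)"
  unfolding shrink_def by (auto simp: add.assoc) (meson add_mono norm_triangle_le)

lemma shrink_antimono: "r \<le> s \<Longrightarrow> shrink s W \<subseteq> shrink r W"
  unfolding shrink_def by auto

lemma submean_on_box_avg:
  assumes h: "submean_on W h" "continuous_on UNIV h"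
  shows "submean_on (shrink (norm v) W) (box_avg v h)"
  unfolding submean_on_def
proof (intro allI impI)
  fix a b assume d: "\<forall>c. cmod c \<le> 1 \<longrightarrow> a + c *\<^sub>C b \<in> shrink (norm v) W"
  show "box_avg v h a \<le> circ_mean (\<lambda>c. box_avg v h (a + c *\<^sub>C b))"
  proof (rule box_avg_submean[OF h(2)])
    show "continuous_on (sphere 0 1) (\<lambda>c. a + c *\<^sub>C b)" by (intro continuous_intros)
    fix s :: real assume s: "s \<in> {0..1}"
    have "h (a + s *\<^sub>R v) \<le> circ_mean (\<lambda>c. h (a + s *\<^sub>R v + c *\<^sub>C b))"
    proof (rule submean_onD[OF h(1)])
      fix c :: complex assume "cmod c \<le> 1"
      moreover have "norm (s *\<^sub>R v) \<le> norm v" using s by (simp add: mult_left_le_one_le)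
      ultimately have "a + c *\<^sub>C b + s *\<^sub>R v \<in> W" using d by (simp add: shrink_def)
      then show "a + s *\<^sub>R v + c *\<^sub>C b \<in> W" by (simp add: algebra_simps)
    qed
    then show "h (a + s *\<^sub>R v) \<le> circ_mean (\<lambda>c. h (a + c *\<^sub>C b + s *\<^sub>R v))"
      by (simp add: algebra_simps)
  qed
qed

lemma submean_on_box_chain:
  assumes F: "L-lipschitz_on UNIV F" "submean_on W F"
  shows "submean_on (shrink (\<Sum>i<n. norm (w i)) W) (box_chain n w F)"
proof (induction n arbitrary: w)
  case 0
  have "shrink 0 W = W" by (simp add: shrink_def)
  then show ?case using F(2) by simp
next
  case (Suc n)
  have "shrink (\<Sum>i<Suc n. norm (w i)) W
      \<subseteq> shrink (norm (w 0)) (shrink (\<Sum>i<n. norm (w (Suc i))) W)"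
    unfolding sum.lessThan_Suc_shift by (rule shrink_add)
  then show ?case
    unfolding box_chain.simps
    by (rule submean_on_subset[OF submean_on_box_avg[OF Suc.IH continuous_box_chain[OF F(1)]]])
qed

text \<open>The finite chains satisfy the inequality on this set, and replacing the chain by its
  limit inside the mean costs a uniform error that tends to 0.\<close>

lemma submean_on_smoothing:
  assumes F: "L-lipschitz_on UNIV F" "submean_on W F" and w: "summable (\<lambda>i. norm (w i))"
  shows "submean_on (shrink (\<Sum>i. norm (w i)) W) (smoothing w F)"
  unfolding submean_on_def
proof (intro allI impI)
  fix a b assume d: "\<forall>c. cmod c \<le> 1 \<longrightarrow> a + c *\<^sub>C b \<in> shrink (\<Sum>i. norm (w i)) W"
  let ?g = "smoothing w F" and ?t = "\<lambda>n. L * (\<Sum>i. norm (w (i + n)))"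
  have cg: "continuous_on (sphere 0 1) (\<lambda>c. ?g (a + c *\<^sub>C b))"
    by (rule continuous_on_disc[OF lipschitz_on_continuous_on[OF lipschitz_smoothing[OF F(1) w]]]) simp
  have "box_chain n w F a \<le> circ_mean (\<lambda>c. ?g (a + c *\<^sub>C b)) + ?t n" for n
  proof -
    have "submean_on (shrink (\<Sum>i. norm (w i)) W) (box_chain n w F)"
      by (rule submean_on_subset[OF submean_on_box_chain[OF F]])
        (intro shrink_antimono sum_le_suminf w, auto)
    then have "box_chain n w F a \<le> circ_mean (\<lambda>c. box_chain n w F (a + c *\<^sub>C b))"
      using d by (blast intro: submean_onD)
    also have "\<dots> \<le> circ_mean (\<lambda>c. ?g (a + c *\<^sub>C b) + ?t n)"
    proof (intro circ_mean_mono continuous_on_add cg continuous_on_const)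
      show "continuous_on (sphere 0 1) (\<lambda>c. box_chain n w F (a + c *\<^sub>C b))"
        by (rule continuous_on_disc[OF continuous_box_chain[OF F(1), of UNIV]]) simp
      show "box_chain n w F (a + c *\<^sub>C b) \<le> ?g (a + c *\<^sub>C b) + ?t n" for c
        using smoothing_approx(1)[OF F(1) w, of "a + c *\<^sub>C b" n] by linarith
    qed
    also have "\<dots> = circ_mean (\<lambda>c. ?g (a + c *\<^sub>C b)) + ?t n"
      by (subst circ_mean_add[OF cg continuous_on_const]) simp
    finally show ?thesis .
  qed
  moreover have "(\<lambda>n. circ_mean (\<lambda>c. ?g (a + c *\<^sub>C b)) + ?t n) \<longlonglongrightarrow> circ_mean (\<lambda>c. ?g (a + c *\<^sub>C b)) + 0"
    by (intro tendsto_intros tail_norm_null[OF w])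
  ultimately show "?g a \<le> circ_mean (\<lambda>c. ?g (a + c *\<^sub>C b))"
    using LIMSEQ_le[OF smoothing_approx(2)[OF F(1) w]] by auto
qed

lemma smoothing_ell2:
  fixes F :: "ell2 \<Rightarrow> real"
  assumes F: "L-lipschitz_on UNIV F" and e: "0 < e"
  obtains g where "\<And>n. smooth_along coord_dirs n g" "\<And>x. \<bar>g x - F x\<bar> \<le> L * e"
    "\<And>W. submean_on W F \<Longrightarrow> submean_on (shrink e W) g"
proof -
  \<comment> \<open>\<open>fst (prod_decode i)\<close> takes every value infinitely often, so each
    direction recurs; the lengths add up to \<open>e\<close>.\<close>
  define w where "w i = (e * (1/2) ^ Suc i) *\<^sub>R dir_seq (fst (prod_decode i))" for i
  have nw: "norm (w i) = e * (1/2) ^ Suc i" for i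
    using e by (simp add: w_def norm_dir_seq)
  have "(\<lambda>i. norm (w i)) sums (e * 1)"
    unfolding nw by (intro sums_mult power_half_series)
  then have w: "summable (\<lambda>i. norm (w i))" "(\<Sum>i. norm (w i)) = e"
    by (simp_all add: sums_iff)
  show thesis
  proof
    show "smooth_along coord_dirs n (smoothing w F)" for n
    proof (rule smooth_along_smoothing[OF F w(1)])
      fix v assume "v \<in> coord_dirs"
      then obtain m where v: "v = dir_seq m" using coord_dirs_dir_seq by blast
      show "recurs v w"
        unfolding recurs_def
      proof
        fix N
        have "N \<le> prod_encode (m, N)" by (rule le_prod_encode_2)
        moreover have "w (prod_encode (m, N)) = (e * (1/2) ^ Suc (prod_encode (m, N))) *\<^sub>R v"
          by (simp add: w_def v)
        ultimately show "\<exists>i\<ge>N. \<exists>e>0. w i = e *\<^sub>R v"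
          using e by (meson mult_pos_pos zero_less_power half_gt_zero zero_less_one)
      qed
    qed
    show "\<bar>smoothing w F x - F x\<bar> \<le> L * e" for x
      using smoothing_approx(1)[OF F w(1), of x 0] w(2) by simp
    show "submean_on (shrink e W) (smoothing w F)" if "submean_on W F" for W
      using submean_on_smoothing[OF F that w(1)] w(2) by simp
  qed
qed

section \<open>Gluing\<close>

lemma submean_on_affine:
  assumes "submean_on W g" "0 \<le> A" "continuous_on UNIV g"
  shows "submean_on W (\<lambda>z. A * g z + B)"
  unfolding submean_on_def
proof (intro allI impI)
  fix a b assume d: "\<forall>c. cmod c \<le> 1 \<longrightarrow> a + c *\<^sub>C b \<in> W"
  have cg: "continuous_on (sphere 0 1) (\<lambda>c. g (a + c *\<^sub>C b))"
    by (rule continuous_on_disc[OF assms(3)]) simp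
  have "A * g a + B \<le> A * circ_mean (\<lambda>c. g (a + c *\<^sub>C b)) + B"
    using submean_onD[OF assms(1)] d assms(2) by (simp add: mult_left_mono)
  also have "\<dots> = circ_mean (\<lambda>c. A * g (a + c *\<^sub>C b) + B)"
    by (subst circ_mean_add) (auto simp: circ_mean_cmult intro!: continuous_intros cg)
  finally show "A * g a + B \<le> circ_mean (\<lambda>c. A * g (a + c *\<^sub>C b) + B)" .
qed

text \<open>\<open>(s, t) \<mapsto> s + \<rho> (t - s)\<close> is convex and nondecreasing in both arguments, so its supporting plane
  has nonnegative coefficients.\<close>

lemma submean_on_ramp:
  assumes h: "submean_on W h" "continuous_on UNIV h" and g: "submean_on W g" "continuous_on UNIV g"
    and \<rho>: "continuous_on UNIV \<rho>"
      "\<And>s. \<exists>\<beta>. 0 \<le> \<beta> \<and> \<beta> \<le> 1 \<and> (\<forall>t. \<rho> s + \<beta> * (t - s) \<le> \<rho> t)"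
  shows "submean_on W (\<lambda>z. h z + \<rho> (g z - h z))"
  unfolding submean_on_def
proof (intro allI impI)
  fix a b assume d: "\<forall>c. cmod c \<le> 1 \<longrightarrow> a + c *\<^sub>C b \<in> W"
  let ?h = "\<lambda>c. h (a + c *\<^sub>C b)" and ?g = "\<lambda>c. g (a + c *\<^sub>C b)"
  have ch: "continuous_on (sphere 0 1) ?h" by (rule continuous_on_disc[OF h(2)]) simp
  have cg: "continuous_on (sphere 0 1) ?g" by (rule continuous_on_disc[OF g(2)]) simp
  define s where "s = g a - h a"
  obtain \<beta> where \<beta>: "0 \<le> \<beta>" "\<beta> \<le> 1" "\<And>t. \<rho> s + \<beta> * (t - s) \<le> \<rho> t" using \<rho>(2)[of s] by blast
  have "h a + \<rho> s = (1 - \<beta>) * h a + \<beta> * g a + (\<rho> s - \<beta> * s)" by (simp add: s_def algebra_simps)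
  also have "\<dots> \<le> (1 - \<beta>) * circ_mean ?h + \<beta> * circ_mean ?g + (\<rho> s - \<beta> * s)"
    using \<beta> d submean_onD[OF h(1)] submean_onD[OF g(1)]
    by (intro add_right_mono add_mono mult_left_mono) auto
  also have "\<dots> = circ_mean (\<lambda>c. (1 - \<beta>) * ?h c + \<beta> * ?g c + (\<rho> s - \<beta> * s))"
    by (subst circ_mean_add, (intro continuous_intros ch cg)+, subst circ_mean_add,
        (intro continuous_intros ch cg)+) (simp add: circ_mean_cmult)
  also have "\<dots> \<le> circ_mean (\<lambda>c. ?h c + \<rho> (?g c - ?h c))"
  proof (rule circ_mean_mono)
    show "continuous_on (sphere 0 1) (\<lambda>c. ?h c + \<rho> (?g c - ?h c))"
      by (intro continuous_intros ch cg continuous_on_compose2[OF \<rho>(1)]) auto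
    show "(1 - \<beta>) * ?h c + \<beta> * ?g c + (\<rho> s - \<beta> * s) \<le> ?h c + \<rho> (?g c - ?h c)" for c
      using \<beta>(3)[of "?g c - ?h c"] by (simp add: algebra_simps)
  qed (intro continuous_intros ch cg)
  finally show "h a + \<rho> (g a - h a) \<le> circ_mean (\<lambda>c. ?h c + \<rho> (?g c - ?h c))"
    by (simp add: s_def)
qed

lemma ln_lipschitz:
  assumes "0 < c" "c \<le> x" "c \<le> (y::real)"
  shows "\<bar>ln x - ln y\<bar> \<le> \<bar>x - y\<bar> / c"
proof -
  have *: "ln x - ln y \<le> \<bar>x - y\<bar> / c" if "c \<le> x" "c \<le> y" for x y :: real
  proof -
    have "ln x - ln y = ln (x / y)" using that assms(1) by (simp add: ln_div)
    also have "\<dots> \<le> x / y - 1" using that assms(1) by (intro ln_le_minus_one) auto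
    also have "\<dots> = (x - y) / y" using that assms(1) by (simp add: field_simps)
    also have "\<dots> \<le> \<bar>x - y\<bar> / y" using that assms(1) by (intro divide_right_mono) auto
    also have "\<dots> \<le> \<bar>x - y\<bar> / c" using that assms(1) by (intro divide_left_mono) auto
    finally show ?thesis .
  qed
  show ?thesis using *[of x y] *[of y x] assms by (simp add: abs_le_iff abs_minus_commute)
qed

text \<open>One summand for each half of uniform inclusion: the norm controls boundedness, the
  logarithm the distance to the boundary.\<close>

definition log_exhaustion :: "ell2 set \<Rightarrow> ell2 \<Rightarrow> real" where
  "log_exhaustion V z = norm z - ln (inner_radius V z)"

text \<open>The strict inequality makes these sets open for open \<open>V\<close>, and empty at
  level 0, where the gluing starts.\<close>

definition sublevel :: "ell2 set \<Rightarrow> real \<Rightarrow> ell2 set" where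
  "sublevel V t = {z \<in> V. log_exhaustion V z < t}"

context
  fixes V :: "ell2 set"
  assumes V: "open V"
begin

lemma log_exhaustion_bounds:
  assumes "z \<in> V"
  shows "0 \<le> log_exhaustion V z" "norm z \<le> log_exhaustion V z"
    "exp (- log_exhaustion V z) \<le> inner_radius V z"
proof -
  have "ln (inner_radius V z) \<le> 0"
    using inner_radius_pos[OF V assms] inner_radius_le_1 by simp
  then show "0 \<le> log_exhaustion V z" "norm z \<le> log_exhaustion V z"
    unfolding log_exhaustion_def using norm_ge_zero[of z] by linarith+
  have "- log_exhaustion V z \<le> ln (inner_radius V z)" by (simp add: log_exhaustion_def)
  then show "exp (- log_exhaustion V z) \<le> inner_radius V z"
    using ln_ge_iff[OF inner_radius_pos[OF V assms]] by blast
qed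

lemma log_exhaustion_continuous: "continuous_on V (log_exhaustion V)"
  unfolding log_exhaustion_def[abs_def]
  by (intro continuous_intros inner_radius_continuous) (use inner_radius_pos[OF V] in force)

lemma open_sublevel: "open (sublevel V t)" "open {z \<in> V. s < log_exhaustion V z}"
proof -
  have "open (log_exhaustion V -` {..<t} \<inter> V)" "open (log_exhaustion V -` {s<..} \<inter> V)"
    by (rule continuous_on_open_vimage[OF V, THEN iffD1, OF log_exhaustion_continuous, rule_format], simp)+
  moreover have "sublevel V t = log_exhaustion V -` {..<t} \<inter> V"
    "{z \<in> V. s < log_exhaustion V z} = log_exhaustion V -` {s<..} \<inter> V"
    by (auto simp: sublevel_def)
  ultimately show "open (sublevel V t)" "open {z \<in> V. s < log_exhaustion V z}"
    by (simp_all only:)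
qed

text \<open>The logarithm is Lipschitz only where the radius is bounded below, so the radius is cut
  off at \<open>c\<close>. On the sublevel set the radius exceeds \<open>exp (- t)\<close> >
  \<open>c\<close>, which leaves room for averaging without meeting the cutoff.\<close>

lemma smooth_approx_log_exhaustion:
  assumes f: "submean_on V (log_exhaustion V)"
  obtains g where "\<And>n. smooth_along coord_dirs n g" "submean_on (sublevel V t) g"
    "\<And>z. z \<in> sublevel V t \<Longrightarrow> \<bar>g z - log_exhaustion V z\<bar> \<le> 1 / 8"
proof -
  define c where "c = exp (- (t + 1))"
  define F where "F z = norm z - ln (max (inner_radius V z) c)" for z
  define L where "L = 1 + 1 / c"
  have c: "0 < c" by (simp add: c_def)
  then have L: "0 < L" by (simp add: L_def add_pos_pos)
  have F: "L-lipschitz_on UNIV F"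
  proof (rule lipschitz_onI)
    fix x y
    have "\<bar>ln (max (inner_radius V x) c) - ln (max (inner_radius V y) c)\<bar>
        \<le> \<bar>max (inner_radius V x) c - max (inner_radius V y) c\<bar> / c"
      using c by (intro ln_lipschitz) auto
    also have "\<dots> \<le> norm (x - y) / c"
      using c inner_radius_lipschitz[of V x y] by (intro divide_right_mono) auto
    finally have "\<bar>F x - F y\<bar> \<le> norm (x - y) + norm (x - y) / c"
      using norm_triangle_ineq3[of x y] unfolding F_def by linarith
    then show "dist (F x) (F y) \<le> L * dist x y"
      by (simp add: L_def dist_norm distrib_right)
  qed (use L in simp)
  have Ff: "F z = log_exhaustion V z" if "c \<le> inner_radius V z" for z
    using that by (simp add: F_def log_exhaustion_def max_def)
  let ?W = "{z. c < inner_radius V z}"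
  have W: "?W \<subseteq> V"
    using ball_inner_radius[of x x V for x] c by (auto dest: less_trans)
  have sF: "submean_on ?W F"
    by (rule submean_on_cong[OF submean_on_subset[OF f W]]) (simp add: Ff)
  have ec: "c < exp (- t)" by (simp add: c_def)
  \<comment> \<open>The first bound keeps the error at 1/8. By the second, moving by
    \<open>e\<close> cannot bring the 1-Lipschitz radius from above \<open>exp (- t)\<close> down to
    \<open>c\<close>.\<close>
  define e where "e = min (1 / (8 * L)) (exp (- t) - c)"
  have e: "0 < e" using L ec by (simp add: e_def)
  have "L * e \<le> L * (1 / (8 * L))" using L by (intro mult_left_mono) (auto simp: e_def)
  then have Le: "L * e \<le> 1 / 8" using L by simp
  have deep: "exp (- t) < inner_radius V z" if "z \<in> sublevel V t" for z
  proof -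
    have "exp (- t) < exp (- log_exhaustion V z)" using that by (simp add: sublevel_def)
    also have "\<dots> \<le> inner_radius V z" using that log_exhaustion_bounds(3) by (simp add: sublevel_def)
    finally show ?thesis .
  qed
  obtain g where g: "\<And>n. smooth_along coord_dirs n g" "\<And>x. \<bar>g x - F x\<bar> \<le> L * e"
    "\<And>W. submean_on W F \<Longrightarrow> submean_on (shrink e W) g"
    using smoothing_ell2[OF F e] by metis
  show thesis
  proof
    show "smooth_along coord_dirs n g" for n by (rule g(1))
    have "sublevel V t \<subseteq> shrink e ?W"
    proof
      fix z assume z: "z \<in> sublevel V t"
      have "c < inner_radius V (z + y)" if "norm y \<le> e" for y
      proof -
        have "norm y \<le> exp (- t) - c" using that by (simp add: e_def)
        then show ?thesis using deep[OF z] inner_radius_lipschitz[of V z "z + y"]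
          by (simp add: abs_le_iff)
      qed
      then show "z \<in> shrink e ?W" by (simp add: shrink_def)
    qed
    then show "submean_on (sublevel V t) g" using submean_on_subset[OF g(3)[OF sF]] by blast
    show "\<bar>g z - log_exhaustion V z\<bar> \<le> 1 / 8" if "z \<in> sublevel V t" for z
    proof -
      have "F z = log_exhaustion V z" using deep[OF that] ec by (intro Ff) simp
      then show ?thesis using g(2)[of z] Le by linarith
    qed
  qed
qed

lemma glue_step:
  assumes f: "submean_on V (log_exhaustion V)"
    and h: "\<And>n. smooth_along coord_dirs n h" "submean_on (sublevel V (real k)) h"
  shows "\<exists>h'. ((\<forall>n. smooth_along coord_dirs n h') \<and> submean_on (sublevel V (real (Suc k))) h') \<and>
    (\<forall>z. h z \<le> h' z) \<and> (\<forall>z\<in>sublevel V (real k - 1). h' z = h z) \<and>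
    (\<forall>z\<in>sublevel V (real (Suc k)). real k \<le> log_exhaustion V z \<longrightarrow> real k \<le> h' z)"
proof -
  let ?f = "log_exhaustion V"
  obtain g where g: "\<And>n. smooth_along coord_dirs n g" "submean_on (sublevel V (real (Suc k))) g"
    "\<And>z. z \<in> sublevel V (real (Suc k)) \<Longrightarrow> \<bar>g z - ?f z\<bar> \<le> 1 / 8"
    using smooth_approx_log_exhaustion[OF f] by metis
  obtain \<rho> :: "real \<Rightarrow> real" where \<rho>:
    "\<And>n. smooth_along {1} n \<rho>" "\<And>t. 0 \<le> \<rho> t" "\<And>t. t \<le> -1 \<Longrightarrow> \<rho> t = 0"
    "\<And>t. 0 \<le> t \<Longrightarrow> \<rho> t = \<rho> 0 + t"
    "\<And>s. \<exists>\<beta>. 0 \<le> \<beta> \<and> \<beta> \<le> 1 \<and> (\<forall>t. \<rho> s + \<beta> * (t - s) \<le> \<rho> t)"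
    using smooth_ramp by metis
  have cont: "continuous_on UNIV u" if "smooth_along D 0 u" for D :: "'a::real_normed_vector set" and u
    using loc_lipschitz_continuous smooth_along_lipschitz that by blast
  \<comment> \<open>The norm is at most \<open>log_exhaustion\<close>, so the sublevel set lies in
    this ball; the Lipschitz bound there replaces compactness.\<close>
  obtain B where B: "0 \<le> B" "\<And>z. z \<in> cball 0 (real (Suc k)) \<Longrightarrow> \<bar>h z\<bar> \<le> B"
    using loc_lipschitz_bounded[OF smooth_along_lipschitz[OF h(1)]] by metis
  have Bh: "\<bar>h z\<bar> \<le> B" if "z \<in> sublevel V (real (Suc k))" for z
    using log_exhaustion_bounds(2)[of z] that by (intro B(2)) (auto simp: sublevel_def)
  \<comment> \<open>Outside the transition zone \<open>g\<close> differs from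
    \<open>k - 1 / 2\<close> by at least 1/4 - 1/8 = 1/8. Times \<open>A\<close> this beats the
    bound \<open>B\<close> of \<open>h\<close> by at least 1, the width of the ramp, and brings the
    new value up to \<open>k\<close>.\<close>
  define A where "A = 8 * (B + 1 + real k)"
  have A: "0 \<le> A" using B(1) by (simp add: A_def)
  define G where "G z = A * g z + A * (1 / 2 - real k)" for z
  define h' where "h' z = h z + \<rho> (G z - h z)" for z
  have smG: "smooth_along coord_dirs n G" for n
    unfolding G_def by (intro smooth_along_add smooth_along_cmult g smooth_along_const)
  have sm: "smooth_along coord_dirs n h'" for n
    unfolding h'_def by (intro smooth_along_add smooth_along_compose[OF \<rho>(1)] smooth_along_diff smG h)
  have sG: "submean_on (sublevel V (real (Suc k))) G"
    unfolding G_def by (intro submean_on_affine g A cont[OF g(1)])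
  have low: "h' z = h z" if "z \<in> sublevel V (real (Suc k))" "?f z < real k - 3 / 4" for z
  proof -
    have "g z + (1 / 2 - real k) \<le> - (1 / 8)" using g(3)[OF that(1)] that(2) by linarith
    then have "A * (g z + (1 / 2 - real k)) \<le> A * - (1 / 8)" using A by (rule mult_left_mono)
    then have "G z \<le> - (B + 1 + real k)" by (simp add: G_def A_def algebra_simps)
    then have "G z - h z \<le> - 1" using Bh[OF that(1)] by linarith
    then show ?thesis by (simp add: h'_def \<rho>(3))
  qed
  have high: "h' z = \<rho> 0 + G z \<and> B + 1 + real k \<le> G z" if "z \<in> sublevel V (real (Suc k))" "real k - 1 / 4 \<le> ?f z" for z
  proof -
    have "1 / 8 \<le> g z + (1 / 2 - real k)" using g(3)[OF that(1)] that(2) by linarith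
    then have "A * (1 / 8) \<le> A * (g z + (1 / 2 - real k))" using A by (rule mult_left_mono)
    then have G: "B + 1 + real k \<le> G z" by (simp add: G_def A_def algebra_simps)
    then have "0 \<le> G z - h z" using Bh[OF that(1)] by linarith
    then have "\<rho> (G z - h z) = \<rho> 0 + (G z - h z)" by (rule \<rho>(4))
    then show ?thesis using G by (simp add: h'_def)
  qed
  have "submean_on (sublevel V (real (Suc k))) h'"
  \<comment> \<open>Two overlapping open sets: below level \<open>k\<close> both \<open>h\<close>
    and \<open>G\<close> are submean; above \<open>k - 1 / 4\<close> the glued function is
    \<open>G\<close> plus a constant.\<close>
  proof (rule submean_on_local)
    show "continuous_on (sublevel V (real (Suc k))) h'"
      using continuous_on_subset[OF cont[OF sm]] by simp
    fix x assume x: "x \<in> sublevel V (real (Suc k))"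
    show "\<exists>N. open N \<and> x \<in> N \<and> submean_on N h'"
    proof (cases "?f x < real k")
      case True
      have "submean_on (sublevel V (real k)) G"
        by (rule submean_on_subset[OF sG]) (auto simp: sublevel_def)
      then have "submean_on (sublevel V (real k)) h'"
        unfolding h'_def by (intro submean_on_ramp h cont[OF h(1)] cont[OF smG] cont[OF \<rho>(1)] \<rho>(5))
      then show ?thesis using True x open_sublevel(1)[of "real k"] by (auto simp: sublevel_def)
    next
      case False
      let ?N = "sublevel V (real (Suc k)) \<inter> {z \<in> V. real k - 1 / 4 < ?f z}"
      have "submean_on ?N (\<lambda>z. 1 * G z + \<rho> 0)"
        by (intro submean_on_affine submean_on_subset[OF sG] cont[OF smG]) auto
      then have "submean_on ?N h'" by (rule submean_on_cong) (use high in auto)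
      then show ?thesis using False x open_sublevel
        by (intro exI[of _ ?N]) (auto simp: sublevel_def)
    qed
  qed
  moreover have "h z \<le> h' z" for z by (simp add: h'_def \<rho>(2))
  moreover have "h' z = h z" if "z \<in> sublevel V (real k - 1)" for z
    using that by (intro low) (auto simp: sublevel_def)
  moreover have "real k \<le> h' z" if "z \<in> sublevel V (real (Suc k))" "real k \<le> ?f z" for z
    using high[OF that(1)] that(2) B(1) \<rho>(2)[of 0] by linarith
  ultimately show ?thesis using sm by blast
qed

text \<open>Each step keeps the values below level \<open>k - 1\<close>, so the sequence is
  eventually constant on every sublevel set. On the sublevel set of level \<open>k\<close> it has
  settled from index \<open>k + 1\<close> on, which explains the shift in the family
  returned.\<close>

lemma smooth_psh_exhaustion:
  assumes f: "submean_on V (log_exhaustion V)"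
  obtains \<eta> h where "\<And>k n. smooth_along coord_dirs n (h k)"
    "\<And>k z. z \<in> sublevel V (real k) \<Longrightarrow> \<eta> z = h k z"
    "\<And>z. z \<in> V \<Longrightarrow> log_exhaustion V z - 1 \<le> \<eta> z" "continuous_on V \<eta>" "submean_on V \<eta>"
proof -
  let ?f = "log_exhaustion V"
  let ?P = "\<lambda>k h. (\<forall>n. smooth_along coord_dirs n h) \<and> submean_on (sublevel V (real k)) h"
  let ?Q = "\<lambda>k h h'. (\<forall>z. h z \<le> h' z) \<and> (\<forall>z\<in>sublevel V (real k - 1). h' z = h z) \<and>
    (\<forall>z\<in>sublevel V (real (Suc k)). real k \<le> ?f z \<longrightarrow> real k \<le> h' z)"
  \<comment> \<open>Over the empty set the zero function qualifies vacuously.\<close>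
  have "sublevel V 0 = {}" using log_exhaustion_bounds(1) by (fastforce simp: sublevel_def)
  then have "?P 0 (\<lambda>_. 0)" by (auto simp: smooth_along_const submean_on_def)
  then have base: "\<exists>h. ?P 0 h" by (intro exI)
  have "\<exists>h. \<forall>k. ?P k (h k) \<and> ?Q k (h k) (h (Suc k))"
  proof (rule dependent_nat_choice[where P = ?P and Q = ?Q, OF base])
    fix h k assume "?P k h"
    then show "\<exists>h'. ?P (Suc k) h' \<and> ?Q k h h'" by (intro glue_step[OF f]) blast+
  qed
  then obtain h where "\<forall>k. ?P k (h k) \<and> ?Q k (h k) (h (Suc k))" by (elim exE)
  then have h: "?P k (h k)" "?Q k (h k) (h (Suc k))" for k by (blast, blast)
  have stable: "h (k + m) z = h k z" if "z \<in> sublevel V (real k - 1)" for k m z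
  proof (induction m)
    case (Suc m)
    have "z \<in> sublevel V (real (k + m) - 1)" using that by (auto simp: sublevel_def)
    then show ?case using h(2)[of "k + m"] Suc by simp
  qed simp
  \<comment> \<open>The least index with \<open>?f z\<close> < \<open>N z - 1\<close>, from which on
    the values at \<open>z\<close> no longer change.\<close>
  define N where "N z = nat \<lfloor>?f z\<rfloor> + 2" for z
  define \<eta> where "\<eta> z = h (N z) z" for z
  have N: "?f z < real (N z) - 1" "real (N z) - 2 \<le> ?f z" if "z \<in> V" for z
    using log_exhaustion_bounds(1)[OF that] unfolding N_def by linarith+
  have \<eta>: "\<eta> z = h (Suc k) z" if z: "z \<in> sublevel V (real k)" for k z
  proof -
    have zV: "z \<in> V" "?f z < real k" using z by (auto simp: sublevel_def)
    have "N z \<le> Suc k" using N(2)[OF zV(1)] zV(2) by linarith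
    moreover have "z \<in> sublevel V (real (N z) - 1)" using N(1) zV by (simp add: sublevel_def)
    ultimately show ?thesis using stable[of z "N z" "Suc k - N z"] by (simp add: \<eta>_def)
  qed
  have cov: "\<exists>k. z \<in> sublevel V (real k)" if "z \<in> V" for z
    using that reals_Archimedean2[of "?f z"] by (auto simp: sublevel_def)
  have ch: "continuous_on UNIV (h k)" for k
    using loc_lipschitz_continuous[OF smooth_along_lipschitz] h(1) by blast
  have c\<eta>: "continuous_on V \<eta>"
  proof -
    have "isCont \<eta> z" if z: "z \<in> V" for z
    proof -
      obtain k where k: "z \<in> sublevel V (real k)" using cov[OF z] by blast
      have "continuous_on (sublevel V (real k)) \<eta>"
        using continuous_on_subset[OF ch[of "Suc k"]] \<eta> by (metis continuous_on_cong subset_UNIV)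
      then show ?thesis using k open_sublevel(1) by (simp add: continuous_on_eq_continuous_at)
    qed
    then show ?thesis using V by (simp add: continuous_on_eq_continuous_at)
  qed
  show thesis
  proof
    show "smooth_along coord_dirs n (h (Suc k))" for k n using h(1) by blast
    show "\<eta> z = h (Suc k) z" if "z \<in> sublevel V (real k)" for k z by (rule \<eta>[OF that])
    show "?f z - 1 \<le> \<eta> z" if z: "z \<in> V" for z
    proof -
      \<comment> \<open>\<open>j\<close> is the integer part of \<open>?f z\<close>. The step to
        index \<open>j + 1\<close> raises the value to at least \<open>j\<close>, later steps never
        lower it, and \<open>?f z - 1\<close> < \<open>j\<close>.\<close>
      obtain j where j: "N z = Suc (Suc j)" by (simp add: N_def)
      have "z \<in> sublevel V (real (Suc j))" "real j \<le> ?f z" using N[OF z] z j by (auto simp: sublevel_def)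
      then have "real j \<le> h (Suc j) z" using h(2)[of j] by blast
      also have "\<dots> \<le> h (Suc (Suc j)) z" using h(2)[of "Suc j"] by blast
      finally show ?thesis using N(1)[OF z] j by (simp add: \<eta>_def)
    qed
    show "continuous_on V \<eta>" by (rule c\<eta>)
    show "submean_on V \<eta>"
    proof (rule submean_on_local[OF c\<eta>])
      fix z assume "z \<in> V"
      then obtain k where k: "z \<in> sublevel V (real k)" using cov by blast
      have "submean_on (sublevel V (real k)) (h (Suc k))"
        by (rule submean_on_subset[OF conjunct2[OF h(1)[of "Suc k"]]]) (auto simp: sublevel_def)
      then have "submean_on (sublevel V (real k)) \<eta>"
        by (rule submean_on_cong) (use \<eta> in auto)
      then show "\<exists>N. open N \<and> z \<in> N \<and> submean_on N \<eta>" using k open_sublevel(1) by blast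
    qed
  qed
qed

end

lemma submean_on_log_exhaustion:
  assumes "pseudoconvex_domain V"
  shows "submean_on V (log_exhaustion V)"
  unfolding submean_on_def
proof (intro allI impI)
  fix a b assume d: "\<forall>c. cmod c \<le> 1 \<longrightarrow> a + c *\<^sub>C b \<in> V"
  have oV: "open V" using assms by (simp add: pseudoconvex_domain_def)
  have cn: "continuous_on (sphere 0 1) (\<lambda>c. norm (a + c *\<^sub>C b))" by (intro continuous_intros)
  have "continuous_on V (\<lambda>z. - ln (inner_radius V z))"
    by (intro continuous_intros inner_radius_continuous) (use inner_radius_pos[OF oV] in force)
  then have cl: "continuous_on (sphere 0 1) (\<lambda>c. - ln (inner_radius V (a + c *\<^sub>C b)))"
    by (rule continuous_on_disc) (use d in auto)
  have "norm a + - ln (inner_radius V a)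
      \<le> circ_mean (\<lambda>c. norm (a + c *\<^sub>C b)) + circ_mean (\<lambda>c. - ln (inner_radius V (a + c *\<^sub>C b)))"
    using d submean_onD[OF submean_on_norm[of V]] submean_onD[OF submean_on_neg_log_inner_radius[OF assms]]
    by (intro add_mono) auto
  also have "\<dots> = circ_mean (\<lambda>c. norm (a + c *\<^sub>C b) + - ln (inner_radius V (a + c *\<^sub>C b)))"
    by (rule circ_mean_add[OF cn cl, symmetric])
  finally show "log_exhaustion V a \<le> circ_mean (\<lambda>c. log_exhaustion V (a + c *\<^sub>C b))"
    by (simp add: log_exhaustion_def)
qed

section \<open>The function spaces\<close>

lemma has_dderivI:
  assumes "\<And>x e. 0 < e \<Longrightarrow> \<exists>d>0. \<forall>\<tau>. \<bar>\<tau>\<bar> < d \<longrightarrow> \<bar>f (x + \<tau> *\<^sub>R v) - f x - \<tau> * f' x\<bar> \<le> e * \<bar>\<tau>\<bar>"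
  shows "has_dderiv v f f'"
  unfolding has_dderiv_def has_field_derivative_def has_derivative_at_alt
  using assms by (auto simp: bounded_linear_mult_right mult.commute)

lemma has_dderivE:
  assumes "has_dderiv v f f'" "0 < e"
  obtains d where "0 < d" "\<And>\<tau>. \<bar>\<tau>\<bar> < d \<Longrightarrow> \<bar>f (x + \<tau> *\<^sub>R v) - f x - \<tau> * f' x\<bar> \<le> e * \<bar>\<tau>\<bar>"
proof -
  have "\<exists>d>0. \<forall>y. norm (y - 0) < d \<longrightarrow>
      norm (f (x + y *\<^sub>R v) - f (x + 0 *\<^sub>R v) - f' x * (y - 0)) \<le> e * norm (y - 0)"
    using assms unfolding has_dderiv_def has_field_derivative_def has_derivative_at_alt by blast
  then show thesis using that by (auto simp: mult.commute)
qed

lemma has_dderiv_unique: "has_dderiv v f f' \<Longrightarrow> has_dderiv v f f'' \<Longrightarrow> f' = f''"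
  unfolding has_dderiv_def using DERIV_unique by blast

lemma has_dderiv_scaleR:
  assumes "has_dderiv v f f'"
  shows "has_dderiv (c *\<^sub>R v) f (\<lambda>x. c * f' x)"
  unfolding has_dderiv_def
proof
  fix x
  have "((\<lambda>\<tau>. f (x + (\<tau> * c) *\<^sub>R v)) has_real_derivative f' x * c) (at 0)"
    by (rule DERIV_chain2[where g = "\<lambda>\<tau>. \<tau> * c" and f = "\<lambda>\<tau>. f (x + \<tau> *\<^sub>R v)"])
      (use assms in \<open>auto simp: has_dderiv_def intro!: derivative_eq_intros\<close>)
  then show "((\<lambda>\<tau>. f (x + \<tau> *\<^sub>R c *\<^sub>R v)) has_real_derivative c * f' x) (at 0)"
    by (simp add: mult.commute)
qed

text \<open>There is no total derivative to appeal to. Going first along \<open>v\<close> and then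
  along \<open>w\<close>, continuity of \<open>g'\<close> controls the second leg, which starts at a
  moving point.\<close>

lemma has_dderiv_add:
  fixes f :: "'a::real_normed_vector \<Rightarrow> real"
  assumes v: "has_dderiv v f f'" and w: "has_dderiv w f g'" and cont: "continuous_on UNIV g'"
  shows "has_dderiv (v + w) f (\<lambda>x. f' x + g' x)"
proof (rule has_dderivI)
  fix x :: 'a and e :: real assume e: "0 < e"
  obtain d where d: "0 < d" "\<And>\<tau>. \<bar>\<tau>\<bar> < d \<Longrightarrow> \<bar>f (x + \<tau> *\<^sub>R v) - f x - \<tau> * f' x\<bar> \<le> e / 2 * \<bar>\<tau>\<bar>"
    using has_dderivE[OF v, of "e / 2"] e by (metis half_gt_zero)
  obtain d' where d': "0 < d'" "\<And>y. dist y x < d' \<Longrightarrow> \<bar>g' y - g' x\<bar> < e / 2"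
    using cont e unfolding continuous_on_iff dist_real_def by (metis UNIV_I half_gt_zero)
  define r where "r = min d (d' / (2 * (norm v + norm w + 1)))"
  let ?k = "norm v + norm w + 1"
  have k: "0 < ?k" by (simp add: add_nonneg_pos)
  show "\<exists>d>0. \<forall>\<tau>. \<bar>\<tau>\<bar> < d \<longrightarrow>
      \<bar>f (x + \<tau> *\<^sub>R (v + w)) - f x - \<tau> * (f' x + g' x)\<bar> \<le> e * \<bar>\<tau>\<bar>"
  proof (intro exI[of _ r] conjI allI impI)
    show "0 < r" using d(1) d'(1) k by (simp add: r_def)
    fix \<tau> assume \<tau>: "\<bar>\<tau>\<bar> < r"
    have "\<bar>f ((x + \<tau> *\<^sub>R v) + \<tau> *\<^sub>R w) - f (x + \<tau> *\<^sub>R v) - \<tau> * g' x\<bar> \<le> e / 2 * \<bar>\<tau>\<bar>"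
    proof (rule has_dderiv_linear_approx[OF w])
      fix s assume s: "\<bar>s\<bar> \<le> \<bar>\<tau>\<bar>"
      have "norm (\<tau> *\<^sub>R v + s *\<^sub>R w) \<le> \<bar>\<tau>\<bar> * norm v + \<bar>s\<bar> * norm w"
        by (metis norm_triangle_ineq norm_scaleR)
      also have "\<dots> \<le> \<bar>\<tau>\<bar> * norm v + \<bar>\<tau>\<bar> * norm w"
        using s by (intro add_left_mono mult_right_mono) auto
      also have "\<dots> \<le> \<bar>\<tau>\<bar> * ?k" by (simp add: algebra_simps)
      also have "\<dots> \<le> d' / (2 * ?k) * ?k"
        using \<tau> k by (intro mult_right_mono) (auto simp: r_def)
      also have "\<dots> = d' / 2" using k by (simp del: distrib_left_numeral)
      also have "\<dots> < d'" using d'(1) by simp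
      finally have "dist (x + \<tau> *\<^sub>R v + s *\<^sub>R w) x < d'" by (simp add: dist_norm add.assoc)
      then show "\<bar>g' (x + \<tau> *\<^sub>R v + s *\<^sub>R w) - g' x\<bar> \<le> e / 2" using d'(2) less_imp_le by blast
    qed
    moreover have "\<bar>f (x + \<tau> *\<^sub>R v) - f x - \<tau> * f' x\<bar> \<le> e / 2 * \<bar>\<tau>\<bar>"
      using \<tau> by (intro d(2)) (simp add: r_def)
    moreover have "e / 2 * \<bar>\<tau>\<bar> + e / 2 * \<bar>\<tau>\<bar> = e * \<bar>\<tau>\<bar>" by simp
    ultimately have "\<bar>f (x + \<tau> *\<^sub>R v + \<tau> *\<^sub>R w) - f x - (\<tau> * f' x + \<tau> * g' x)\<bar> \<le> e * \<bar>\<tau>\<bar>"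
      by linarith
    then show "\<bar>f (x + \<tau> *\<^sub>R (v + w)) - f x - \<tau> * (f' x + g' x)\<bar> \<le> e * \<bar>\<tau>\<bar>"
      by (simp add: scaleR_add_right add.assoc[symmetric] distrib_left)
  qed
qed

lemma has_dderiv_sum:
  fixes f :: "'a::real_normed_vector \<Rightarrow> real" and n :: nat
  assumes "\<And>i. i < n \<Longrightarrow> has_dderiv (v i) f (f' i)" "\<And>i. i < n \<Longrightarrow> continuous_on UNIV (f' i)"
  shows "has_dderiv (\<Sum>i<n. c i *\<^sub>R v i) f (\<lambda>x. \<Sum>i<n. c i * f' i x)"
  using assms
proof (induction n)
  case 0
  then show ?case by (simp add: has_dderiv_def)
next
  case (Suc n)
  then show ?case
    by (auto intro!: has_dderiv_add has_dderiv_scaleR continuous_intros)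
qed

lemma has_dderiv_lipschitz_bound:
  assumes d: "has_dderiv w f f'" and x: "norm x < R"
    and L: "\<And>x y. x \<in> cball 0 R \<Longrightarrow> y \<in> cball 0 R \<Longrightarrow> \<bar>f x - f y\<bar> \<le> L * norm (x - y)"
  shows "\<bar>f' x\<bar> \<le> L * norm w"
proof (rule tendsto_upperbound[where F = "at (0::real)"])
  have "((\<lambda>h. (f (x + h *\<^sub>R w) - f (x + 0 *\<^sub>R w)) / (h - 0)) \<longlongrightarrow> f' x) (at 0)"
    using d unfolding has_dderiv_def has_field_derivative_iff by blast
  then show "((\<lambda>h. \<bar>(f (x + h *\<^sub>R w) - f x) / h\<bar>) \<longlongrightarrow> \<bar>f' x\<bar>) (at 0)"
    by (intro tendsto_rabs) simp
  have "((\<lambda>h. norm (x + h *\<^sub>R w)) \<longlongrightarrow> norm (x + 0 *\<^sub>R w)) (at (0::real))"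
    by (intro tendsto_intros)
  then have "\<forall>\<^sub>F h in at (0::real). norm (x + h *\<^sub>R w) < R"
    by (rule order_tendstoD) (use x in simp)
  then show "\<forall>\<^sub>F h in at (0::real). \<bar>(f (x + h *\<^sub>R w) - f x) / h\<bar> \<le> L * norm w"
    using eventually_neq_at_within[of 0 0 UNIV]
  proof eventually_elim
    case (elim h)
    have "\<bar>f (x + h *\<^sub>R w) - f x\<bar> \<le> L * norm (h *\<^sub>R w)"
      using L[of "x + h *\<^sub>R w" x] elim(1) x by simp
    then show ?case using elim(2) by (simp add: divide_simps algebra_simps)
  qed
qed simp

lemma coord_sum: "coord (\<Sum>i\<in>I. f i) k = (\<Sum>i\<in>I. coord (f i) k)"
  by (induction I rule: infinite_finite_induct) (simp_all add: zero_ell2.rep_eq plus_ell2.rep_eq)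

text \<open>Testing the Lipschitz bound along the truncated gradient itself bounds the gradient.\<close>

lemma gradient_bound:
  fixes f :: "ell2 \<Rightarrow> real"
  assumes dx: "\<And>j. has_dderiv (x_dir j) f (p j)" "\<And>j. continuous_on UNIV (p j)"
    and dy: "\<And>j. has_dderiv (y_dir j) f (q j)" "\<And>j. continuous_on UNIV (q j)"
    and z: "norm z < R"
    and L: "\<And>x y. x \<in> cball 0 R \<Longrightarrow> y \<in> cball 0 R \<Longrightarrow> \<bar>f x - f y\<bar> \<le> L * norm (x - y)"
  shows "(\<Sum>j<n. (p j z)\<^sup>2 + (q j z)\<^sup>2) \<le> L\<^sup>2"
proof -
  define w where "w = (\<Sum>j<n. p j z *\<^sub>R x_dir j) + (\<Sum>j<n. q j z *\<^sub>R y_dir j)"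
  define s where "s = (\<Sum>j<n. (p j z)\<^sup>2 + (q j z)\<^sup>2)"
  have s: "0 \<le> s" unfolding s_def by (intro sum_nonneg) auto
  have "has_dderiv w f (\<lambda>x. (\<Sum>j<n. p j z * p j x) + (\<Sum>j<n. q j z * q j x))"
    unfolding w_def
    by (intro has_dderiv_add has_dderiv_sum dx dy continuous_intros)
  \<comment> \<open>At \<open>z\<close> the derivative along \<open>w\<close> is \<open>s\<close>
    itself, while \<open>norm w\<close> is the square root of \<open>s\<close>.\<close>
  from has_dderiv_lipschitz_bound[OF this z L]
  have 1: "s \<le> L * norm w"
    by (simp add: s_def sum.distrib power2_eq_square)
  have "coord w k = (if k < n then Complex (p k z) (q k z) else 0)" for k
  proof -
    have "coord w k = (\<Sum>j<n. if k = j then of_real (p j z) + \<i> * of_real (q j z) else 0)"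
      unfolding w_def plus_ell2.rep_eq coord_sum sum.distrib[symmetric]
      by (intro sum.cong refl)
        (simp add: scaleR_ell2.rep_eq scaleC.rep_eq unit_vec.rep_eq scaleR_conv_of_real)
    then show ?thesis by (simp add: complex_eq_iff)
  qed
  then have "(\<lambda>k. (cmod (coord w k))\<^sup>2) = (\<lambda>k. if k \<in> {..<n} then (p k z)\<^sup>2 + (q k z)\<^sup>2 else 0)"
    by (auto simp: cmod_power2)
  then have 2: "norm w = sqrt s"
    unfolding norm_ell2_def s_def
    using sums_unique[OF sums_If_finite_set[of "{..<n}" "\<lambda>k. (p k z)\<^sup>2 + (q k z)\<^sup>2"]] by simp
  show ?thesis
  proof (cases "s = 0")
    case False
    then have s0: "0 < sqrt s" using s by simp
    have "sqrt s * sqrt s \<le> L * sqrt s" using 1 2 s by simp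
    then have "sqrt s \<le> L" using s0 by (rule mult_right_le_imp_le)
    then have "(sqrt s)\<^sup>2 \<le> L\<^sup>2" using s0 by (intro power_mono) auto
    then show ?thesis using s by (simp add: s_def)
  qed (simp add: s_def)
qed

section \<open>Functions smooth in all coordinates\<close>

definition coord_smooth :: "(ell2 \<Rightarrow> complex) \<Rightarrow> bool" where
  "coord_smooth F \<longleftrightarrow>
    (\<forall>n. smooth_along coord_dirs n (\<lambda>z. Re (F z)) \<and> smooth_along coord_dirs n (\<lambda>z. Im (F z)))"

lemma coord_smooth_continuous: "coord_smooth F \<Longrightarrow> continuous_on S F"
proof -
  assume "coord_smooth F"
  then have "loc_lipschitz (\<lambda>z. Re (F z))" "loc_lipschitz (\<lambda>z. Im (F z))"
    unfolding coord_smooth_def using smooth_along_lipschitz by blast+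
  then have "continuous_on S (\<lambda>z. Re (F z))" "continuous_on S (\<lambda>z. Im (F z))"
    using loc_lipschitz_continuous continuous_on_subset by blast+
  then have "continuous_on S (\<lambda>z. of_real (Re (F z)) + \<i> * of_real (Im (F z)))"
    by (intro continuous_on_add continuous_on_mult continuous_on_const continuous_on_of_real)
  moreover have "(\<lambda>z. of_real (Re (F z)) + \<i> * of_real (Im (F z))) = F"
    by (auto simp: complex_eq_iff)
  ultimately show "continuous_on S F" by metis
qed

text \<open>\<open>smooth_along\<close> offers a derivative for each order; uniqueness makes it the
  same one for all orders.\<close>

lemma smooth_along_dderiv:
  assumes "\<And>n. smooth_along D n f" "v \<in> D"
  obtains f' where "has_dderiv v f f'" "\<And>n. smooth_along D n f'"
proof -
  obtain f' where f': "has_dderiv v f f'" using assms(1)[of 1] assms(2) by auto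
  have "smooth_along D n f'" for n
  proof -
    obtain g where "has_dderiv v f g" "smooth_along D n g"
      using assms(1)[of "Suc n"] assms(2) by auto
    then show ?thesis using has_dderiv_unique[OF f'] by simp
  qed
  then show thesis using that f' by blast
qed

lemma coord_smooth_ddir:
  assumes F: "coord_smooth F" and v: "v \<in> coord_dirs"
  shows "has_ddir v F z" "coord_smooth (ddir v F)"
    "has_dderiv v (\<lambda>z. Re (F z)) (\<lambda>z. Re (ddir v F z))"
    "has_dderiv v (\<lambda>z. Im (F z)) (\<lambda>z. Im (ddir v F z))"
proof -
  obtain f where f: "has_dderiv v (\<lambda>z. Re (F z)) f" "\<And>n. smooth_along coord_dirs n f"
    using smooth_along_dderiv[of coord_dirs "\<lambda>z. Re (F z)" v] F v unfolding coord_smooth_def by blast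
  obtain g where g: "has_dderiv v (\<lambda>z. Im (F z)) g" "\<And>n. smooth_along coord_dirs n g"
    using smooth_along_dderiv[of coord_dirs "\<lambda>z. Im (F z)" v] F v unfolding coord_smooth_def by blast
  have d: "((\<lambda>\<tau>. F (z + \<tau> *\<^sub>R v)) has_vector_derivative Complex (f z) (g z)) (at 0)" for z
    using f(1) g(1) by (simp add: has_vector_derivative_complex_iff has_dderiv_def)
  then show "has_ddir v F z" unfolding has_ddir_def by blast
  have eq: "ddir v F = (\<lambda>z. Complex (f z) (g z))"
    using vector_derivative_at[OF d] by (auto simp: ddir_def)
  show "coord_smooth (ddir v F)"
    unfolding eq coord_smooth_def using f g by simp
  show "has_dderiv v (\<lambda>z. Re (F z)) (\<lambda>z. Re (ddir v F z))"
    "has_dderiv v (\<lambda>z. Im (F z)) (\<lambda>z. Im (ddir v F z))"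
    using f g by (simp_all add: eq)
qed

lemma dirs_in_coord_dirs [simp]: "x_dir j \<in> coord_dirs" "y_dir j \<in> coord_dirs"
  by (simp_all add: coord_dirs_def)

lemma coord_smooth_d_hol:
  assumes "coord_smooth F"
  shows "coord_smooth (d_hol j F)"
proof -
  let ?X = "ddir (x_dir j) F" and ?Y = "ddir (y_dir j) F"
  have "(\<lambda>z. Re (d_hol j F z)) = (\<lambda>z. 1 / 2 * (Re (?X z) + Im (?Y z)))"
    "(\<lambda>z. Im (d_hol j F z)) = (\<lambda>z. 1 / 2 * (Im (?X z) - Re (?Y z)))"
    by (auto simp: d_hol_def)
  then show ?thesis
    using coord_smooth_ddir(2)[OF assms, of "x_dir j"] coord_smooth_ddir(2)[OF assms, of "y_dir j"]
    unfolding coord_smooth_def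
    by (auto simp only: dirs_in_coord_dirs intro!: smooth_along_cmult smooth_along_add smooth_along_diff)
qed

lemma coord_smooth_d_anti:
  assumes "coord_smooth F"
  shows "coord_smooth (d_anti j F)"
proof -
  let ?X = "ddir (x_dir j) F" and ?Y = "ddir (y_dir j) F"
  have "(\<lambda>z. Re (d_anti j F z)) = (\<lambda>z. 1 / 2 * (Re (?X z) - Im (?Y z)))"
    "(\<lambda>z. Im (d_anti j F z)) = (\<lambda>z. 1 / 2 * (Im (?X z) + Re (?Y z)))"
    by (auto simp: d_anti_def)
  then show ?thesis
    using coord_smooth_ddir(2)[OF assms, of "x_dir j"] coord_smooth_ddir(2)[OF assms, of "y_dir j"]
    unfolding coord_smooth_def
    by (auto simp only: dirs_in_coord_dirs intro!: smooth_along_cmult smooth_along_add smooth_along_diff)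
qed

section \<open>Uniform inclusion in terms of balls\<close>

lemma uniformly_includedI:
  assumes "open V" "S \<subseteq> V" "bounded S" "0 < r"
    and "\<And>z y. z \<in> S \<Longrightarrow> norm (y - z) < r \<Longrightarrow> y \<in> V"
  shows "uniformly_included S V"
proof -
  have "0 < boundary_dist S V"
  proof (cases "V = UNIV")
    case False
    have "ereal r \<le> (INF (z, w) \<in> S \<times> frontier V. ereal (norm (z - w)))"
    proof (rule INF_greatest, clarify)
      fix z w assume "z \<in> S" "w \<in> frontier V"
      moreover have "w \<notin> V" using \<open>w \<in> frontier V\<close> \<open>open V\<close> by (simp add: frontier_def interior_open)
      ultimately have "\<not> norm (w - z) < r" using assms(5) by blast
      then show "ereal r \<le> ereal (norm (z - w))" by (simp add: norm_minus_commute)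
    qed
    moreover have "0 < ereal r" using assms(4) by simp
    ultimately have "0 < (INF (z, w) \<in> S \<times> frontier V. ereal (norm (z - w)))" by (rule less_le_trans[rotated])
    then show ?thesis using False by (simp add: boundary_dist_def)
  qed (simp add: boundary_dist_def)
  then show ?thesis using assms(2,3) by (simp add: uniformly_included_def)
qed

text \<open>A segment from a point of \<open>V\<close> to a point outside meets the frontier, and no
  later than at its end.\<close>

lemma uniformly_includedD:
  assumes "uniformly_included S V"
  obtains r where "0 < r" "S \<subseteq> V" "bounded S" "\<forall>z\<in>S. \<forall>y. norm (y - z) < r \<longrightarrow> y \<in> V"
proof (cases "S = {} \<or> V = UNIV")
  case True
  then show thesis using that[of 1] assms by (auto simp: uniformly_included_def)
next
  case False
  then have S: "S \<subseteq> V" "bounded S" and "0 < boundary_dist S V"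
    using assms by (auto simp: uniformly_included_def)
  then have "0 < (INF (z, w) \<in> S \<times> frontier V. ereal (norm (z - w)))"
    using False by (simp add: boundary_dist_def)
  then obtain r where r: "0 < ereal r" "ereal r < (INF (z, w) \<in> S \<times> frontier V. ereal (norm (z - w)))"
    using ereal_dense2 by blast
  have "y \<in> V" if z: "z \<in> S" and y: "norm (y - z) < r" for z y
  proof (rule ccontr)
    assume "y \<notin> V"
    then have "closed_segment z y \<inter> frontier V \<noteq> {}"
      using z S(1) by (intro connected_Int_frontier connected_segment) auto
    then obtain w where w: "w \<in> closed_segment z y" "w \<in> frontier V" by blast
    have "(INF (z, w) \<in> S \<times> frontier V. ereal (norm (z - w))) \<le> ereal (norm (z - w))"
      using z w(2) by (intro INF_lower2[of "(z, w)"]) auto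
    then have "ereal r < ereal (norm (z - w))" using r(2) by (rule less_le_trans[rotated])
    moreover have "norm (z - w) \<le> norm (y - z)"
      using segment_bound(1)[OF w(1)] by (simp add: norm_minus_commute)
    ultimately show False using y by simp
  qed
  then show thesis using that[of r] r(1) S by auto
qed

section \<open>From smoothness near uniformly included sets to the function spaces\<close>

text \<open>The exhaustion itself is in general not bounded on bounded parts of \<open>V\<close>.
  Agreement on an open set with a function on the whole space transfers both derivatives and
  Lipschitz bounds.\<close>

definition unif_smooth :: "ell2 set \<Rightarrow> (ell2 \<Rightarrow> complex) \<Rightarrow> bool" where
  "unif_smooth V f \<longleftrightarrow> (\<forall>S. uniformly_included S V \<longrightarrow>
     (\<exists>W g. open W \<and> S \<subseteq> W \<and> coord_smooth g \<and> (\<forall>x\<in>W. f x = g x)))"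

lemma unif_smoothE:
  assumes "unif_smooth V f" "uniformly_included S V"
  obtains W g where "open W" "S \<subseteq> W" "coord_smooth g" "\<And>x. x \<in> W \<Longrightarrow> f x = g x"
  using assms unfolding unif_smooth_def by meson

lemma ddir_cong:
  assumes "open W" "z \<in> W" "\<And>x. x \<in> W \<Longrightarrow> f x = g x"
  shows "has_ddir v f z \<longleftrightarrow> has_ddir v g z" "ddir v f z = ddir v g z"
proof -
  have "((\<lambda>\<tau>. z + \<tau> *\<^sub>R v) \<longlongrightarrow> z + 0 *\<^sub>R v) (nhds (0::real))"
    by (intro tendsto_intros filterlim_ident)
  then have "\<forall>\<^sub>F \<tau> in nhds (0::real). z + \<tau> *\<^sub>R v \<in> W"
    using assms(1,2) by (intro topological_tendstoD) auto
  then have ev: "\<forall>\<^sub>F \<tau> in nhds (0::real). \<tau> \<in> UNIV \<longrightarrow> f (z + \<tau> *\<^sub>R v) = g (z + \<tau> *\<^sub>R v)"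
    by eventually_elim (simp add: assms(3))
  have "((\<lambda>\<tau>. f (z + \<tau> *\<^sub>R v)) has_vector_derivative D) (at 0) \<longleftrightarrow>
      ((\<lambda>\<tau>. g (z + \<tau> *\<^sub>R v)) has_vector_derivative D) (at 0)" for D
    using ev assms(3)[OF assms(2)] by (intro has_vector_derivative_cong_ev) auto
  then show "has_ddir v f z \<longleftrightarrow> has_ddir v g z" "ddir v f z = ddir v g z"
    by (simp_all add: has_ddir_def ddir_def vector_derivative_def)
qed

text \<open>The operator \<open>T\<close> has to be local: its value at a point depends only on the
  function near that point.\<close>

lemma unif_smooth_transfer:
  assumes f: "unif_smooth V f"
    and op: "\<And>g. coord_smooth g \<Longrightarrow> coord_smooth (T g)"
    and cong: "\<And>W f g z. open W \<Longrightarrow> z \<in> W \<Longrightarrow> (\<And>x. x \<in> W \<Longrightarrow> f x = g x) \<Longrightarrow> T f z = T g z"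
  shows "unif_smooth V (T f)"
  unfolding unif_smooth_def
proof (intro allI impI)
  fix S assume "uniformly_included S V"
  then obtain W g where "open W" "S \<subseteq> W" "coord_smooth g" "\<forall>x\<in>W. f x = g x"
    using f unfolding unif_smooth_def by blast
  then show "\<exists>W g. open W \<and> S \<subseteq> W \<and> coord_smooth g \<and> (\<forall>x\<in>W. T f x = g x)"
    using op cong[of W _ f g] by (intro exI[of _ W] exI[of _ "T g"]) auto
qed

lemma unif_smooth_ddir: "unif_smooth V f \<Longrightarrow> v \<in> coord_dirs \<Longrightarrow> unif_smooth V (ddir v f)"
  by (rule unif_smooth_transfer) (auto intro: coord_smooth_ddir(2) ddir_cong(2))

lemma unif_smooth_d_hol: "unif_smooth V f \<Longrightarrow> unif_smooth V (d_hol j f)"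
proof (rule unif_smooth_transfer[where T = "d_hol j"])
  fix W and f g :: "ell2 \<Rightarrow> complex" and z assume "open W" "z \<in> W" "\<And>x. x \<in> W \<Longrightarrow> f x = g x"
  then have "ddir v f z = ddir v g z" for v by (rule ddir_cong(2))
  then show "d_hol j f z = d_hol j g z" by (simp add: d_hol_def)
qed (auto intro: coord_smooth_d_hol)

lemma unif_smooth_d_anti: "unif_smooth V f \<Longrightarrow> unif_smooth V (d_anti j f)"
proof (rule unif_smooth_transfer[where T = "d_anti j"])
  fix W and f g :: "ell2 \<Rightarrow> complex" and z assume "open W" "z \<in> W" "\<And>x. x \<in> W \<Longrightarrow> f x = g x"
  then have "ddir v f z = ddir v g z" for v by (rule ddir_cong(2))
  then show "d_anti j f z = d_anti j g z" by (simp add: d_anti_def)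
qed (auto intro: coord_smooth_d_anti)

lemma unif_smooth_d_multi:
  assumes D: "\<And>j f. unif_smooth V f \<Longrightarrow> unif_smooth V (D j f)" and f: "unif_smooth V f"
  shows "unif_smooth V (d_multi D \<alpha> f)"
proof -
  have pow: "unif_smooth V f \<Longrightarrow> unif_smooth V ((D j ^^ n) f)" for j n f
    by (induction n) (auto intro: D)
  have "unif_smooth V (foldr (\<lambda>j. D j ^^ \<alpha> j) js f)" for js
    by (induction js) (auto intro: pow f)
  then show ?thesis unfolding d_multi_def .
qed

lemma unif_smooth_at:
  assumes "open V" "unif_smooth V f" "z \<in> V"
  obtains W g where "open W" "z \<in> W" "coord_smooth g" "\<And>x. x \<in> W \<Longrightarrow> f x = g x"
proof -
  obtain r where "0 < r" "ball z r \<subseteq> V" using assms(1,3) open_contains_ball by blast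
  then have "uniformly_included {z} V"
    using assms(1,3) by (intro uniformly_includedI[of _ _ r]) (auto simp: dist_norm norm_minus_commute subset_iff)
  then show thesis using assms(2) that unfolding unif_smooth_def by (metis insert_subset)
qed

lemma unif_smooth_Ck:
  assumes V: "open V"
  shows "unif_smooth V f \<Longrightarrow> f \<in> Ck n V"
proof (induction n arbitrary: f)
  case (0 f)
  have "isCont f z" if z: "z \<in> V" for z
  proof -
    obtain W g where W: "open W" "z \<in> W" "coord_smooth g" "\<And>x. x \<in> W \<Longrightarrow> f x = g x"
      using unif_smooth_at[OF V 0 z] by metis
    have "continuous_on W f"
      using coord_smooth_continuous[OF W(3)] W(4) by (metis continuous_on_cong)
    then show ?thesis using W(1,2) by (simp add: continuous_on_eq_continuous_at)
  qed
  then show ?case using V by (simp add: continuous_on_eq_continuous_at)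
next
  case (Suc n)
  have "f \<in> Ck n V" by (rule Suc.IH[OF Suc.prems])
  then have "continuous_on V f" by (cases n) auto
  moreover have "has_ddir v f z" if v: "v \<in> coord_dirs" and z: "z \<in> V" for v z
  proof -
    obtain W g where "open W" "z \<in> W" "coord_smooth g" "\<And>x. x \<in> W \<Longrightarrow> f x = g x"
      using unif_smooth_at[OF V Suc.prems z] by metis
    then show ?thesis using ddir_cong(1) coord_smooth_ddir(1)[OF _ v] by metis
  qed
  moreover have "ddir v f \<in> Ck n V" if "v \<in> coord_dirs" for v
    by (rule Suc.IH[OF unif_smooth_ddir[OF Suc.prems that]])
  ultimately show ?case unfolding Ck.simps coord_dirs_def by blast
qed

text \<open>By the parallelogram law the squares of the two complex derivatives add up to half the
  sum of squares of the four real ones, which the Lipschitz constants of real and imaginary part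
  control.\<close>

lemma unif_smooth_C1_F:
  assumes V: "open V" and f: "unif_smooth V f"
  shows "f \<in> C1_F V"
  unfolding C1_F_def
proof (intro CollectI conjI allI impI)
  show "f \<in> Ck 1 V" by (rule unif_smooth_Ck[OF V f])
  fix S assume S: "uniformly_included S V"
  obtain W g where W: "open W" "S \<subseteq> W" "coord_smooth g" "\<And>x. x \<in> W \<Longrightarrow> f x = g x"
    using unif_smoothE[OF f S] by metis
  have "bounded S" using S by (auto simp: uniformly_included_def)
  then obtain R where R: "\<And>z. z \<in> S \<Longrightarrow> norm z \<le> R" by (auto simp: bounded_iff)
  have "loc_lipschitz (\<lambda>z. Re (g z))" "loc_lipschitz (\<lambda>z. Im (g z))"
    using W(3) smooth_along_lipschitz unfolding coord_smooth_def by blast+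
  note ll = this
  \<comment> \<open>The radius \<open>R + 1\<close> leaves the points of \<open>S\<close> in the
    interior, where difference quotients can be formed.\<close>
  obtain L where L: "\<And>x y. x \<in> cball 0 (R + 1) \<Longrightarrow> y \<in> cball 0 (R + 1) \<Longrightarrow> \<bar>Re (g x) - Re (g y)\<bar> \<le> L * norm (x - y)"
    using loc_lipschitzE[OF ll(1)] by metis
  obtain M where M: "\<And>x y. x \<in> cball 0 (R + 1) \<Longrightarrow> y \<in> cball 0 (R + 1) \<Longrightarrow> \<bar>Im (g x) - Im (g y)\<bar> \<le> M * norm (x - y)"
    using loc_lipschitzE[OF ll(2)] by metis
  obtain B where B: "\<And>x. x \<in> cball 0 R \<Longrightarrow> \<bar>Re (g x)\<bar> \<le> B" using loc_lipschitz_bounded[OF ll(1)] by metis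
  obtain B' where B': "\<And>x. x \<in> cball 0 R \<Longrightarrow> \<bar>Im (g x)\<bar> \<le> B'" using loc_lipschitz_bounded[OF ll(2)] by metis
  have cont: "continuous_on UNIV (\<lambda>z. Re (ddir v g z))" "continuous_on UNIV (\<lambda>z. Im (ddir v g z))"
    if "v \<in> coord_dirs" for v
    using coord_smooth_continuous[OF coord_smooth_ddir(2)[OF W(3) that]] by (auto intro: continuous_intros)
  have "(SUP z\<in>S. ennreal (cmod (f z)) +
      (\<Sum>j. ennreal ((cmod (d_hol j f z))\<^sup>2 + (cmod (d_anti j f z))\<^sup>2))) \<le> ennreal (B + B') + ennreal ((L\<^sup>2 + M\<^sup>2) / 2)"
  proof (rule SUP_least)
    fix z assume z: "z \<in> S"
    have zR: "z \<in> cball 0 R" "norm z < R + 1" using R[OF z] by auto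
    have "cmod (f z) \<le> B + B'"
      using W(2,4) z B[OF zR(1)] B'[OF zR(1)] cmod_le[of "g z"] by fastforce
    moreover have "(\<Sum>j. ennreal ((cmod (d_hol j f z))\<^sup>2 + (cmod (d_anti j f z))\<^sup>2)) \<le> ennreal ((L\<^sup>2 + M\<^sup>2) / 2)"
    proof (rule suminf_le_const[OF summableI])
      fix n
      let ?X = "\<lambda>j. ddir (x_dir j) g z" and ?Y = "\<lambda>j. ddir (y_dir j) g z"
      have eq: "(cmod (d_hol j f z))\<^sup>2 + (cmod (d_anti j f z))\<^sup>2
          = (((Re (?X j))\<^sup>2 + (Re (?Y j))\<^sup>2) + ((Im (?X j))\<^sup>2 + (Im (?Y j))\<^sup>2)) / 2" for j
      proof -
        have "ddir v f z = ddir v g z" for v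
          by (rule ddir_cong(2)[OF W(1) _ W(4)]) (use z W(2) in auto)
        then show ?thesis
          unfolding d_hol_def d_anti_def cmod_power2 by (simp add: power2_eq_square field_simps)
      qed
      have "(\<Sum>j<n. (Re (?X j))\<^sup>2 + (Re (?Y j))\<^sup>2) \<le> L\<^sup>2"
        by (rule gradient_bound[OF _ _ _ _ zR(2) L]) (auto intro: coord_smooth_ddir[OF W(3)] cont)
      moreover have "(\<Sum>j<n. (Im (?X j))\<^sup>2 + (Im (?Y j))\<^sup>2) \<le> M\<^sup>2"
        by (rule gradient_bound[OF _ _ _ _ zR(2) M]) (auto intro: coord_smooth_ddir[OF W(3)] cont)
      ultimately have "(\<Sum>j<n. (cmod (d_hol j f z))\<^sup>2 + (cmod (d_anti j f z))\<^sup>2) \<le> (L\<^sup>2 + M\<^sup>2) / 2"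
        unfolding eq sum_divide_distrib[symmetric] sum.distrib by simp
      then show "(\<Sum>j<n. ennreal ((cmod (d_hol j f z))\<^sup>2 + (cmod (d_anti j f z))\<^sup>2)) \<le> ennreal ((L\<^sup>2 + M\<^sup>2) / 2)"
        by (subst sum_ennreal) (auto intro: ennreal_leI)
    qed
    ultimately show "ennreal (cmod (f z)) + (\<Sum>j. ennreal ((cmod (d_hol j f z))\<^sup>2 + (cmod (d_anti j f z))\<^sup>2))
        \<le> ennreal (B + B') + ennreal ((L\<^sup>2 + M\<^sup>2) / 2)"
      by (intro add_mono ennreal_leI)
  qed
  also have "\<dots> < \<infinity>" by (simp add: ennreal_add_less_top less_top)
  finally show "(SUP z\<in>S. ennreal (cmod (f z)) +
      (\<Sum>j. ennreal ((cmod (d_hol j f z))\<^sup>2 + (cmod (d_anti j f z))\<^sup>2))) < \<infinity>" .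
qed

lemma unif_smooth_C_inf_F_inf:
  assumes "open V" "unif_smooth V f"
  shows "f \<in> C_inf_F_inf V"
  unfolding C_inf_F_inf_def C_inf_def
  using assms unif_smooth_Ck
  by (auto intro!: unif_smooth_C1_F unif_smooth_d_multi unif_smooth_d_hol unif_smooth_d_anti)

section \<open>Finite-dimensional slices\<close>

text \<open>Bolzano-Weierstrass by induction on the spanning set. A new vector \<open>v\<close> has
  positive distance \<open>d\<close> from the closed span of the others, so the coefficient of
  \<open>v\<close> in a vector \<open>x\<close> is at most \<open>norm x / d\<close>; a subsequence
  makes the coefficients converge, and the rest is covered by induction.\<close>

lemma span_subsequence:
  fixes x :: "nat \<Rightarrow> ell2"
  assumes "finite B" "range x \<subseteq> cvec.span B" "bounded (range x)"
  shows "\<exists>l\<in>cvec.span B. \<exists>r. strict_mono r \<and> (x \<circ> r) \<longlonglongrightarrow> l"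
  using assms
proof (induction B arbitrary: x)
  case empty
  then have "x = (\<lambda>_. 0)" by auto
  then show ?case using exI[of strict_mono "id :: nat \<Rightarrow> nat", OF strict_mono_id] by (simp add: o_def)
next
  case (insert v B)
  show ?case
  proof (cases "v \<in> cvec.span B")
    case True
    then show ?thesis using insert cvec.span_redundant by simp
  next
    case False
    \<comment> \<open>Convergent sequences are bounded, so the induction hypothesis gives a
      subsequence with limit in the span, and this is the limit of the whole sequence.\<close>
    have closed: "closed (cvec.span B)"
      unfolding closed_sequential_limits
    proof (intro allI impI, elim conjE)
      fix y l assume y: "\<forall>n. y n \<in> cvec.span B" "y \<longlonglongrightarrow> l"
      have "bounded (range y)" using convergent_imp_bounded y(2) convergentI by blast
      then obtain l' r where l': "l' \<in> cvec.span B" "strict_mono r" "(y \<circ> r) \<longlonglongrightarrow> l'"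
        using insert.IH[of y] y(1) by blast
      moreover have "(y \<circ> r) \<longlonglongrightarrow> l" using LIMSEQ_subseq_LIMSEQ[OF y(2) l'(2)] .
      ultimately show "l \<in> cvec.span B" using LIMSEQ_unique by metis
    qed
    define d where "d = infdist v (cvec.span B)"
    have d: "0 < d" unfolding d_def
      using infdist_pos_not_in_closed[OF closed _ False] cvec.span_zero[of B] by blast
    have "\<forall>n. x n \<in> cvec.span (insert v B)" using insert.prems(1) by blast
    then have "\<forall>n. \<exists>k. x n - k *\<^sub>C v \<in> cvec.span B"
      unfolding cvec.span_breakdown_eq .
    then obtain k where k: "\<And>n. x n - k n *\<^sub>C v \<in> cvec.span B" by metis
    obtain C where C: "\<And>n. norm (x n) \<le> C" using insert.prems(2) by (auto simp: bounded_iff)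
    have kC: "cmod (k n) \<le> C / d" for n
    proof (cases "k n = 0")
      case True
      then show ?thesis using C[of n] norm_ge_zero[of "x n"] d by (simp del: norm_ge_zero)
    next
      case False
      \<comment> \<open>\<open>v - ?b\<close> is \<open>x n\<close> divided by \<open>k n\<close>,
        so its norm is at least the distance of \<open>v\<close> from the span.\<close>
      let ?b = "- (inverse (k n) *\<^sub>C (x n - k n *\<^sub>C v))"
      have "?b \<in> cvec.span B" using k by (intro cvec.span_neg cvec.span_scale)
      then have "d \<le> dist v ?b" unfolding d_def by (rule infdist_le)
      also have "v - ?b = inverse (k n) *\<^sub>C x n"
        using False by (simp add: cvec.scale_right_diff_distrib)
      then have "dist v ?b = norm (x n) / cmod (k n)"
        by (simp add: dist_norm norm_scaleC norm_inverse divide_inverse mult.commute)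
      finally have "d * cmod (k n) \<le> norm (x n)" using False by (simp add: field_simps)
      then show ?thesis using C[of n] d by (simp add: field_simps)
    qed
    then have "bounded (range k)" by (auto simp: bounded_iff)
    then obtain l r where r: "strict_mono r" "(k \<circ> r) \<longlonglongrightarrow> l"
      using bounded_imp_convergent_subsequence by blast
    let ?y = "\<lambda>n. x (r n) - k (r n) *\<^sub>C v"
    have "norm (?y n) \<le> C + C / d * norm v" for n
    proof -
      have "norm (?y n) \<le> norm (x (r n)) + cmod (k (r n)) * norm v"
        using norm_triangle_ineq4[of "x (r n)" "k (r n) *\<^sub>C v"] by (simp add: norm_scaleC)
      also have "\<dots> \<le> C + C / d * norm v" by (intro add_mono C mult_right_mono kC) simp
      finally show ?thesis .
    qed
    then have "bounded (range ?y)" by (auto simp: bounded_iff)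
    then obtain m s where m: "m \<in> cvec.span B" "strict_mono s" "(?y \<circ> s) \<longlonglongrightarrow> m"
      using insert.IH[of ?y] k by blast
    have "(\<lambda>n. (?y \<circ> s) n + ((k \<circ> r) \<circ> s) n *\<^sub>C v) \<longlonglongrightarrow> m + l *\<^sub>C v"
      by (intro tendsto_add m(3) scaleC.tendsto LIMSEQ_subseq_LIMSEQ[OF r(2) m(2)] tendsto_const)
    then have "(x \<circ> (r \<circ> s)) \<longlonglongrightarrow> m + l *\<^sub>C v" by (simp add: o_def)
    moreover have "m + l *\<^sub>C v \<in> cvec.span (insert v B)"
      unfolding cvec.span_breakdown_eq by (rule exI[of _ l]) (simp add: m(1))
    ultimately show ?thesis using strict_mono_o[OF r(1) m(2)] by blast
  qed
qed

lemma finite_dim_csubspace_compact_closure: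
  assumes M: "finite_dim_csubspace M" and S: "S \<subseteq> M" "bounded S"
  shows "compact (closure S)" "closure S \<subseteq> M"
proof -
  obtain B where B: "finite B" "M = cvec.span B" using M by (auto simp: finite_dim_csubspace_def)
  have sub: "\<exists>l\<in>M. \<exists>r. strict_mono r \<and> (x \<circ> r) \<longlonglongrightarrow> l"
    if "range x \<subseteq> M" "bounded (range x)" for x :: "nat \<Rightarrow> ell2"
    using span_subsequence[OF B(1)] that B(2) by simp
  show cM: "closure S \<subseteq> M"
  proof
    fix l assume "l \<in> closure S"
    then obtain y where y: "\<forall>n. y n \<in> S" "y \<longlonglongrightarrow> l" by (auto simp: closure_sequential)
    have "bounded (range y)" by (rule bounded_subset[OF S(2)]) (use y(1) in auto)
    then obtain l' r where l': "l' \<in> M" "strict_mono r" "(y \<circ> r) \<longlonglongrightarrow> l'"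
      using sub[of y] y(1) S(1) by blast
    moreover have "(y \<circ> r) \<longlonglongrightarrow> l" using LIMSEQ_subseq_LIMSEQ[OF y(2) l'(2)] .
    ultimately show "l \<in> M" using LIMSEQ_unique by metis
  qed
  show "compact (closure S)"
    unfolding compact_def
  proof (intro allI impI)
    fix y :: "nat \<Rightarrow> ell2" assume y: "\<forall>n. y n \<in> closure S"
    have "bounded (range y)" by (rule bounded_subset[OF bounded_closure[OF S(2)]]) (use y in auto)
    then obtain l r where l: "strict_mono r" "(y \<circ> r) \<longlonglongrightarrow> l"
      using sub[of y] y cM by blast
    moreover have "l \<in> closure S"
      by (rule closed_sequentially[OF closed_closure _ l(2)]) (use y in auto)
    ultimately show "\<exists>l\<in>closure S. \<exists>r. strict_mono r \<and> (y \<circ> r) \<longlonglongrightarrow> l" by blast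
  qed
qed

section \<open>The two implications\<close>

text \<open>The exhaustion is restricted to each slice. Uniform inclusion keeps the closure of a
  sublevel set inside \<open>V\<close> and bounded, and bounded sets of a finite-dimensional slice
  have compact closure in it.\<close>

lemma pseudoconvex_domain_if_exhaustion:
  assumes V: "open V" "V \<noteq> {}" and ex: "exhaustion_function V \<eta>"
    and psh: "plurisubharmonic_on UNIV V \<eta>"
  shows "pseudoconvex_domain V"
proof -
  have "pseudoconvex_in M (V \<inter> M)" if M: "finite_dim_csubspace M" for M
  proof -
    have op: "openin (top_of_set M) (V \<inter> M)"
      using V(1) by (simp add: Int_commute openin_open_Int)
    have "plurisubharmonic_on M (V \<inter> M) \<eta>"
      using psh op unfolding plurisubharmonic_on_def by (auto intro: continuous_on_subset)
    moreover have "relatively_compact_in (V \<inter> M) {x \<in> V \<inter> M. \<eta> x < t}" for t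
    proof -
      let ?S = "{x \<in> V \<inter> M. \<eta> x < t}"
      have "uniformly_included {z \<in> V. \<eta> z \<le> t} V" using ex by (simp add: exhaustion_function_def)
      then obtain r where r: "0 < r" "{z \<in> V. \<eta> z \<le> t} \<subseteq> V" "bounded {z \<in> V. \<eta> z \<le> t}"
        "\<forall>z\<in>{z \<in> V. \<eta> z \<le> t}. \<forall>y. norm (y - z) < r \<longrightarrow> y \<in> V"
        using uniformly_includedD by blast
      have S: "?S \<subseteq> M" "bounded ?S" by (auto intro: bounded_subset[OF r(3)])
      have "closure ?S \<subseteq> V"
      proof
        fix x assume "x \<in> closure ?S"
        then obtain y where "y \<in> ?S" "dist y x < r" using r(1) closure_approachable by blast
        then have "y \<in> {z \<in> V. \<eta> z \<le> t}" "norm (x - y) < r"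
          by (auto simp: dist_norm norm_minus_commute)
        then show "x \<in> V" using r(4) by blast
      qed
      then show ?thesis
        using finite_dim_csubspace_compact_closure[OF M S] by (auto simp: relatively_compact_in_def)
    qed
    ultimately show ?thesis using op unfolding pseudoconvex_in_def by blast
  qed
  then show ?thesis using V by (simp add: pseudoconvex_domain_def)
qed

lemma exhaustion_if_pseudoconvex_domain:
  assumes "pseudoconvex_domain V"
  shows "\<exists>\<eta> :: ell2 \<Rightarrow> real. exhaustion_function V \<eta> \<and>
       (\<lambda>z. complex_of_real (\<eta> z)) \<in> C_inf_F_inf V \<and>
       plurisubharmonic_on UNIV V \<eta>"
proof -
  have V: "open V" using assms by (simp add: pseudoconvex_domain_def)
  obtain \<eta> h where h: "\<And>k n. smooth_along coord_dirs n (h k)"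
    and \<eta>h: "\<And>k z. z \<in> sublevel V (real k) \<Longrightarrow> \<eta> z = h k z"
    and \<eta>f: "\<And>z. z \<in> V \<Longrightarrow> log_exhaustion V z - 1 \<le> \<eta> z"
    and \<eta>: "continuous_on V \<eta>" "submean_on V \<eta>"
    using smooth_psh_exhaustion[OF V submean_on_log_exhaustion[OF assms]] by metis
  have "exhaustion_function V \<eta>"
    unfolding exhaustion_function_def
  proof
    fix t
    have f: "log_exhaustion V z \<le> t + 1" if "z \<in> V" "\<eta> z \<le> t" for z using \<eta>f[OF that(1)] that(2) by linarith
    show "uniformly_included {z \<in> V. \<eta> z \<le> t} V"
    proof (rule uniformly_includedI[OF V])
      show "bounded {z \<in> V. \<eta> z \<le> t}"
        unfolding bounded_iff using f log_exhaustion_bounds(2)[OF V] by (intro exI[of _ "t + 1"]) fastforce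
      fix z y assume z: "z \<in> {z \<in> V. \<eta> z \<le> t}" and y: "norm (y - z) < exp (- (t + 1))"
      have "log_exhaustion V z \<le> t + 1" using f z by blast
      then have "exp (- (t + 1)) \<le> exp (- log_exhaustion V z)" by simp
      also have "\<dots> \<le> inner_radius V z" using z log_exhaustion_bounds(3)[OF V] by simp
      finally show "y \<in> V" using y by (intro ball_inner_radius[of y z]) simp
    qed auto
  qed
  moreover have "unif_smooth V (\<lambda>z. complex_of_real (\<eta> z))"
    unfolding unif_smooth_def
  proof (intro allI impI)
    fix S assume "uniformly_included S V"
    then obtain r where r: "0 < r" "S \<subseteq> V" "bounded S" "\<forall>z\<in>S. \<forall>y. norm (y - z) < r \<longrightarrow> y \<in> V"
      using uniformly_includedD by blast
    obtain R where R: "\<And>z. z \<in> S \<Longrightarrow> norm z \<le> R" using r(3) by (auto simp: bounded_iff)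
    \<comment> \<open>Truncated at 1 like \<open>inner_radius\<close>, for which it is to be a lower
      bound on \<open>S\<close>.\<close>
    define r' where "r' = min r 1"
    have r': "0 < r'" using r(1) by (simp add: r'_def)
    \<comment> \<open>On \<open>S\<close> the function \<open>log_exhaustion\<close> is at most
      \<open>R - ln r'\<close>.\<close>
    obtain k :: nat where k: "R - ln r' < real k" using reals_Archimedean2 by blast
    have "S \<subseteq> sublevel V (real k)"
    proof
      fix z assume z: "z \<in> S"
      have "r' \<le> inner_radius V z" using r(4) z by (intro inner_radius_geI) (auto simp: r'_def)
      then have "ln r' \<le> ln (inner_radius V z)" using r' by simp
      then show "z \<in> sublevel V (real k)"
        using R[OF z] k z r(2) by (auto simp: sublevel_def log_exhaustion_def)
    qed
    moreover have "coord_smooth (\<lambda>z. of_real (h k z))"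
      unfolding coord_smooth_def by (simp add: h smooth_along_const)
    ultimately show "\<exists>W g. open W \<and> S \<subseteq> W \<and> coord_smooth g \<and> (\<forall>x\<in>W. complex_of_real (\<eta> x) = g x)"
      using open_sublevel(1)[OF V] \<eta>h
      by (intro exI[of _ "sublevel V (real k)"] exI[of _ "\<lambda>z. of_real (h k z)"]) auto
  qed
  ultimately show ?thesis
    using unif_smooth_C_inf_F_inf[OF V] V \<eta> unfolding plurisubharmonic_on_UNIV_iff by blast
qed

theorem corollary5p1:
  fixes V :: "ell2 set"
  assumes "open V" and "V \<noteq> {}"
  shows "pseudoconvex_domain V \<longleftrightarrow>
    (\<exists>\<eta> :: ell2 \<Rightarrow> real. exhaustion_function V \<eta> \<and>
       (\<lambda>z. complex_of_real (\<eta> z)) \<in> C_inf_F_inf V \<and>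
       plurisubharmonic_on UNIV V \<eta>)"
  using exhaustion_if_pseudoconvex_domain pseudoconvex_domain_if_exhaustion[OF assms] by blast

end
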